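(* Let $M$ and $N$ be connected compact complex manifolds with $\dim_{\mathbb{C}} N = n > m = \dim_{\mathbb{C}} M \geq 3$, let $f : N \to M$ be a holomorphic submersion, and let $a := n-m$ be the dimension of its fibres. Suppose $M$ is balanced. Let $X$ be any one of the four types $\mathrm{K}, \mathrm{WK}, \mathrm{S}, \mathrm{PL}$. If $N$ is $aX$, then it is also $(n-1)X$.
   Context: Transverse forms. On a complex manifold $N$ of dimension $n$, let $1\le p\le n-1$. A smooth real $(p,p)$-form $\Omega$ is strictly weakly positive (transverse) if at every point $x$ its restriction to every $p$-dimensional complex subspace of the holomorphic tangent space $T_xN$ is a strictly positive volume form. The four types. A compact complex manifold $N$ of dimension $n$ is said to be, for $1\le p\le n-1$: - $p\mathrm{K}$ ($p$-Kähler) if it has a transverse $(p,p)$-form $\Omega$ with $\partial\Omega=0$; - $p\mathrm{WK}$ (weakly $p$-Kähler) if it has a transverse $(p,p)$-form $\Omega$ with $\partial\Omega=\partial\overline\partial\alpha$ for some form $\alpha$; - $p\mathrm{S}$ ($p$-symplectic) if it has a real $2p$-form $\Psi$ with $d\Psi=0$ whose $(p,p)$-component is transverse; - $p\mathrm{PL}$ ($p$-pluriclosed) if it has a transverse $(p,p)$-form $\Omega$ with $\partial\overline\partial\Omega=0$. A compact complex manifold $M$ of dimension $m$ is balanced if it has a hermitian metric whose fundamental form $\omega$ satisfies $d\omega^{m-1}=0$ (equivalently, $M$ is $(m-1)\mathrm{K}$). *)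

theory Defs
  imports "HOL-Analysis.Analysis"
begin

section \<open>Smooth and holomorphic maps on open sets\<close>

text \<open>\<^term>\<open>S\<close> is always an open set below.\<close>

primrec Ck_on :: "nat \<Rightarrow> 'a set \<Rightarrow> ('a::real_normed_vector \<Rightarrow> 'b::real_normed_vector) \<Rightarrow> bool" where
  "Ck_on 0 S f \<longleftrightarrow> continuous_on S f"
| "Ck_on (Suc k) S f \<longleftrightarrow>
     (\<forall>x\<in>S. f differentiable (at x)) \<and> (\<forall>v. Ck_on k S (\<lambda>x. frechet_derivative f (at x) v))"

definition smooth_on :: "'a set \<Rightarrow> ('a::real_normed_vector \<Rightarrow> 'b::real_normed_vector) \<Rightarrow> bool" where
  "smooth_on S f \<longleftrightarrow> (\<forall>k. Ck_on k S f)"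

text \<open>
  The library's \<open>holomorphic_on\<close> covers one variable only.  As usual in several variables, a
  holomorphic map is a smooth map satisfying the Cauchy--Riemann equations, i.e. whose
  (a priori real-linear) differential is complex linear at every point.
\<close>

definition holo_map_on :: "(complex^'n::finite) set \<Rightarrow> (complex^'n \<Rightarrow> complex^'m::finite) \<Rightarrow> bool" where
  "holo_map_on S f \<longleftrightarrow> smooth_on S f \<and>
     (\<forall>x\<in>S. Vector_Spaces.linear (*s) (*s) (frechet_derivative f (at x)))"

section \<open>Compact complex manifolds and holomorphic submersions\<close>

type_synonym ('a, 'n) chart = "'a set \<times> ('a \<Rightarrow> complex^'n)"

abbreviation cdom :: "('a, 'n) chart \<Rightarrow> 'a set" where
  "cdom c \<equiv> fst c"

abbreviation cran :: "('a, 'n) chart \<Rightarrow> (complex^'n) set" where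
  "cran c \<equiv> snd c ` fst c"

definition in_charts :: "('a, 'n) chart \<Rightarrow> ('b, 'm) chart \<Rightarrow> ('a \<Rightarrow> 'b) \<Rightarrow> complex^'n \<Rightarrow> complex^'m" where
  "in_charts c c' f = (\<lambda>z. snd c' (f (inv_into (cdom c) (snd c) z)))"

text \<open>Second countability is automatic here, by compactness.\<close>

locale compact_complex_manifold =
  fixes T :: "'a topology" and A :: "('a, 'n::finite) chart set"
  assumes compact: "compact_space T"
    and hausdorff: "Hausdorff_space T"
    and cover: "(\<Union>c\<in>A. cdom c) = topspace T"
    and chart_openin: "c \<in> A \<Longrightarrow> openin T (cdom c)"
    and chart_open: "c \<in> A \<Longrightarrow> open (cran c)"
    and chart_homeo:
      "c \<in> A \<Longrightarrow> homeomorphic_map (subtopology T (cdom c)) (top_of_set (cran c)) (snd c)"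
    and transition:
      "c \<in> A \<Longrightarrow> c' \<in> A \<Longrightarrow> holo_map_on (snd c ` (cdom c \<inter> cdom c')) (in_charts c c' id)"

definition holomorphic_submersion ::
    "'a topology \<Rightarrow> ('a, 'n::finite) chart set \<Rightarrow> 'b topology \<Rightarrow> ('b, 'm::finite) chart set
      \<Rightarrow> ('a \<Rightarrow> 'b) \<Rightarrow> bool" where
  "holomorphic_submersion T A T' A' f \<longleftrightarrow> continuous_map T T' f \<and>
     (\<forall>c\<in>A. \<forall>c'\<in>A'. let S = snd c ` {x \<in> cdom c. f x \<in> cdom c'} in
        holo_map_on S (in_charts c c' f) \<and>
        (\<forall>z\<in>S. surj (frechet_derivative (in_charts c c' f) (at z))))"

section \<open>Exterior algebra of the real vector space underlying complex n-space\<close>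

text \<open>
  A complex-valued \<^term>\<open>k\<close>-covector is a function of a sequence of vectors that depends on the
  entries with index below \<^term>\<open>k\<close> only, and is real-multilinear and alternating in those.
  The complex structure of the real tangent space is multiplication by \<^term>\<open>\<i>\<close>; complex subspaces
  of the holomorphic tangent space are identified with the subspaces of \<open>complex^'n\<close> over the
  complex numbers in the usual way.
\<close>

type_synonym 'n covec = "(nat \<Rightarrow> complex^'n) \<Rightarrow> complex"

definition k_covector :: "nat \<Rightarrow> 'n::finite covec \<Rightarrow> bool" where
  "k_covector k \<eta> \<longleftrightarrow>
     (\<forall>v w. (\<forall>i<k. v i = w i) \<longrightarrow> \<eta> v = \<eta> w) \<and>
     (\<forall>v. \<forall>i<k. linear (\<lambda>x. \<eta> (v(i := x)))) \<and>
     (\<forall>v. \<forall>i<k. \<forall>j<k. i \<noteq> j \<longrightarrow> v i = v j \<longrightarrow> \<eta> v = 0)"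

definition wedge :: "nat \<Rightarrow> nat \<Rightarrow> 'n::finite covec \<Rightarrow> 'n covec \<Rightarrow> 'n covec" where
  "wedge k l \<eta> \<theta> = (\<lambda>v.
     (\<Sum>s | s permutes {..<k + l}.
        of_int (sign s) * \<eta> (\<lambda>i. v (s i)) * \<theta> (\<lambda>i. v (s (k + i)))) / (fact k * fact l))"

text \<open>Powers of a 2-covector.\<close>

primrec wedge_power :: "'n::finite covec \<Rightarrow> nat \<Rightarrow> 'n covec" where
  "wedge_power \<eta> 0 = (\<lambda>v. 1)"
| "wedge_power \<eta> (Suc k) = wedge 2 (2 * k) \<eta> (wedge_power \<eta> k)"

text \<open>
  The complex-multilinear extension of a \<^term>\<open>k\<close>-covector to the complexified tangent space, whose
  elements \<open>x + i y\<close> are represented by pairs \<^term>\<open>(x, y)\<close>.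
\<close>

definition complexify :: "nat \<Rightarrow> 'n::finite covec \<Rightarrow> (nat \<Rightarrow> (complex^'n) \<times> (complex^'n)) \<Rightarrow> complex" where
  "complexify k \<eta> w =
     (\<Sum>I\<in>Pow {..<k}. \<i> ^ card I * \<eta> (\<lambda>j. if j \<in> I then snd (w j) else fst (w j)))"

text \<open>
  The (1,0)-part \<open>(v - i J v) / 2\<close> and the (0,1)-part \<open>(v + i J v) / 2\<close> of a real tangent
  vector, \<open>J\<close> being multiplication by \<^term>\<open>\<i>\<close> on \<open>complex^'n\<close>.
\<close>

definition part10 :: "complex^'n::finite \<Rightarrow> (complex^'n) \<times> (complex^'n)" where
  "part10 v = ((1/2) *\<^sub>R v, - ((1/2) *\<^sub>R (\<i> *s v)))"

definition part01 :: "complex^'n::finite \<Rightarrow> (complex^'n) \<times> (complex^'n)" where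
  "part01 v = ((1/2) *\<^sub>R v, (1/2) *\<^sub>R (\<i> *s v))"

text \<open>The (p,q)-component of a \<open>(p+q)\<close>-covector.\<close>

definition bideg :: "nat \<Rightarrow> nat \<Rightarrow> 'n::finite covec \<Rightarrow> 'n covec" where
  "bideg p q \<eta> = (\<lambda>v. \<Sum>I | I \<subseteq> {..<p + q} \<and> card I = p.
     complexify (p + q) \<eta> (\<lambda>j. if j \<in> I then part10 (v j) else part01 (v j)))"

text \<open>
  The restriction of a real \<open>2p\<close>-covector to a \<^term>\<open>p\<close>-dimensional complex subspace \<^term>\<open>V\<close> is a
  strictly positive volume form: it is positive on each basis
  \<open>e\<^sub>0, i e\<^sub>0, e\<^sub>1, i e\<^sub>1, \<dots>\<close> (the canonical orientation of \<^term>\<open>V\<close>).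
\<close>

definition positive_volume_on :: "nat \<Rightarrow> 'n::finite covec \<Rightarrow> (complex^'n) set \<Rightarrow> bool" where
  "positive_volume_on p \<eta> V \<longleftrightarrow>
     (\<forall>e. inj_on e {..<p} \<and> vec.independent (e ` {..<p}) \<and> vec.span (e ` {..<p}) = V \<longrightarrow>
        Re (\<eta> (\<lambda>i. if even i then e (i div 2) else \<i> *s e (i div 2))) > 0)"

definition strictly_weakly_positive :: "nat \<Rightarrow> 'n::finite covec \<Rightarrow> bool" where
  "strictly_weakly_positive p \<eta> \<longleftrightarrow>
     (\<forall>V. vec.subspace V \<and> vec.dim V = p \<longrightarrow> positive_volume_on p \<eta> V)"

section \<open>Differential forms\<close>

text \<open>
  A form is given by its expressions in the charts of the atlas; two expressions are related by
  pullback along the transition map.  Values outside the range of a chart are irrelevant,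
  which is why equality of forms is \<open>form_eq\<close> rather than equality of functions.
\<close>

type_synonym 'n lform = "complex^'n \<Rightarrow> 'n covec"

type_synonym ('a, 'n) form = "('a, 'n) chart \<Rightarrow> 'n lform"

definition smooth_form :: "('a, 'n::finite) chart set \<Rightarrow> nat \<Rightarrow> ('a, 'n) form \<Rightarrow> bool" where
  "smooth_form A k \<omega> \<longleftrightarrow>
     (\<forall>c\<in>A. (\<forall>z\<in>cran c. k_covector k (\<omega> c z)) \<and> (\<forall>v. smooth_on (cran c) (\<lambda>z. \<omega> c z v))) \<and>
     (\<forall>c\<in>A. \<forall>c'\<in>A. \<forall>z \<in> snd c ` (cdom c \<inter> cdom c'). \<forall>v.
        \<omega> c z v =
        \<omega> c' (in_charts c c' id z) (\<lambda>i. frechet_derivative (in_charts c c' id) (at z) (v i)))"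

definition form_eq :: "('a, 'n::finite) chart set \<Rightarrow> ('a, 'n) form \<Rightarrow> ('a, 'n) form \<Rightarrow> bool" where
  "form_eq A \<omega> \<omega>' \<longleftrightarrow> (\<forall>c\<in>A. \<forall>z\<in>cran c. \<omega> c z = \<omega>' c z)"

abbreviation zero_form :: "('a, 'n::finite) form" where
  "zero_form \<equiv> \<lambda>c z v. 0"

definition real_form :: "('a, 'n::finite) chart set \<Rightarrow> ('a, 'n) form \<Rightarrow> bool" where
  "real_form A \<omega> \<longleftrightarrow> (\<forall>c\<in>A. \<forall>z\<in>cran c. \<forall>v. \<omega> c z v \<in> \<real>)"

text \<open>The (p,q)-component of a \<open>(p+q)\<close>-form.\<close>

definition form_component :: "nat \<Rightarrow> nat \<Rightarrow> ('a, 'n::finite) form \<Rightarrow> ('a, 'n) form" where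
  "form_component p q \<omega> = (\<lambda>c z. bideg p q (\<omega> c z))"

text \<open>Exterior derivative of a \<^term>\<open>k\<close>-form:
  \<open>d\<eta>(v\<^sub>0,\<dots>,v\<^sub>k) = \<Sum>\<^sub>i (-1)^i D(\<eta>(v\<^sub>0,\<dots>,v\<^sub>i omitted,\<dots>,v\<^sub>k))[v\<^sub>i]\<close> for constant fields \<open>v\<^sub>i\<close>.\<close>

definition ext_deriv :: "nat \<Rightarrow> 'n::finite lform \<Rightarrow> 'n lform" where
  "ext_deriv k \<eta> = (\<lambda>z v. \<Sum>i\<le>k. (-1) ^ i *
     frechet_derivative (\<lambda>y. \<eta> y (\<lambda>j. if j < i then v j else v (Suc j))) (at z) (v i))"

definition form_d :: "nat \<Rightarrow> ('a, 'n::finite) form \<Rightarrow> ('a, 'n) form" where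
  "form_d k \<omega> = (\<lambda>c. ext_deriv k (\<omega> c))"

text \<open>On (p,q)-forms, the Dolbeault operators are the components of \<open>d\<close> of type (p+1,q) and (p,q+1).\<close>

definition form_del :: "nat \<Rightarrow> ('a, 'n::finite) form \<Rightarrow> ('a, 'n) form" where
  "form_del k \<omega> = (\<lambda>c z v. \<Sum>p\<le>k.
     form_component (Suc p) (k - p) (form_d k (form_component p (k - p) \<omega>)) c z v)"

definition form_delbar :: "nat \<Rightarrow> ('a, 'n::finite) form \<Rightarrow> ('a, 'n) form" where
  "form_delbar k \<omega> = (\<lambda>c z v. \<Sum>p\<le>k.
     form_component p (Suc (k - p)) (form_d k (form_component p (k - p) \<omega>)) c z v)"

section \<open>Transverse forms and the four types\<close>

definition transverse_form :: "('a, 'n::finite) chart set \<Rightarrow> nat \<Rightarrow> ('a, 'n) form \<Rightarrow> bool" where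
  "transverse_form A p \<Omega> \<longleftrightarrow>
     smooth_form A (2 * p) \<Omega> \<and> real_form A \<Omega> \<and> form_eq A (form_component p p \<Omega>) \<Omega> \<and>
     (\<forall>c\<in>A. \<forall>z\<in>cran c. strictly_weakly_positive p (\<Omega> c z))"

definition p_kaehler :: "('a, 'n::finite) chart set \<Rightarrow> nat \<Rightarrow> bool" where
  "p_kaehler A p \<longleftrightarrow>
     (\<exists>\<Omega>. transverse_form A p \<Omega> \<and> form_eq A (form_del (2 * p) \<Omega>) zero_form)"

definition weakly_p_kaehler :: "('a, 'n::finite) chart set \<Rightarrow> nat \<Rightarrow> bool" where
  "weakly_p_kaehler A p \<longleftrightarrow>
     (\<exists>\<Omega> \<alpha>. transverse_form A p \<Omega> \<and> smooth_form A (2 * p - 1) \<alpha> \<and>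
        form_eq A (form_del (2 * p) \<Omega>) (form_del (2 * p) (form_delbar (2 * p - 1) \<alpha>)))"

definition p_symplectic :: "('a, 'n::finite) chart set \<Rightarrow> nat \<Rightarrow> bool" where
  "p_symplectic A p \<longleftrightarrow>
     (\<exists>\<Psi>. smooth_form A (2 * p) \<Psi> \<and> real_form A \<Psi> \<and>
        form_eq A (form_d (2 * p) \<Psi>) zero_form \<and> transverse_form A p (form_component p p \<Psi>))"

definition p_pluriclosed :: "('a, 'n::finite) chart set \<Rightarrow> nat \<Rightarrow> bool" where
  "p_pluriclosed A p \<longleftrightarrow>
     (\<exists>\<Omega>. transverse_form A p \<Omega> \<and>
        form_eq A (form_del (2 * p + 1) (form_delbar (2 * p) \<Omega>)) zero_form)"

datatype p_type = Type_K | Type_WK | Type_S | Type_PL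

primrec has_p_type :: "p_type \<Rightarrow> nat \<Rightarrow> ('a, 'n::finite) chart set \<Rightarrow> bool" where
  "has_p_type Type_K p A \<longleftrightarrow> p_kaehler A p"
| "has_p_type Type_WK p A \<longleftrightarrow> weakly_p_kaehler A p"
| "has_p_type Type_S p A \<longleftrightarrow> p_symplectic A p"
| "has_p_type Type_PL p A \<longleftrightarrow> p_pluriclosed A p"

section \<open>Balanced manifolds\<close>

text \<open>A smooth hermitian metric, given by its chart expressions; linear in the first argument.\<close>

definition hermitian_metric ::
    "('a, 'n::finite) chart set \<Rightarrow>
      (('a, 'n) chart \<Rightarrow> complex^'n \<Rightarrow> complex^'n \<Rightarrow> complex^'n \<Rightarrow> complex) \<Rightarrow> bool" where
  "hermitian_metric A h \<longleftrightarrow>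
     (\<forall>c\<in>A. \<forall>z\<in>cran c.
        (\<forall>w. Vector_Spaces.linear (*s) (*) (\<lambda>u. h c z u w)) \<and>
        (\<forall>u w. h c z w u = cnj (h c z u w)) \<and>
        (\<forall>u. u \<noteq> 0 \<longrightarrow> Re (h c z u u) > 0)) \<and>
     (\<forall>c\<in>A. \<forall>u w. smooth_on (cran c) (\<lambda>z. h c z u w)) \<and>
     (\<forall>c\<in>A. \<forall>c'\<in>A. \<forall>z \<in> snd c ` (cdom c \<inter> cdom c'). \<forall>u w.
        let \<tau> = in_charts c c' id; D = frechet_derivative \<tau> (at z)
        in h c z u w = h c' (\<tau> z) (D u) (D w))"

definition fundamental_form ::
    "(('a, 'n::finite) chart \<Rightarrow> complex^'n \<Rightarrow> complex^'n \<Rightarrow> complex^'n \<Rightarrow> complex) \<Rightarrow> ('a, 'n) form" where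
  "fundamental_form h = (\<lambda>c z v. - complex_of_real (Im (h c z (v 0) (v 1))))"

definition balanced :: "('a, 'm::finite) chart set \<Rightarrow> bool" where
  "balanced A \<longleftrightarrow>
     (\<exists>h. hermitian_metric A h \<and>
        form_eq A
          (form_d (2 * (CARD('m) - 1)) (\<lambda>c z. wedge_power (fundamental_form h c z) (CARD('m) - 1)))
          zero_form)"

end

theory Submission
  imports Defs
begin

text \<open>
  Let \<open>q = m - 1\<close>, let \<open>\<omega>\<close> be the balanced fundamental form on \<open>M\<close> and \<open>\<theta> = f\<^sup>* \<omega>\<^sup>q\<close>, a real closed form of
  type \<open>(q,q)\<close>.  If \<open>\<Omega>\<close> witnesses that \<open>N\<close> is \<open>aX\<close>, then \<open>\<Omega> \<and> \<theta>\<close> witnesses that \<open>N\<close> is \<open>(a+q)X\<close>, and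
  \<open>a + q = n - 1\<close>.  The differential conditions are inherited because wedging with a closed form of type
  \<open>(q,q)\<close> commutes with \<open>d\<close>, \<open>\<partial>\<close> and its conjugate.

  For transversality, at each point \<open>f\<^sup>* \<omega>\<close> is a sum of terms \<open>i/2 \<beta> \<and> cnj \<beta>\<close> whose common kernel \<open>K = ker df\<close> has
  dimension \<open>a\<close>.  Evaluating \<open>\<eta> \<and> i/2 \<beta> \<and> cnj \<beta>\<close> on a subspace \<open>V\<close> gives a positive multiple of the value of
  \<open>\<eta>\<close> on \<open>V \<inter> ker \<beta>\<close>, or zero if \<open>\<beta>\<close> vanishes on \<open>V\<close>.  So wedging \<open>q\<close> times preserves nonnegativity, and strict
  positivity on all \<open>V\<close> with \<open>dim (V \<inter> K) \<le> a\<close>, which is no restriction.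
\<close>

text \<open>Transversality is weak positivity, and a product of weakly positive forms need not be
  weakly positive. What saves the product here is that the second factor is a power of a sum of
  squares of linear forms: it can be removed one square at a time, each square cutting the subspace
  by a hyperplane. The degree a is critical, since it bounds the dimension of a subspace on which
  all these linear forms vanish; while more than a dimensions remain, some square contributes
  strictly.

  A balanced metric need not be Kaehler. Only the power of its fundamental form is closed, so
  closedness has to be pulled back for the power itself; the Leibniz rule reduces this to degree
  two, where it rests on the symmetry of second derivatives.

  Components of type (p,r) are treated as weights: when a unit complex number u multiplies all
  arguments, the component of type (p,r) acquires the factor u^p cnj(u)^r. A form of type (q,q) is
  fixed by this action, which is why multiplication by it shifts bidegrees by (q,q).\<close>

section \<open>Smooth maps\<close>

lemma Ck_on_cong:
  assumes "open S" "\<And>x. x \<in> S \<Longrightarrow> f x = g x"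
  shows "Ck_on k S f \<longleftrightarrow> Ck_on k S g"
  using assms(2)
proof (induction k arbitrary: f g)
  case 0
  then show ?case by (auto intro: continuous_on_cong)
next
  case (Suc k)
  have hd: "(f has_derivative D) (at x) \<longleftrightarrow> (g has_derivative D) (at x)" if "x \<in> S" for x D
    using has_derivative_transform_within_open[OF _ assms(1) that, of f D UNIV g]
      has_derivative_transform_within_open[OF _ assms(1) that, of g D UNIV f] Suc.prems by auto
  have d: "f differentiable (at x) \<longleftrightarrow> g differentiable (at x)" if "x \<in> S" for x
    using hd[OF that] unfolding differentiable_def by simp
  have e: "frechet_derivative f (at x) v = frechet_derivative g (at x) v" if "x \<in> S" for x v
    using hd[OF that] unfolding frechet_derivative_def by simp
  show ?case using Suc.IH[OF e] d by simp
qed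

lemma frechet_derivative_cong_open:
  assumes "open S" "x \<in> S" "\<And>x. x \<in> S \<Longrightarrow> f x = g x"
  shows "frechet_derivative f (at x) = frechet_derivative g (at x)"
proof -
  have "(f has_derivative D) (at x) \<longleftrightarrow> (g has_derivative D) (at x)" for D
    using has_derivative_transform_within_open[OF _ assms(1,2), of f D UNIV g]
      has_derivative_transform_within_open[OF _ assms(1,2), of g D UNIV f] assms(3) by auto
  then show ?thesis unfolding frechet_derivative_def by simp
qed

lemma Ck_on_SucD: "Ck_on (Suc k) S f \<Longrightarrow> Ck_on k S f"
proof (induction k arbitrary: f)
  case 0
  then show ?case
    by (auto intro!: continuous_at_imp_continuous_on differentiable_imp_continuous_within)
next
  case (Suc k)
  then show ?case by simp
qed

text \<open>Needed because the pullback of a form on the base is expressed through different charts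
  of the base near different points, so its smoothness is only visible locally.\<close>

lemma Ck_on_local:
  assumes "\<And>x. x \<in> S \<Longrightarrow> \<exists>U. open U \<and> x \<in> U \<and> Ck_on k U f"
  shows "Ck_on k S f"
  using assms
proof (induction k arbitrary: f)
  case 0
  then show ?case
    by (metis Ck_on.simps(1) continuous_at_imp_continuous_on continuous_on_eq_continuous_at)
next
  case (Suc k)
  then show ?case by (simp) (metis (no_types, lifting))
qed

lemma Ck_on_const: "Ck_on k S (\<lambda>x. c)"
  by (induction k arbitrary: c) (auto simp: frechet_derivative_const)

lemma Ck_on_add:
  assumes "open S" "Ck_on k S f" "Ck_on k S g"
  shows "Ck_on k S (\<lambda>x. f x + g x)"
  using assms(2,3)
proof (induction k arbitrary: f g)
  case 0
  then show ?case by (auto intro: continuous_on_add)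
next
  case (Suc k)
  have D: "((\<lambda>x. f x + g x) has_derivative (\<lambda>v. frechet_derivative f (at x) v + frechet_derivative g (at x) v)) (at x)"
    if "x \<in> S" for x
    using that Suc.prems by (intro has_derivative_add) (auto simp: frechet_derivative_works[symmetric])
  have "Ck_on k S (\<lambda>x. frechet_derivative (\<lambda>x. f x + g x) (at x) v)" for v
    using Suc.prems
    by (subst Ck_on_cong[OF assms(1)], subst frechet_derivative_at[OF D, symmetric]) (auto intro!: Suc.IH)
  with Suc.prems show ?case by auto
qed

lemma Ck_on_bilinear:
  assumes "bounded_bilinear p" "open S" "Ck_on k S f" "Ck_on k S g"
  shows "Ck_on k S (\<lambda>x. p (f x) (g x))"
  using assms(3,4)
proof (induction k arbitrary: f g)
  case 0
  then show ?case using bounded_bilinear.continuous_on[OF assms(1)] by auto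
next
  case (Suc k)
  have D: "((\<lambda>x. p (f x) (g x)) has_derivative
      (\<lambda>v. p (f x) (frechet_derivative g (at x) v) + p (frechet_derivative f (at x) v) (g x))) (at x)"
    if "x \<in> S" for x
    using that Suc.prems
    by (intro bounded_bilinear.FDERIV[OF assms(1)]) (auto simp: frechet_derivative_works[symmetric])
  \<comment> \<open>The product rule leaves one factor undifferentiated. The induction hypothesis
    wants that factor in class k, and \<open>Ck_on_SucD\<close> lowers it from class Suc k.\<close>
  have "Ck_on k S (\<lambda>x. frechet_derivative (\<lambda>x. p (f x) (g x)) (at x) v)" for v
    using Suc.prems Ck_on_SucD[OF Suc.prems(1)] Ck_on_SucD[OF Suc.prems(2)]
    by (subst Ck_on_cong[OF assms(2)], subst frechet_derivative_at[OF D, symmetric])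
      (auto intro!: Ck_on_add assms Suc.IH)
  moreover have "(\<lambda>x. p (f x) (g x)) differentiable (at x)" if "x \<in> S" for x
    using D[OF that] unfolding differentiable_def by blast
  ultimately show ?case by auto
qed

lemma Ck_on_linear:
  assumes "bounded_linear L" "open S" "Ck_on k S f"
  shows "Ck_on k S (\<lambda>x. L (f x))"
  using assms(3)
proof (induction k arbitrary: f)
  case 0
  then show ?case using bounded_linear.continuous_on[OF assms(1)] by auto
next
  case (Suc k)
  have D: "((\<lambda>x. L (f x)) has_derivative (\<lambda>v. L (frechet_derivative f (at x) v))) (at x)"
    if "x \<in> S" for x
    using that Suc.prems
    by (intro bounded_linear.has_derivative[OF assms(1)]) (auto simp: frechet_derivative_works[symmetric])
  have "Ck_on k S (\<lambda>x. frechet_derivative (\<lambda>x. L (f x)) (at x) v)" for v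
    using Suc.prems
    by (subst Ck_on_cong[OF assms(2)], subst frechet_derivative_at[OF D, symmetric])
      (auto intro!: Suc.IH)
  moreover have "(\<lambda>x. L (f x)) differentiable (at x)" if "x \<in> S" for x
    using D[OF that] unfolding differentiable_def by blast
  ultimately show ?case by auto
qed

lemma Ck_on_sum:
  assumes "open S" "\<And>i. i \<in> I \<Longrightarrow> Ck_on k S (f i)"
  shows "Ck_on k S (\<lambda>x. \<Sum>i\<in>I. f i x)"
  using assms(2)
  by (induction I rule: infinite_finite_induct) (auto intro: Ck_on_const Ck_on_add assms(1))

lemma linear_euclidean_expand:
  fixes L :: "'b::euclidean_space \<Rightarrow> 'c::real_vector"
  assumes "linear L"
  shows "L x = (\<Sum>b\<in>Basis. (x \<bullet> b) *\<^sub>R L b)"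
  by (subst euclidean_representation[of x, symmetric])
    (simp only: linear_sum[OF assms] linear_scale[OF assms])

text \<open>\<open>Ck_on\<close> controls the derivative of g only in fixed directions, whereas the
  chain rule evaluates it in the moving direction DF(x)v. Expanding that direction in a basis gives
  scalar functions times derivatives of g in fixed directions, which is why the middle space is
  Euclidean.\<close>

lemma Ck_on_compose:
  fixes g :: "'b::euclidean_space \<Rightarrow> 'c::real_normed_vector" and F :: "'a::real_normed_vector \<Rightarrow> 'b"
  assumes "open S" "open T" "\<And>x. x \<in> S \<Longrightarrow> F x \<in> T" "Ck_on k S F" "Ck_on k T g"
  shows "Ck_on k S (\<lambda>x. g (F x))"
  using assms(4,5)
proof (induction k arbitrary: g)
  case 0
  then show ?case using assms(3)
    by (auto intro!: continuous_on_compose2[of T g S F])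
next
  case (Suc k)
  have D: "((\<lambda>x. g (F x)) has_derivative
      (\<lambda>v. frechet_derivative g (at (F x)) (frechet_derivative F (at x) v))) (at x)"
    if "x \<in> S" for x
    using that Suc.prems assms(3)
    by (intro has_derivative_compose[of F _ x UNIV g, simplified])
      (auto simp: frechet_derivative_works[symmetric])
  have D': "frechet_derivative (\<lambda>x. g (F x)) (at x) v = 
      (\<Sum>b\<in>Basis. (frechet_derivative F (at x) v \<bullet> b) *\<^sub>R frechet_derivative g (at (F x)) b)"
    if "x \<in> S" for x v
    using that Suc.prems assms(3)
    by (subst frechet_derivative_at[OF D, symmetric])
      (auto intro!: linear_euclidean_expand linear_frechet_derivative)
  have "Ck_on k S (\<lambda>x. frechet_derivative (\<lambda>x. g (F x)) (at x) v)" for v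
  proof (subst Ck_on_cong[OF assms(1) D'], assumption, intro Ck_on_sum assms(1))
    fix b :: 'b assume "b \<in> Basis"
    show "Ck_on k S (\<lambda>x. (frechet_derivative F (at x) v \<bullet> b) *\<^sub>R frechet_derivative g (at (F x)) b)"
      using Suc.prems Ck_on_SucD[OF Suc.prems(1)]
      by (intro Ck_on_bilinear[OF bounded_bilinear_scaleR] assms(1)
        Ck_on_linear[OF bounded_linear_inner_left] Suc.IH) auto
  qed
  moreover have "(\<lambda>x. g (F x)) differentiable (at x)" if "x \<in> S" for x
    using D[OF that] unfolding differentiable_def by blast
  ultimately show ?case by auto
qed

lemma smooth_on_cong: "open S \<Longrightarrow> (\<And>x. x \<in> S \<Longrightarrow> f x = g x) \<Longrightarrow> smooth_on S f \<longleftrightarrow> smooth_on S g"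
  unfolding smooth_on_def using Ck_on_cong by blast

lemma smooth_on_local:
  assumes "\<And>x. x \<in> S \<Longrightarrow> \<exists>U. open U \<and> x \<in> U \<and> smooth_on U f"
  shows "smooth_on S f"
  using assms unfolding smooth_on_def by (intro allI Ck_on_local) meson

lemma smooth_on_const: "smooth_on S (\<lambda>x. c)"
  by (simp add: smooth_on_def Ck_on_const)

lemma smooth_on_sum: "open S \<Longrightarrow> (\<And>i. i \<in> I \<Longrightarrow> smooth_on S (f i)) \<Longrightarrow> smooth_on S (\<lambda>x. \<Sum>i\<in>I. f i x)"
  by (simp add: smooth_on_def Ck_on_sum)

lemma smooth_on_bilinear:
  "bounded_bilinear p \<Longrightarrow> open S \<Longrightarrow> smooth_on S f \<Longrightarrow> smooth_on S g \<Longrightarrow> smooth_on S (\<lambda>x. p (f x) (g x))"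
  by (simp add: smooth_on_def Ck_on_bilinear)

lemmas smooth_on_mult = smooth_on_bilinear[OF bounded_bilinear_mult]

lemma smooth_on_linear:
  "bounded_linear L \<Longrightarrow> open S \<Longrightarrow> smooth_on S f \<Longrightarrow> smooth_on S (\<lambda>x. L (f x))"
  by (simp add: smooth_on_def Ck_on_linear)

lemma smooth_on_compose:
  fixes g :: "'b::euclidean_space \<Rightarrow> 'c::real_normed_vector" and F :: "'a::real_normed_vector \<Rightarrow> 'b"
  assumes "open S" "open T" "\<And>x. x \<in> S \<Longrightarrow> F x \<in> T" "smooth_on S F" "smooth_on T g"
  shows "smooth_on S (\<lambda>x. g (F x))"
  using assms unfolding smooth_on_def by (auto intro: Ck_on_compose)

lemma smooth_on_differentiable: "smooth_on S f \<Longrightarrow> x \<in> S \<Longrightarrow> f differentiable (at x)"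
  unfolding smooth_on_def by (metis Ck_on.simps(2))

lemma smooth_on_frechet_derivative:
  "smooth_on S f \<Longrightarrow> smooth_on S (\<lambda>x. frechet_derivative f (at x) v)"
  unfolding smooth_on_def by (metis Ck_on.simps(2))

lemma smooth_on_continuous_on: "smooth_on S f \<Longrightarrow> continuous_on S f"
  unfolding smooth_on_def by (metis Ck_on.simps(1))

section \<open>Symmetry of second derivatives\<close>

lemma second_difference_mean_value:
  fixes g :: "'a::real_normed_vector \<Rightarrow> real"
  assumes "0 < h" "\<And>s t. 0 \<le> s \<Longrightarrow> s \<le> h \<Longrightarrow> 0 \<le> t \<Longrightarrow> t \<le> h \<Longrightarrow> x + s *\<^sub>R v + t *\<^sub>R w \<in> S"
    and "\<And>y. y \<in> S \<Longrightarrow> g differentiable (at y)"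
    and "\<And>y. y \<in> S \<Longrightarrow> (\<lambda>y. frechet_derivative g (at y) v) differentiable (at y)"
  obtains s t where "0 < s" "s < h" "0 < t" "t < h"
    "g (x + h *\<^sub>R v + h *\<^sub>R w) - g (x + h *\<^sub>R v) - g (x + h *\<^sub>R w) + g x
      = h\<^sup>2 * frechet_derivative (\<lambda>y. frechet_derivative g (at y) v) (at (x + s *\<^sub>R v + t *\<^sub>R w)) w"
proof -
  define D where "D y = frechet_derivative g (at y)" for y
  define E where "E y = frechet_derivative (\<lambda>y. D y v) (at y)" for y
  have D: "(g has_derivative D y) (at y)" if "y \<in> S" for y
    using assms(3)[OF that] by (simp add: D_def frechet_derivative_works[symmetric])
  have E: "((\<lambda>y. D y v) has_derivative E y) (at y)" if "y \<in> S" for y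
    using assms(4)[OF that] by (simp add: D_def E_def frechet_derivative_works[symmetric])
  have 1: "((\<lambda>s. g (x + s *\<^sub>R v + t *\<^sub>R w)) has_real_derivative D (x + s *\<^sub>R v + t *\<^sub>R w) v) (at s)"
    if "0 \<le> s" "s \<le> h" "0 \<le> t" "t \<le> h" for s t
  proof -
    have "((\<lambda>s. g (x + s *\<^sub>R v + t *\<^sub>R w)) has_derivative (\<lambda>r. D (x + s *\<^sub>R v + t *\<^sub>R w) (r *\<^sub>R v))) (at s)"
      by (rule has_derivative_compose[of "\<lambda>s. x + s *\<^sub>R v + t *\<^sub>R w" _ s UNIV g, simplified])
        (auto intro!: derivative_eq_intros D assms that)
    then show ?thesis
      using linear_scale[OF has_derivative_linear[OF D[OF assms(2)[OF that]]]]
      by (simp add: has_field_derivative_def mult_commute_abs)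
  qed
  have 2: "((\<lambda>t. D (x + s *\<^sub>R v + t *\<^sub>R w) v) has_real_derivative E (x + s *\<^sub>R v + t *\<^sub>R w) w) (at t)"
    if "0 \<le> s" "s \<le> h" "0 \<le> t" "t \<le> h" for s t
  proof -
    have "((\<lambda>t. D (x + s *\<^sub>R v + t *\<^sub>R w) v) has_derivative (\<lambda>r. E (x + s *\<^sub>R v + t *\<^sub>R w) (r *\<^sub>R w))) (at t)"
      by (rule has_derivative_compose[of "\<lambda>t. x + s *\<^sub>R v + t *\<^sub>R w" _ t UNIV "\<lambda>y. D y v", simplified])
        (auto intro!: derivative_eq_intros E assms that)
    then show ?thesis
      using linear_scale[OF has_derivative_linear[OF E[OF assms(2)[OF that]]]]
      by (simp add: has_field_derivative_def mult_commute_abs)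
  qed
  \<comment> \<open>Mean value theorem in direction v for the difference of g along two parallel
    segments; a second application, in direction w, follows. The explicit zero multiples keep all
    points in the shape of facts 1 and 2.\<close>
  have "\<exists>s>0. s < h \<and> 
      (g (x + h *\<^sub>R v + h *\<^sub>R w) - g (x + h *\<^sub>R v + 0 *\<^sub>R w)) - (g (x + 0 *\<^sub>R v + h *\<^sub>R w) - g (x + 0 *\<^sub>R v + 0 *\<^sub>R w))
      = (h - 0) * (D (x + s *\<^sub>R v + h *\<^sub>R w) v - D (x + s *\<^sub>R v + 0 *\<^sub>R w) v)"
    using assms(1) by (intro MVT2 DERIV_diff 1) auto
  then obtain s where s: "0 < s" "s < h"
    "(g (x + h *\<^sub>R v + h *\<^sub>R w) - g (x + h *\<^sub>R v + 0 *\<^sub>R w)) - (g (x + 0 *\<^sub>R v + h *\<^sub>R w) - g (x + 0 *\<^sub>R v + 0 *\<^sub>R w))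
      = (h - 0) * (D (x + s *\<^sub>R v + h *\<^sub>R w) v - D (x + s *\<^sub>R v + 0 *\<^sub>R w) v)"
    by blast
  have "\<exists>t>0. t < h \<and>
      D (x + s *\<^sub>R v + h *\<^sub>R w) v - D (x + s *\<^sub>R v + 0 *\<^sub>R w) v = (h - 0) * E (x + s *\<^sub>R v + t *\<^sub>R w) w"
    using assms(1) s(1,2) by (intro MVT2 2) auto
  then obtain t where t: "0 < t" "t < h"
    "D (x + s *\<^sub>R v + h *\<^sub>R w) v - D (x + s *\<^sub>R v + 0 *\<^sub>R w) v = (h - 0) * E (x + s *\<^sub>R v + t *\<^sub>R w) w"
    by blast
  show ?thesis
    by (rule that[OF s(1,2) t(1,2)])
      (use s(3) t(3) in \<open>simp add: E_def D_def power2_eq_square algebra_simps\<close>)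
qed

text \<open>The second difference Q is symmetric in v and w, and divided by h^2 it tends to the
  second derivative in either order: it equals that derivative at a nearby point, and the derivative
  is continuous.\<close>

lemma second_derivative_symmetric_real:
  fixes g :: "'a::real_normed_vector \<Rightarrow> real"
  assumes "open S" "smooth_on S g" "x \<in> S"
  shows "frechet_derivative (\<lambda>y. frechet_derivative g (at y) v) (at x) w
       = frechet_derivative (\<lambda>y. frechet_derivative g (at y) w) (at x) v"
proof -
  define E where "E v w y = frechet_derivative (\<lambda>y. frechet_derivative g (at y) v) (at y) w" for v w y
  define Q where "Q v w h = g (x + h *\<^sub>R v + h *\<^sub>R w) - g (x + h *\<^sub>R v) - g (x + h *\<^sub>R w) + g x" for v w h
  have Qsym: "Q v w h = Q w v h" for v w h
    by (simp add: Q_def algebra_simps)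
  have key: "\<exists>d>0. \<forall>h. 0 < h \<and> h < d \<longrightarrow> \<bar>Q v w h / h\<^sup>2 - E v w x\<bar> < e" if "e > 0" for e v w
  proof -
    have "continuous_on S (E v w)"
      unfolding E_def by (intro smooth_on_continuous_on smooth_on_frechet_derivative assms)
    then have "isCont (E v w) x" using assms continuous_on_eq_continuous_at by blast
    then have "\<forall>\<^sub>F y in nhds x. dist (E v w y) (E v w x) < e"
      using that by (simp add: isCont_def tendsto_iff eventually_nhds_conv_at)
    then have "\<forall>\<^sub>F y in nhds x. y \<in> S \<and> dist (E v w y) (E v w x) < e"
      using assms by (intro eventually_conj eventually_nhds_in_open)
    then obtain r where r: "r > 0" "\<And>y. dist y x < r \<Longrightarrow> y \<in> S \<and> dist (E v w y) (E v w x) < e"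
      unfolding eventually_nhds_metric by blast
    \<comment> \<open>Chosen so that s v + t w has norm below r for s, t at most h < d; the summand
      1 keeps the denominator positive when v = w = 0.\<close>
    define d where "d = r / (norm v + norm w + 1)"
    have d: "d > 0" unfolding d_def using r(1) by (intro divide_pos_pos) (auto intro: add_nonneg_pos)
    have dist: "dist (x + s *\<^sub>R v + t *\<^sub>R w) x < r"
      if "0 \<le> s" "s \<le> h" "0 \<le> t" "t \<le> h" "h < d" for s t h
    proof -
      have "dist (x + s *\<^sub>R v + t *\<^sub>R w) x \<le> s * norm v + t * norm w"
        using that norm_triangle_ineq[of "s *\<^sub>R v" "t *\<^sub>R w"] by (simp add: dist_norm add.assoc)
      also have "\<dots> \<le> d * norm v + d * norm w"
        using that by (intro add_mono mult_right_mono) auto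
      also have "\<dots> < d * (norm v + norm w + 1)" using d by (simp add: algebra_simps)
      also have "\<dots> = r" unfolding d_def
        by (simp add: add_nonneg_eq_0_iff)
      finally show ?thesis .
    qed
    show ?thesis
    proof (intro exI[of _ d] conjI allI impI d)
      fix h :: real assume h: "0 < h \<and> h < d"
      have 1: "\<And>s t. 0 \<le> s \<Longrightarrow> s \<le> h \<Longrightarrow> 0 \<le> t \<Longrightarrow> t \<le> h \<Longrightarrow> x + s *\<^sub>R v + t *\<^sub>R w \<in> S"
        using dist r h by blast
      obtain s t where st: "0 < s" "s < h" "0 < t" "t < h" "Q v w h = h\<^sup>2 * E v w (x + s *\<^sub>R v + t *\<^sub>R w)"
        unfolding E_def Q_def
        by (rule second_difference_mean_value[of h x v w S g, OF _ 1
            smooth_on_differentiable[OF assms(2)]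
            smooth_on_differentiable[OF smooth_on_frechet_derivative[OF assms(2)]]]) (use h in auto)
      have "dist (x + s *\<^sub>R v + t *\<^sub>R w) x < r" using st h by (intro dist[of _ h]) auto
      then show "\<bar>Q v w h / h\<^sup>2 - E v w x\<bar> < e"
        using r(2) st(5) h by (simp add: dist_real_def)
    qed
  qed
  have "\<bar>E v w x - E w v x\<bar> \<le> 0 + e" if e: "e > 0" for e
  proof -
    obtain d1 where d1: "d1 > 0" "\<And>h. 0 < h \<Longrightarrow> h < d1 \<Longrightarrow> \<bar>Q v w h / h\<^sup>2 - E v w x\<bar> < e/2"
      using key[OF half_gt_zero[OF e], of v w] by blast
    obtain d2 where d2: "d2 > 0" "\<And>h. 0 < h \<Longrightarrow> h < d2 \<Longrightarrow> \<bar>Q w v h / h\<^sup>2 - E w v x\<bar> < e/2"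
      using key[OF half_gt_zero[OF e], of w v] by blast
    define h where "h = min d1 d2 / 2"
    have "0 < h" "h < d1" "h < d2" using d1(1) d2(1) by (auto simp: h_def)
    then have "\<bar>Q v w h / h\<^sup>2 - E v w x\<bar> < e/2" "\<bar>Q v w h / h\<^sup>2 - E w v x\<bar> < e/2"
      using d1(2)[of h] d2(2)[of h] Qsym[of v w h] by simp_all
    then show ?thesis by arith
  qed
  then have "\<bar>E v w x - E w v x\<bar> \<le> 0" by (rule field_le_epsilon)
  then show ?thesis by (simp add: E_def)
qed

lemma second_derivative_symmetric:
  fixes g :: "'a::real_normed_vector \<Rightarrow> 'b::euclidean_space"
  assumes "open S" "smooth_on S g" "x \<in> S"
  shows "frechet_derivative (\<lambda>y. frechet_derivative g (at y) v) (at x) w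
       = frechet_derivative (\<lambda>y. frechet_derivative g (at y) w) (at x) v"
proof (rule euclidean_eqI)
  fix b :: 'b
  have comp: "frechet_derivative (\<lambda>y. h y \<bullet> b) (at y) v = frechet_derivative h (at y) v \<bullet> b"
    if "h differentiable (at y)" for h :: "'a \<Rightarrow> 'b" and y v
    using has_derivative_inner_left[of h "frechet_derivative h (at y)" "at y" b] that
    by (subst frechet_derivative_at[symmetric]) (auto simp: frechet_derivative_works[symmetric])
  have "frechet_derivative (\<lambda>y. frechet_derivative g (at y) v) (at x) w \<bullet> b =
        frechet_derivative (\<lambda>y. frechet_derivative (\<lambda>y. g y \<bullet> b) (at y) v) (at x) w" for v w
    using assms smooth_on_differentiable[OF assms(2)]
      smooth_on_differentiable[OF smooth_on_frechet_derivative[OF assms(2)]]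
    by (subst frechet_derivative_cong_open[OF assms(1,3) comp]) (auto simp: comp)
  moreover have "smooth_on S (\<lambda>y. g y \<bullet> b)"
    by (intro smooth_on_linear[OF bounded_linear_inner_left] assms)
  ultimately show "frechet_derivative (\<lambda>y. frechet_derivative g (at y) v) (at x) w \<bullet> b
       = frechet_derivative (\<lambda>y. frechet_derivative g (at y) w) (at x) v \<bullet> b"
    using second_derivative_symmetric_real assms by metis
qed

section \<open>Exterior algebra and the Leibniz rule\<close>

definition alternation :: "nat \<Rightarrow> 'n::finite covec \<Rightarrow> 'n covec" where
  "alternation n g = (\<lambda>v. \<Sum>s | s permutes {..<n}. of_int (sign s) * g (v \<circ> s))"

definition tensor :: "nat \<Rightarrow> 'n::finite covec \<Rightarrow> 'n covec \<Rightarrow> 'n covec" where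
  "tensor k \<eta> \<theta> = (\<lambda>v. \<eta> v * \<theta> (\<lambda>i. v (k + i)))"

lemma wedge_alternation: "wedge k l \<eta> \<theta> v = alternation (k + l) (tensor k \<eta> \<theta>) v / (fact k * fact l)"
  by (simp add: wedge_def alternation_def tensor_def o_def mult.assoc)

lemma sign_compose_permutes:
  "p permutes {..<n::nat} \<Longrightarrow> q permutes {..<m} \<Longrightarrow> sign (p \<circ> q) = sign p * sign q"
  by (intro sign_compose permutes_imp_permutation[OF finite_lessThan])

lemma sign_transpose_compose:
  "a \<noteq> b \<Longrightarrow> p permutes {..<n::nat} \<Longrightarrow> sign (Transposition.transpose a b \<circ> p) = - sign p"
  using permutes_imp_permutation[OF finite_lessThan, of p n]
  by (simp add: sign_compose sign_swap_id permutation_swap_id)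

text \<open>Composing with \<open>p i\<close> only permutes the terms of the outer sum and the signs
  cancel, so every index contributes one full alternation. The factor \<open>card I\<close> is what
  meets the factorial normalisations in nested wedge products and in the Leibniz rule.\<close>

lemma alternation_absorb:
  assumes "\<And>i. i \<in> I \<Longrightarrow> p i permutes {..<n}"
  shows "alternation n (\<lambda>v. \<Sum>i\<in>I. of_int (sign (p i)) * g (v \<circ> p i)) = (\<lambda>v. of_nat (card I) * alternation n g v)"
proof
  fix v
  have "alternation n (\<lambda>v. \<Sum>i\<in>I. of_int (sign (p i)) * g (v \<circ> p i)) v
      = (\<Sum>i\<in>I. \<Sum>s | s permutes {..<n}. of_int (sign s) * (of_int (sign (p i)) * g (v \<circ> s \<circ> p i)))"
    unfolding alternation_def sum_distrib_left by (rule sum.swap)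
  also have "\<dots> = (\<Sum>i\<in>I. alternation n g v)"
  proof (rule sum.cong[OF refl])
    fix i assume i: "i \<in> I"
    have "alternation n g v = (\<Sum>s | s permutes {..<n}. of_int (sign (s \<circ> p i)) * g (v \<circ> (s \<circ> p i)))"
      unfolding alternation_def
      by (rule sum_permutations_compose_right[OF assms[OF i]])
    also have "\<dots> = (\<Sum>s | s permutes {..<n}. of_int (sign s) * (of_int (sign (p i)) * g (v \<circ> s \<circ> p i)))"
      using assms[OF i]
      by (intro sum.cong) (auto simp: sign_compose_permutes o_assoc)
    finally show "(\<Sum>s | s permutes {..<n}. of_int (sign s) * (of_int (sign (p i)) * g (v \<circ> s \<circ> p i)))
        = alternation n g v" by simp
  qed
  finally show "alternation n (\<lambda>v. \<Sum>i\<in>I. of_int (sign (p i)) * g (v \<circ> p i)) v = of_nat (card I) * alternation n g v"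
    by simp
qed

lemma alternation_compose:
  assumes "p permutes {..<n}"
  shows "alternation n (\<lambda>v. g (v \<circ> p)) v = of_int (sign p) * alternation n g v"
proof -
  have "alternation n (\<lambda>v. \<Sum>i\<in>{()}. of_int (sign p) * g (v \<circ> p)) v = of_nat (card {()}) * alternation n g v"
    using alternation_absorb[of "{()}" "\<lambda>_. p" n g] assms by metis
  then have "of_int (sign p) * alternation n (\<lambda>v. g (v \<circ> p)) v = alternation n g v"
    by (simp add: alternation_def sum_distrib_left mult.left_commute)
  then have "of_int (sign p) * alternation n g v
     = of_int (sign p * sign p) * alternation n (\<lambda>v. g (v \<circ> p)) v"
    by (metis of_int_mult mult.assoc)
  then show ?thesis by simp
qed

lemma alternation_permute:
  assumes "p permutes {..<n}"
  shows "alternation n g (v \<circ> p) = of_int (sign p) * alternation n g v"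
proof -
  have "alternation n g v = (\<Sum>s | s permutes {..<n}. of_int (sign (p \<circ> s)) * g (v \<circ> (p \<circ> s)))"
    unfolding alternation_def by (rule setum_permutations_compose_left[OF assms])
  also have "\<dots> = of_int (sign p) * alternation n g (v \<circ> p)"
    unfolding alternation_def sum_distrib_left using assms
    by (intro sum.cong) (auto simp: sign_compose_permutes o_assoc)
  finally have "of_int (sign p) * alternation n g v = of_int (sign p * sign p) * alternation n g (v \<circ> p)"
    by (simp only: of_int_mult mult.assoc)
  then show ?thesis by simp
qed

lemma alternation_add: "alternation n (\<lambda>v. f v + g v) v = alternation n f v + alternation n g v"
  by (simp add: alternation_def distrib_left sum.distrib)

lemma alternation_divide: "alternation n (\<lambda>v. g v / c) v = alternation n g v / c"
  by (simp add: alternation_def sum_divide_distrib)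

text \<open>The permutation t transported to the block of positions from c on; it appears when an
  inner alternation acts on the second factor of a tensor product.\<close>

definition shift_perm :: "nat \<Rightarrow> (nat \<Rightarrow> nat) \<Rightarrow> nat \<Rightarrow> nat" where
  "shift_perm c t = (\<lambda>i. if i < c then i else c + t (i - c))"

lemma shift_perm_permutes_sign:
  assumes "t permutes {..<l}"
  shows "shift_perm c t permutes {..<c + l} \<and> sign (shift_perm c t) = sign t"
  using assms finite_lessThan
proof (induction rule: permutes_induct)
  case id
  have "shift_perm c id = id" by (auto simp: shift_perm_def)
  then show ?case by (simp only: permutes_id simp_thms)
next
  case (swap a b p)
  have eq: "shift_perm c (Transposition.transpose a b \<circ> p) = Transposition.transpose (c + a) (c + b) \<circ> shift_perm c p"
    by (auto simp: shift_perm_def Transposition.transpose_def fun_eq_iff)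
  have "Transposition.transpose (c + a) (c + b) permutes {..<c + l}"
    using swap by (intro permutes_swap_id) auto
  moreover have p: "shift_perm c p permutes {..<c + l}" "sign (shift_perm c p) = sign p"
    using swap.IH by auto
  moreover have ne: "c + a \<noteq> c + b" using swap by simp
  ultimately show ?case
    unfolding eq
    by (intro conjI permutes_compose) (simp_all only: sign_transpose_compose[OF ne p(1)] p(2) sign_transpose_compose[OF swap(3,4)])
qed

lemmas shift_perm_permutes = shift_perm_permutes_sign[THEN conjunct1]
lemmas sign_shift_perm = shift_perm_permutes_sign[THEN conjunct2]

definition local_covec :: "nat \<Rightarrow> 'n::finite covec \<Rightarrow> bool" where
  "local_covec k \<eta> \<longleftrightarrow> (\<forall>v w. (\<forall>i<k. v i = w i) \<longrightarrow> \<eta> v = \<eta> w)"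

text \<open>\<open>k_covector\<close> is split because bidegree components and Dolbeault derivatives
  are tracked only up to multilinearity, which suffices for reading off bidegrees.\<close>

definition multilinear :: "nat \<Rightarrow> 'n::finite covec \<Rightarrow> bool" where
  "multilinear k \<eta> \<longleftrightarrow> local_covec k \<eta> \<and> (\<forall>v. \<forall>i<k. linear (\<lambda>x. \<eta> (v(i := x))))"

definition alternating :: "nat \<Rightarrow> 'n::finite covec \<Rightarrow> bool" where
  "alternating k \<eta> \<longleftrightarrow> (\<forall>v. \<forall>i<k. \<forall>j<k. i \<noteq> j \<longrightarrow> v i = v j \<longrightarrow> \<eta> v = 0)"

lemma k_covector_iff: "k_covector k \<eta> \<longleftrightarrow> multilinear k \<eta> \<and> alternating k \<eta>"
  by (auto simp: k_covector_def multilinear_def alternating_def local_covec_def)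

lemma local_covecD: "local_covec k \<eta> \<Longrightarrow> (\<And>i. i < k \<Longrightarrow> v i = w i) \<Longrightarrow> \<eta> v = \<eta> w"
  by (auto simp: local_covec_def)

lemma multilinear_local: "multilinear k \<eta> \<Longrightarrow> local_covec k \<eta>"
  by (simp add: multilinear_def)

lemma multilinear_sum: "(\<And>i. i \<in> I \<Longrightarrow> multilinear k (\<eta> i)) \<Longrightarrow> multilinear k (\<lambda>v. \<Sum>i\<in>I. \<eta> i v)"
  unfolding multilinear_def local_covec_def
  by (auto intro!: sum.cong linear_compose_sum)

lemma multilinear_scale: "multilinear k \<eta> \<Longrightarrow> multilinear k (\<lambda>v. c * \<eta> v)"
  unfolding multilinear_def local_covec_def
  by (auto simp: linear_iff algebra_simps)

lemma multilinear_permute: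
  assumes "multilinear k \<eta>" "s permutes {..<k}"
  shows "multilinear k (\<lambda>v. \<eta> (v \<circ> s))"
proof -
  have upd: "v(i := x) \<circ> s = (v \<circ> s)(inv s i := x)" for v :: "nat \<Rightarrow> 'v" and i x
    using assms(2) by (auto simp: fun_eq_iff permutes_inverses)
  have inv: "inv s i < k" if "i < k" for i
    using permutes_in_image[OF permutes_inv[OF assms(2)], of i] that by auto
  have "s i < k" if "i < k" for i
    using permutes_in_image[OF assms(2), of i] that by auto
  then show ?thesis
    using assms(1) inv unfolding multilinear_def local_covec_def
    by (simp add: upd)
qed

lemma multilinear_alternation: "multilinear n g \<Longrightarrow> multilinear n (alternation n g)"
  unfolding alternation_def
  by (intro multilinear_sum multilinear_scale) (auto intro: multilinear_permute)

text \<open>Exchanging two equal arguments changes nothing and yet reverses the sign.\<close>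

lemma alternating_alternation: "alternating n (alternation n g)"
  unfolding alternating_def
proof (intro allI impI)
  fix v :: "nat \<Rightarrow> complex^'a" and i j assume ij: "i < n" "j < n" "i \<noteq> j" "v i = v j"
  have "v \<circ> Transposition.transpose i j = v" using ij by (auto simp: fun_eq_iff Transposition.transpose_def)
  then have "alternation n g v = - alternation n g v"
    using alternation_permute[of "Transposition.transpose i j" n g v] ij
    by (simp add: permutes_swap_id sign_swap_id)
  then show "alternation n g v = 0" by simp
qed

lemma multilinear_tensor:
  assumes "multilinear k \<eta>" "multilinear l \<theta>"
  shows "multilinear (k + l) (tensor k \<eta> \<theta>)"
  unfolding multilinear_def
proof (intro conjI allI impI)
  show "local_covec (k + l) (tensor k \<eta> \<theta>)"
    unfolding local_covec_def tensor_def
  proof (intro allI impI)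
    fix v w :: "nat \<Rightarrow> complex^'a" assume "\<forall>i<k + l. v i = w i"
    then show "\<eta> v * \<theta> (\<lambda>i. v (k + i)) = \<eta> w * \<theta> (\<lambda>i. w (k + i))"
      by (intro arg_cong2[where f = "(*)"] local_covecD[OF multilinear_local[OF assms(1)]]
          local_covecD[OF multilinear_local[OF assms(2)]]) auto
  qed
  fix v :: "nat \<Rightarrow> complex^'a" and i assume i: "i < k + l"
  show "linear (\<lambda>x. tensor k \<eta> \<theta> (v(i := x)))"
  proof (cases "i < k")
    case True
    have "\<theta> (\<lambda>j. (v(i := x)) (k + j)) = \<theta> (\<lambda>j. v (k + j))" for x
      using True by (auto intro: arg_cong[where f = \<theta>])
    moreover have "linear (\<lambda>x. \<eta> (v(i := x)))" using assms(1) True by (auto simp: multilinear_def)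
    ultimately show ?thesis
      unfolding tensor_def by (simp add: linear_iff algebra_simps)
  next
    case False
    have "\<eta> (v(i := x)) = \<eta> v" for x
      using False by (intro local_covecD[OF multilinear_local[OF assms(1)]]) auto
    moreover have "(\<lambda>j. (v(i := x)) (k + j)) = (\<lambda>j. v (k + j))(i - k := x)" for x
      using False by (auto simp: fun_eq_iff)
    moreover have "linear (\<lambda>x. \<theta> ((\<lambda>j. v (k + j))(i - k := x)))"
      using assms(2) False i by (auto simp: multilinear_def)
    ultimately show ?thesis
      unfolding tensor_def by (simp add: linear_iff algebra_simps)
  qed
qed

lemma multilinear_wedge:
  assumes "multilinear k \<eta>" "multilinear l \<theta>"
  shows "multilinear (k + l) (wedge k l \<eta> \<theta>)"
proof -
  have "wedge k l \<eta> \<theta> = (\<lambda>v. (1 / (fact k * fact l)) * alternation (k + l) (tensor k \<eta> \<theta>) v)"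
    by (simp add: wedge_alternation fun_eq_iff)
  then show ?thesis
    by (simp only: multilinear_scale multilinear_alternation multilinear_tensor assms)
qed

lemma alternating_wedge: "alternating (k + l) (wedge k l \<eta> \<theta>)"
  using alternating_alternation[of "k + l" "tensor k \<eta> \<theta>"]
  unfolding alternating_def by (simp add: wedge_alternation)

lemma k_covector_wedge:
  "k_covector k \<eta> \<Longrightarrow> k_covector l \<theta> \<Longrightarrow> k_covector (k + l) (wedge k l \<eta> \<theta>)"
  by (simp add: k_covector_iff multilinear_wedge alternating_wedge)

lemma k_covector_wedge_power:
  assumes "k_covector 2 \<psi>"
  shows "k_covector (2 * q) (wedge_power \<psi> q)"
proof (induction q)
  case 0
  then show ?case by (simp add: k_covector_def)
next
  case (Suc q)
  show ?case using k_covector_wedge[OF assms Suc.IH] by simp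
qed

text \<open>Antisymmetry comes by polarisation: the value with x + y in both slots is zero, and is
  expanded. Arbitrary permutations follow by induction over transpositions.\<close>

lemma k_covector_permute:
  assumes "k_covector k \<eta>" "s permutes {..<k}"
  shows "\<eta> (v \<circ> s) = of_int (sign s) * \<eta> v"
  using assms(2) finite_lessThan
proof (induction arbitrary: v rule: permutes_induct)
  case id
  then show ?case by simp
next
  case (swap a b p)
  have ab: "a < k" "b < k" "a \<noteq> b" using swap by auto
  have alt: "\<eta> (v(a := x, b := x)) = 0" for x v
    using assms(1) ab unfolding k_covector_def by simp
  have lina: "\<eta> (v(a := x + y)) = \<eta> (v(a := x)) + \<eta> (v(a := y))" for v x y
    using assms(1) ab unfolding k_covector_def by (simp add: linear_iff)
  have linb: "\<eta> (v(b := x + y)) = \<eta> (v(b := x)) + \<eta> (v(b := y))" for v x y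
    using assms(1) ab unfolding k_covector_def by (simp add: linear_iff)
  have tw: "w(a := p, b := q) = w(b := q, a := p)" for w :: "nat \<Rightarrow> complex^'a" and p q
    using ab(3) by (rule fun_upd_twist)
  have "\<eta> (v(b := y, a := x)) + \<eta> (v(b := x, a := y)) = 0" for x y v
  proof -
    have "0 = \<eta> (v(a := x + y, b := x + y))" by (simp add: alt)
    also have "\<dots> = \<eta> (v(a := x + y, b := x)) + \<eta> (v(a := x + y, b := y))" by (rule linb)
    also have "\<dots> = \<eta> (v(b := x, a := x)) + \<eta> (v(b := x, a := y)) + (\<eta> (v(b := y, a := x)) + \<eta> (v(b := y, a := y)))"
      by (simp only: lina tw)
    finally show ?thesis using alt[of v x] alt[of v y] tw[of v] by (simp add: add.commute)
  qed
  from this[of v "v b" "v a"] have "\<eta> (v(b := v a, a := v b)) = - \<eta> v"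
    by (simp add: eq_neg_iff_add_eq_0 add.commute)
  moreover have "v(b := v a, a := v b) = v \<circ> Transposition.transpose a b"
    by (auto simp: Transposition.transpose_def fun_eq_iff)
  ultimately have tr: "\<eta> (v \<circ> Transposition.transpose a b) = - \<eta> v" by simp
  have "\<eta> (v \<circ> (Transposition.transpose a b \<circ> p)) = of_int (sign p) * \<eta> (v \<circ> Transposition.transpose a b)"
    using swap.IH[of "v \<circ> Transposition.transpose a b"] by (simp only: comp_assoc)
  also have "\<dots> = of_int (sign (Transposition.transpose a b \<circ> p)) * \<eta> v"
    using swap ab by (simp add: tr sign_transpose_compose)
  finally show ?case .
qed

lemma alternation_k_covector:
  assumes "k_covector k \<eta>"
  shows "alternation k \<eta> v = fact k * \<eta> v"
proof -
  have "alternation k \<eta> v = (\<Sum>s | s permutes {..<k}. \<eta> v)"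
    unfolding alternation_def
    by (intro sum.cong) (auto simp: k_covector_permute[OF assms] mult.assoc[symmetric] of_int_mult[symmetric]
        simp del: of_int_mult)
  also have "\<dots> = fact k * \<eta> v"
    by (simp add: card_permutations[OF refl] )
  finally show ?thesis .
qed

lemma wedge_one:
  assumes "k_covector k \<eta>"
  shows "wedge k 0 \<eta> (\<lambda>v. 1) = \<eta>"
proof
  fix v
  have "tensor k \<eta> (\<lambda>v. 1) = \<eta>" by (simp add: tensor_def)
  then show "wedge k 0 \<eta> (\<lambda>v. 1) v = \<eta> v"
    using alternation_k_covector[OF assms] by (simp add: wedge_alternation)
qed

text \<open>Both bracketings equal the alternation of the triple tensor product T divided by k! l!
  m!. The inner alternation is absorbed by the outer one with a factor (k + l)! or (l + m)!, which
  the normalisation of the outer wedge cancels.\<close>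

lemma wedge_assoc:
  assumes "local_covec k \<eta>"
  shows "wedge (k + l) m (wedge k l \<eta> \<theta>) \<zeta> = wedge k (l + m) \<eta> (wedge l m \<theta> \<zeta>)"
proof
  fix v
  let ?n = "k + l + m"
  let ?P = "{t. t permutes {..<k + l}}" and ?Q = "{t. t permutes {..<l + m}}"
  define T where "T = tensor k \<eta> (tensor l \<theta> \<zeta>)"
  have T: "tensor (k + l) (tensor k \<eta> \<theta>) \<zeta> = T"
    by (auto simp: T_def tensor_def fun_eq_iff add.assoc)
  have P: "t permutes {..<?n}" if "t \<in> ?P" for t
    using that by (auto intro: permutes_subset)
  have fixP: "t (k + l + i) = k + l + i" if "t \<in> ?P" for t i
    using that permutes_not_in[of t "{..<k + l}" "k + l + i"] by auto
  have "tensor (k + l) (wedge k l \<eta> \<theta>) \<zeta>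
      = (\<lambda>v. (1 / (fact k * fact l)) * (\<Sum>t\<in>?P. of_int (sign t) * tensor (k + l) (tensor k \<eta> \<theta>) \<zeta> (v \<circ> t)))"
    by (auto simp: tensor_def[of "k + l"] fun_eq_iff wedge_alternation alternation_def sum_distrib_right fixP
        intro!: sum.cong arg_cong2[where f = "(/)"])
  then have "alternation ?n (tensor (k + l) (wedge k l \<eta> \<theta>) \<zeta>) v
     = (1 / (fact k * fact l)) * (of_nat (card ?P) * alternation ?n T v)"
    using alternation_absorb[of ?P "\<lambda>t. t" ?n T] P by (simp add: T alternation_divide)
  also have "card ?P = fact (k + l)" by (simp add: card_permutations)
  finally have E1: "alternation ?n (tensor (k + l) (wedge k l \<eta> \<theta>) \<zeta>) v = 1 / (fact k * fact l) * (of_nat (fact (k + l)) * alternation ?n T v)" .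
  have L: "wedge (k + l) m (wedge k l \<eta> \<theta>) \<zeta> v = alternation ?n T v / (fact k * fact l * fact m)"
    unfolding wedge_alternation[of "k + l" m] E1 by (simp add: divide_simps)
  have Q: "shift_perm k t permutes {..<?n}" "sign (shift_perm k t) = sign t" if "t \<in> ?Q" for t
    using that shift_perm_permutes_sign[of t "l + m" k] by (auto simp: add.assoc)
  \<comment> \<open>\<open>shift_perm k t\<close> moves only positions from k on, which \<eta> does
    not read.\<close>
  have fixQ: "\<eta> (v \<circ> shift_perm k t) = \<eta> v" for t v
    by (rule local_covecD[OF assms]) (auto simp: shift_perm_def)
  have sh: "(v \<circ> shift_perm k t) (k + i) = v (k + t i)" for v :: "nat \<Rightarrow> complex^'a" and t i
    by (simp add: shift_perm_def)
  have "tensor k \<eta> (wedge l m \<theta> \<zeta>)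
      = (\<lambda>v. (1 / (fact l * fact m)) * (\<Sum>t\<in>?Q. of_int (sign (shift_perm k t)) * T (v \<circ> shift_perm k t)))"
  proof
    fix v
    have "(\<Sum>t\<in>?Q. of_int (sign (shift_perm k t)) * T (v \<circ> shift_perm k t))
        = (\<Sum>t\<in>?Q. \<eta> v * (of_int (sign t) * tensor l \<theta> \<zeta> (\<lambda>i. v (k + t i))))"
      by (intro sum.cong refl) (simp only: T_def tensor_def[of k] fixQ sh Q mult.left_commute)
    then show "tensor k \<eta> (wedge l m \<theta> \<zeta>) v
      = (1 / (fact l * fact m)) * (\<Sum>t\<in>?Q. of_int (sign (shift_perm k t)) * T (v \<circ> shift_perm k t))"
      by (simp add: tensor_def[of k] wedge_alternation alternation_def sum_distrib_left sum_divide_distrib o_def)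
  qed
  then have "alternation ?n (tensor k \<eta> (wedge l m \<theta> \<zeta>)) v
     = (1 / (fact l * fact m)) * (of_nat (card ?Q) * alternation ?n T v)"
    using alternation_absorb[of ?Q "shift_perm k" ?n T] Q by (simp add: alternation_divide)
  also have "card ?Q = fact (l + m)" by (simp add: card_permutations)
  finally have E2: "alternation ?n (tensor k \<eta> (wedge l m \<theta> \<zeta>)) v
     = 1 / (fact l * fact m) * (of_nat (fact (l + m)) * alternation ?n T v)" .
  have "wedge k (l + m) \<eta> (wedge l m \<theta> \<zeta>) v = alternation ?n T v / (fact k * fact l * fact m)"
    unfolding wedge_alternation[of k "l + m"] add.assoc[symmetric] E2 by (simp add: divide_simps)
  with L show "wedge (k + l) m (wedge k l \<eta> \<theta>) \<zeta> v = wedge k (l + m) \<eta> (wedge l m \<theta> \<zeta>) v"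
    by simp
qed

lemma wedge_sum_left: "wedge k l (\<lambda>v. \<Sum>i\<in>I. \<eta> i v) \<theta> = (\<lambda>v. \<Sum>i\<in>I. wedge k l (\<eta> i) \<theta> v)"
proof
  fix v
  have "(\<Sum>i\<in>I. wedge k l (\<eta> i) \<theta> v) = (\<Sum>s | s permutes {..<k + l}. \<Sum>i\<in>I.
        of_int (sign s) * \<eta> i (\<lambda>i. v (s i)) * \<theta> (\<lambda>i. v (s (k + i)))) / (fact k * fact l)"
    unfolding wedge_def sum_divide_distrib[symmetric] by (subst sum.swap) simp
  then show "wedge k l (\<lambda>v. \<Sum>i\<in>I. \<eta> i v) \<theta> v = (\<Sum>i\<in>I. wedge k l (\<eta> i) \<theta> v)"
    by (simp add: wedge_def sum_distrib_left sum_distrib_right)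
qed

lemma wedge_sum_right: "wedge k l \<eta> (\<lambda>v. \<Sum>i\<in>I. \<theta> i v) = (\<lambda>v. \<Sum>i\<in>I. wedge k l \<eta> (\<theta> i) v)"
proof
  fix v
  have "(\<Sum>i\<in>I. wedge k l \<eta> (\<theta> i) v) = (\<Sum>s | s permutes {..<k + l}. \<Sum>i\<in>I.
        of_int (sign s) * \<eta> (\<lambda>i. v (s i)) * \<theta> i (\<lambda>i. v (s (k + i)))) / (fact k * fact l)"
    unfolding wedge_def sum_divide_distrib[symmetric] by (subst sum.swap) simp
  then show "wedge k l \<eta> (\<lambda>v. \<Sum>i\<in>I. \<theta> i v) v = (\<Sum>i\<in>I. wedge k l \<eta> (\<theta> i) v)"
    by (simp add: wedge_def sum_distrib_left sum_distrib_right)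
qed

lemma wedge_scale_left: "wedge k l (\<lambda>v. c * \<eta> v) \<theta> = (\<lambda>v. c * wedge k l \<eta> \<theta> v)"
  by (simp add: wedge_def sum_distrib_left mult.assoc mult.left_commute)

lemma wedge_zero_left: "wedge k l (\<lambda>v. 0) \<theta> = (\<lambda>v. 0)"
  and wedge_zero_right: "wedge k l \<eta> (\<lambda>v. 0) = (\<lambda>v. 0)"
  by (simp_all add: wedge_def)

lemma wedge_pullback:
  "wedge k l \<eta> \<theta> (\<lambda>i. L (v i)) = wedge k l (\<lambda>v. \<eta> (\<lambda>i. L (v i))) (\<lambda>v. \<theta> (\<lambda>i. L (v i))) v"
  by (simp add: wedge_def)

lemma wedge_power_pullback:
  "wedge_power \<psi> q (\<lambda>i. L (v i)) = wedge_power (\<lambda>v. \<psi> (\<lambda>i. L (v i))) q v"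
proof (induction q arbitrary: v)
  case 0
  then show ?case by simp
next
  case (Suc q)
  then show ?case by (simp add: wedge_def)
qed

lemma wedge_real:
  assumes "\<And>v. \<eta> v \<in> \<real>" "\<And>v. \<theta> v \<in> \<real>"
  shows "wedge k l \<eta> \<theta> v \<in> \<real>"
proof -
  have "(fact i :: complex) \<in> \<real>" for i
    by (metis of_real_fact Reals_of_real)
  then show ?thesis unfolding wedge_def
    by (intro Reals_divide sum_in_Reals Reals_mult assms) auto
qed

lemma wedge_power_real: "(\<And>v. \<psi> v \<in> \<real>) \<Longrightarrow> wedge_power \<psi> q v \<in> \<real>"
  by (induction q arbitrary: v) (auto intro: wedge_real)

section \<open>The Leibniz rule for the exterior derivative\<close>

text \<open>\<open>cycle_perm i\<close> moves entry \<open>i\<close> to the front; these permutations turn the alternating sum in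
  the definition of the exterior derivative into a partial alternation.\<close>

definition cycle_perm :: "nat \<Rightarrow> nat \<Rightarrow> nat" where
  "cycle_perm i = (\<lambda>j. if j = 0 then i else if j \<le> i then j - 1 else j)"

lemma cycle_perm_permutes_sign:
  "cycle_perm i permutes {..<Suc i} \<and> sign (cycle_perm i) = (-1) ^ i"
proof (induction i)
  case 0
  have "cycle_perm 0 = id" by (auto simp: cycle_perm_def)
  then show ?case by (simp only: permutes_id sign_id power_0 simp_thms)
next
  case (Suc i)
  have eq: "cycle_perm (Suc i) = Transposition.transpose i (Suc i) \<circ> cycle_perm i"
    by (auto simp: cycle_perm_def Transposition.transpose_def fun_eq_iff)
  have "Transposition.transpose i (Suc i) permutes {..<Suc (Suc i)}" by (intro permutes_swap_id) auto
  moreover have "cycle_perm i permutes {..<Suc (Suc i)}"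
    using Suc by (auto intro: permutes_subset)
  moreover have "sign (Transposition.transpose i (Suc i) \<circ> cycle_perm i) = (-1) ^ Suc i"
    by (subst sign_transpose_compose[of _ _ _ "Suc i"]) (use Suc.IH in auto)
  ultimately show ?case unfolding eq by (intro conjI permutes_compose)
qed

lemma cycle_perm_permutes: "i < n \<Longrightarrow> cycle_perm i permutes {..<n}"
  using cycle_perm_permutes_sign[of i] by (auto intro: permutes_subset)

lemma sign_cycle_perm: "sign (cycle_perm i) = (-1) ^ i"
  using cycle_perm_permutes_sign by blast

lemma cycle_perm_fix: "i < j \<Longrightarrow> cycle_perm i j = j"
  by (auto simp: cycle_perm_def)

text \<open>A permutation of n + 1 positions is given by its value i at 0 and a permutation of n
  positions. Injectivity is checked directly; surjectivity follows by counting, as (n + 1) n! = (n +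
  1)!.\<close>

lemma bij_betw_cycle_shift:
  "bij_betw (\<lambda>(i, t). cycle_perm i \<circ> shift_perm 1 t) ({..n} \<times> {t. t permutes {..<n}}) {s. s permutes {..<Suc n}}"
proof (intro bij_betw_imageI card_subset_eq)
  show "inj_on (\<lambda>(i, t). cycle_perm i \<circ> shift_perm 1 t) ({..n} \<times> {t. t permutes {..<n}})"
  proof (rule inj_onI, clarify)
    fix i j :: nat and s t :: "nat \<Rightarrow> nat"
    assume eq: "cycle_perm i \<circ> shift_perm 1 s = cycle_perm j \<circ> shift_perm 1 t"
    have ij: "i = j" using fun_cong[OF eq, of 0] by (simp add: cycle_perm_def shift_perm_def)
    have "inj (cycle_perm i)" using cycle_perm_permutes_sign permutes_inj by blast
    then have "shift_perm 1 s = shift_perm 1 t"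
      using eq ij by (metis fun.inj_map_strong inj_eq comp_apply ext)
    then have "shift_perm 1 s (Suc x) = shift_perm 1 t (Suc x)" for x by simp
    then show "i = j \<and> s = t" using ij by (auto simp: shift_perm_def)
  qed
  then have "card ((\<lambda>(i, t). cycle_perm i \<circ> shift_perm 1 t) ` ({..n} \<times> {t. t permutes {..<n}})) = fact (Suc n)"
    by (simp add: card_image card_cartesian_product card_permutations del: fact_Suc) (simp add: fact_Suc)
  then show "card ((\<lambda>(i, t). cycle_perm i \<circ> shift_perm 1 t) ` ({..n} \<times> {t. t permutes {..<n}}))
     = card {s. s permutes {..<Suc n}}"
    by (simp add: card_permutations)
  show "(\<lambda>(i, t). cycle_perm i \<circ> shift_perm 1 t) ` ({..n} \<times> {t. t permutes {..<n}}) \<subseteq> {s. s permutes {..<Suc n}}"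
    using shift_perm_permutes[of _ n 1]
    by (auto intro!: permutes_compose cycle_perm_permutes)
qed (simp add: finite_permutations)

lemma alternation_Suc:
  "alternation (Suc n) g v = (\<Sum>i\<le>n. (-1) ^ i *
     (\<Sum>t | t permutes {..<n}. of_int (sign t) * g (v \<circ> cycle_perm i \<circ> shift_perm 1 t)))"
proof -
  have "alternation (Suc n) g v = (\<Sum>(i, t)\<in>{..n} \<times> {t. t permutes {..<n}}.
      of_int (sign (cycle_perm i \<circ> shift_perm 1 t)) * g (v \<circ> (cycle_perm i \<circ> shift_perm 1 t)))"
    unfolding alternation_def
    by (subst sum.reindex_bij_betw[OF bij_betw_cycle_shift, symmetric]) (simp add: case_prod_beta)
  also have "\<dots> = (\<Sum>i\<le>n. \<Sum>t | t permutes {..<n}.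
      of_int (sign (cycle_perm i \<circ> shift_perm 1 t)) * g (v \<circ> (cycle_perm i \<circ> shift_perm 1 t)))"
    by (simp add: sum.cartesian_product)
  also have "\<dots> = (\<Sum>i\<le>n. \<Sum>t | t permutes {..<n}.
      (-1) ^ i * (of_int (sign t) * g (v \<circ> cycle_perm i \<circ> shift_perm 1 t)))"
  proof (intro sum.cong refl)
    fix i t assume "i \<in> {..n}" "t \<in> {t. t permutes {..<n}}"
    then have "cycle_perm i permutes {..<Suc n}" "shift_perm 1 t permutes {..<Suc n}" "sign (shift_perm 1 t) = sign t"
      using shift_perm_permutes_sign[of t n 1] by (auto intro: cycle_perm_permutes)
    then show "of_int (sign (cycle_perm i \<circ> shift_perm 1 t)) * g (v \<circ> (cycle_perm i \<circ> shift_perm 1 t))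
       = (-1) ^ i * (of_int (sign t) * g (v \<circ> cycle_perm i \<circ> shift_perm 1 t))"
      by (simp add: sign_compose_permutes sign_cycle_perm o_assoc)
  qed
  finally show ?thesis by (simp add: sum_distrib_left)
qed

text \<open>The derivative of \<eta> as a tensor whose slot 0 is the direction of differentiation,
  before any alternation. \<open>ext_deriv\<close> is its signed sum over the permutations
  \<open>cycle_perm i\<close>, and is therefore absorbed by a full alternation.\<close>

definition grad :: "'n::finite lform \<Rightarrow> 'n lform" where
  "grad \<eta> = (\<lambda>z v. frechet_derivative (\<lambda>y. \<eta> y (\<lambda>j. v (Suc j))) (at z) (v 0))"

lemma ext_deriv_grad:
  "ext_deriv k \<eta> z v = (\<Sum>i\<le>k. of_int (sign (cycle_perm i)) * grad \<eta> z (v \<circ> cycle_perm i))"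
proof -
  have "(\<lambda>j. v (cycle_perm i (Suc j))) = (\<lambda>j. if j < i then v j else v (Suc j))" for i
    by (auto simp: cycle_perm_def)
  then show ?thesis
    by (simp add: ext_deriv_def grad_def sign_cycle_perm) (simp add: cycle_perm_def)
qed

lemma has_derivative_wedge:
  assumes "\<And>v. (\<lambda>y. \<eta> y v) differentiable (at z)" "\<And>v. (\<lambda>y. \<theta> y v) differentiable (at z)"
  shows "((\<lambda>y. wedge k l (\<eta> y) (\<theta> y) v) has_derivative
    (\<lambda>x. (\<Sum>s | s permutes {..<k + l}. of_int (sign s) *
       (\<eta> z (\<lambda>i. v (s i)) * frechet_derivative (\<lambda>y. \<theta> y (\<lambda>i. v (s (k + i)))) (at z) x
        + frechet_derivative (\<lambda>y. \<eta> y (\<lambda>i. v (s i))) (at z) x * \<theta> z (\<lambda>i. v (s (k + i)))))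
      / (fact k * fact l))) (at z)"
proof -
  have d\<eta>: "((\<lambda>y. \<eta> y w) has_derivative frechet_derivative (\<lambda>y. \<eta> y w) (at z)) (at z)" for w
    using assms(1) by (simp add: frechet_derivative_works[symmetric])
  have d\<theta>: "((\<lambda>y. \<theta> y w) has_derivative frechet_derivative (\<lambda>y. \<theta> y w) (at z)) (at z)" for w
    using assms(2) by (simp add: frechet_derivative_works[symmetric])
  show ?thesis
    unfolding wedge_def mult.assoc
    by (intro bounded_linear.has_derivative[OF bounded_linear_divide] has_derivative_sum
        has_derivative_mult_right has_derivative_mult d\<eta> d\<theta>)
qed

text \<open>Differentiating a tensor product puts the new direction in front of \<eta> or in front
  of \<theta>; the latter means moving it past the k slots of \<eta>, hence (-1)^k. On the
  right-hand side the partial alternations in \<open>ext_deriv\<close> are absorbed with factors k +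
  1 and l + 1, which turn the normalisations (k + 1)! and (l + 1)! back into k! and l!.\<close>

theorem ext_deriv_wedge:
  assumes "\<And>v. (\<lambda>y. \<eta> y v) differentiable (at z)" "\<And>v. (\<lambda>y. \<theta> y v) differentiable (at z)"
    and loc: "local_covec k (\<eta> z)"
  shows "ext_deriv (k + l) (\<lambda>y. wedge k l (\<eta> y) (\<theta> y)) z v
    = wedge (Suc k) l (ext_deriv k \<eta> z) (\<theta> z) v + (-1) ^ k * wedge k (Suc l) (\<eta> z) (ext_deriv l \<theta> z) v"
proof -
  let ?n = "k + l"
  define A where "A = tensor (Suc k) (grad \<eta> z) (\<theta> z)"
  define B where "B = tensor k (\<eta> z) (grad \<theta> z)"
  \<comment> \<open>Composing with c moves the front argument to position k, between the arguments
    of \<eta> and those of \<theta>.\<close>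
  define c where "c = inv (cycle_perm k)"
  have cp: "cycle_perm k permutes {..<Suc ?n}" by (rule cycle_perm_permutes) simp
  have c: "c permutes {..<Suc ?n}" unfolding c_def using cp by (rule permutes_inv)
  have csign: "sign c = (-1) ^ k"
    unfolding c_def using permutes_imp_permutation[OF finite_lessThan cp]
    by (simp add: sign_inverse sign_cycle_perm)
  have inj: "inj (cycle_perm k)" using cp permutes_inj by blast
  have ceq: "c j = (if j < k then Suc j else if j = k then 0 else j)" for j
    unfolding c_def by (rule inv_f_eq[OF inj]) (auto simp: cycle_perm_def)
  have gw: "grad (\<lambda>y. wedge k l (\<eta> y) (\<theta> y)) z w =
     (\<Sum>t | t permutes {..<?n}. of_int (sign t) * (A (w \<circ> shift_perm 1 t) + B (w \<circ> shift_perm 1 t \<circ> c)))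
      / (fact k * fact l)" for w
  proof -
    have "A (w \<circ> shift_perm 1 t) =
       frechet_derivative (\<lambda>y. \<eta> y (\<lambda>i. w (Suc (t i)))) (at z) (w 0) * \<theta> z (\<lambda>i. w (Suc (t (k + i))))" for t
      by (simp add: A_def tensor_def grad_def shift_perm_def)
    moreover have "B (w \<circ> shift_perm 1 t \<circ> c) =
       \<eta> z (\<lambda>i. w (Suc (t i))) * frechet_derivative (\<lambda>y. \<theta> y (\<lambda>i. w (Suc (t (k + i))))) (at z) (w 0)" for t
    proof -
      have "\<eta> z (w \<circ> shift_perm 1 t \<circ> c) = \<eta> z (\<lambda>i. w (Suc (t i)))"
        by (rule local_covecD[OF loc]) (auto simp: ceq shift_perm_def)
      then show ?thesis by (simp add: B_def tensor_def grad_def ceq shift_perm_def)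
    qed
    ultimately show ?thesis
      unfolding grad_def
      by (subst frechet_derivative_at[OF has_derivative_wedge[OF assms(1,2)], symmetric]) (simp add: add.commute)
  qed
  have "ext_deriv ?n (\<lambda>y. wedge k l (\<eta> y) (\<theta> y)) z v
     = (\<Sum>i\<le>?n. (-1) ^ i * (\<Sum>t | t permutes {..<?n}. of_int (sign t) *
         (\<lambda>u. A u + B (u \<circ> c)) (v \<circ> cycle_perm i \<circ> shift_perm 1 t))) / (fact k * fact l)"
    unfolding ext_deriv_grad gw by (simp add: sign_cycle_perm sum_divide_distrib[where A = "{..k + l}"])
  also have "\<dots> = alternation (Suc ?n) (\<lambda>u. A u + B (u \<circ> c)) v / (fact k * fact l)"
    by (simp only: alternation_Suc)
  also have "\<dots> = (alternation (Suc ?n) A v + (-1) ^ k * alternation (Suc ?n) B v) / (fact k * fact l)"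
    unfolding alternation_add alternation_compose[OF c] by (simp add: csign)
  finally have main: "ext_deriv ?n (\<lambda>y. wedge k l (\<eta> y) (\<theta> y)) z v = \<dots>" .
  have "tensor (Suc k) (ext_deriv k \<eta> z) (\<theta> z)
      = (\<lambda>v. \<Sum>i\<in>{..k}. of_int (sign (cycle_perm i)) * A (v \<circ> cycle_perm i))"
    by (simp add: tensor_def A_def ext_deriv_grad fun_eq_iff sum_distrib_right mult.assoc cycle_perm_fix)
  then have "alternation (Suc ?n) (tensor (Suc k) (ext_deriv k \<eta> z) (\<theta> z)) v = of_nat (Suc k) * alternation (Suc ?n) A v"
    using alternation_absorb[of "{..k}" cycle_perm "Suc ?n" A] cycle_perm_permutes by (simp add: le_imp_less_Suc trans_le_add1)
  then have 1: "wedge (Suc k) l (ext_deriv k \<eta> z) (\<theta> z) v = alternation (Suc ?n) A v / (fact k * fact l)"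
    by (simp add: wedge_alternation fact_Suc del: of_nat_Suc)
  have "tensor k (\<eta> z) (ext_deriv l \<theta> z)
      = (\<lambda>v. \<Sum>i\<in>{..l}. of_int (sign (shift_perm k (cycle_perm i))) * B (v \<circ> shift_perm k (cycle_perm i)))"
  proof
    fix v
    have "\<eta> z (v \<circ> shift_perm k (cycle_perm i)) = \<eta> z v" for i
      by (rule local_covecD[OF loc]) (simp add: shift_perm_def)
    moreover have "sign (shift_perm k (cycle_perm i)) = sign (cycle_perm i)" for i
      using cycle_perm_permutes_sign sign_shift_perm by blast
    moreover have "(\<lambda>j. (v \<circ> shift_perm k (cycle_perm i)) (k + j)) = (\<lambda>j. v (k + j)) \<circ> cycle_perm i" for i
      by (auto simp: shift_perm_def)
    ultimately show "tensor k (\<eta> z) (ext_deriv l \<theta> z) v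
      = (\<Sum>i\<in>{..l}. of_int (sign (shift_perm k (cycle_perm i))) * B (v \<circ> shift_perm k (cycle_perm i)))"
      by (simp add: tensor_def B_def ext_deriv_grad sum_distrib_left mult.left_commute)
  qed
  moreover have "shift_perm k (cycle_perm i) permutes {..<Suc ?n}" if "i \<in> {..l}" for i
    using shift_perm_permutes[OF cycle_perm_permutes[of i "Suc l"], of k] that by simp
  ultimately have "alternation (Suc ?n) (tensor k (\<eta> z) (ext_deriv l \<theta> z)) v = of_nat (Suc l) * alternation (Suc ?n) B v"
    using alternation_absorb[of "{..l}" "\<lambda>i. shift_perm k (cycle_perm i)" "Suc ?n" B] by simp
  then have 2: "wedge k (Suc l) (\<eta> z) (ext_deriv l \<theta> z) v = alternation (Suc ?n) B v / (fact k * fact l)"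
    by (simp add: wedge_alternation fact_Suc del: of_nat_Suc)
  show ?thesis unfolding main 1 2 by (simp add: add_divide_distrib)
qed

section \<open>Bidegrees and Dolbeault operators\<close>

lemma multilinear_update:
  assumes "multilinear k \<eta>" "i < k"
  shows "\<eta> (v(i := a *\<^sub>R x + b *\<^sub>R y)) = a *\<^sub>R \<eta> (v(i := x)) + b *\<^sub>R \<eta> (v(i := y))"
proof -
  have lin: "linear (\<lambda>x. \<eta> (v(i := x)))" using assms by (simp add: multilinear_def)
  show ?thesis
    using linear_add[OF lin, of "a *\<^sub>R x" "b *\<^sub>R y"] linear_scale[OF lin, of a x] linear_scale[OF lin, of b y] by simp
qed

lemma multilinear_scale_slots:
  assumes "multilinear k \<eta>"
  shows "\<eta> (\<lambda>j. c j *\<^sub>R x j) = (\<Prod>j<k. c j) *\<^sub>R \<eta> x"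
proof -
  have "\<eta> (\<lambda>j. if j < r then c j *\<^sub>R x j else x j) = (\<Prod>j<r. c j) *\<^sub>R \<eta> x" if "r \<le> k" for r
    using that
  proof (induction r)
    case (Suc r)
    let ?w = "\<lambda>j. if j < r then c j *\<^sub>R x j else x j"
    have "\<eta> (?w(r := c r *\<^sub>R x r + 0 *\<^sub>R x r)) = c r *\<^sub>R \<eta> (?w(r := x r))"
      using Suc.prems by (subst multilinear_update[OF assms]) auto
    moreover have "?w(r := x r) = ?w" "?w(r := c r *\<^sub>R x r + 0 *\<^sub>R x r) = (\<lambda>j. if j < Suc r then c j *\<^sub>R x j else x j)"
      by (auto simp: fun_eq_iff)
    ultimately show ?case using Suc by (simp add: mult.commute)
  qed simp
  from this[of k] have "\<eta> (\<lambda>j. if j < k then c j *\<^sub>R x j else x j) = (\<Prod>j<k. c j) *\<^sub>R \<eta> x" by simp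
  moreover have "\<eta> (\<lambda>j. if j < k then c j *\<^sub>R x j else x j) = \<eta> (\<lambda>j. c j *\<^sub>R x j)"
    by (rule local_covecD[OF multilinear_local[OF assms]]) simp
  ultimately show ?thesis by simp
qed

lemma sum_Pow_insert:
  assumes "finite A" "a \<notin> A"
  shows "(\<Sum>K\<in>Pow (insert a A). f K) = (\<Sum>K\<in>Pow A. f K + f (insert a K))"
proof -
  have inj: "inj_on (insert a) (Pow A)"
    using assms(2) by (intro inj_onI) (metis Pow_iff insert_ident subsetD)
  have disj: "Pow A \<inter> insert a ` Pow A = {}" using assms(2) by auto
  show ?thesis
    using assms disj by (simp add: Pow_insert sum.union_disjoint sum.reindex[OF inj] sum.distrib)
qed

text \<open>The distributive law over slots: K collects the slots in which the summand with y is
  chosen.\<close>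

lemma multilinear_expand:
  assumes "multilinear k \<eta>"
  shows "\<eta> (\<lambda>j. a j *\<^sub>R x j + b j *\<^sub>R y j) = 
    (\<Sum>K\<in>Pow {..<k}. ((\<Prod>j\<in>K. b j) * (\<Prod>j\<in>{..<k} - K. a j)) *\<^sub>R \<eta> (\<lambda>j. if j \<in> K then y j else x j))"
proof -
  define z where "z = (\<lambda>j. a j *\<^sub>R x j + b j *\<^sub>R y j)"
  \<comment> \<open>Intermediate stage: slots below r are already split according to K, the others
    still hold the full sum.\<close>
  define W where "W r K = (\<lambda>j. if j < r then if j \<in> K then y j else x j else z j)" for r :: nat and K
  have "\<eta> z = (\<Sum>K\<in>Pow {..<r}. ((\<Prod>j\<in>K. b j) * (\<Prod>j\<in>{..<r} - K. a j)) *\<^sub>R \<eta> (W r K))" if "r \<le> k" for r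
    using that
  proof (induction r)
    case 0
    then show ?case by (simp add: W_def)
  next
    case (Suc r)
    let ?c = "\<lambda>r K. (\<Prod>j\<in>K. b j) * (\<Prod>j\<in>{..<r} - K. a j)"
    have "\<eta> z = (\<Sum>K\<in>Pow {..<r}. ?c (Suc r) K *\<^sub>R \<eta> (W (Suc r) K)
        + ?c (Suc r) (insert r K) *\<^sub>R \<eta> (W (Suc r) (insert r K)))"
      unfolding Suc.IH[OF Suc_leD[OF Suc.prems]]
    proof (intro sum.cong refl)
      fix K assume "K \<in> Pow {..<r}"
      then have K: "K \<subseteq> {..<r}" "r \<notin> K" "finite K" by (auto intro: finite_subset)
      have "W r K = (W r K)(r := a r *\<^sub>R x r + b r *\<^sub>R y r)" by (auto simp: W_def z_def)
      then have "\<eta> (W r K) = \<eta> ((W r K)(r := a r *\<^sub>R x r + b r *\<^sub>R y r))" by (rule arg_cong)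
      also have "\<dots> = a r *\<^sub>R \<eta> ((W r K)(r := x r)) + b r *\<^sub>R \<eta> ((W r K)(r := y r))"
        using Suc.prems by (intro multilinear_update[OF assms]) simp
      also have "(W r K)(r := x r) = W (Suc r) K" using K by (auto simp: W_def)
      also have "(W r K)(r := y r) = W (Suc r) (insert r K)" using K by (auto simp: W_def)
      finally have 1: "\<eta> (W r K) = a r *\<^sub>R \<eta> (W (Suc r) K) + b r *\<^sub>R \<eta> (W (Suc r) (insert r K))" .
      have "{..<Suc r} - K = insert r ({..<r} - K)" "{..<Suc r} - insert r K = {..<r} - K"
        using K by auto
      then have c: "?c (Suc r) K = a r * ?c r K" "?c (Suc r) (insert r K) = b r * ?c r K"
        using K by simp_all
      then show "?c r K *\<^sub>R \<eta> (W r K) = ?c (Suc r) K *\<^sub>R \<eta> (W (Suc r) K)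
        + ?c (Suc r) (insert r K) *\<^sub>R \<eta> (W (Suc r) (insert r K))"
        unfolding 1 c by (simp add: scaleR_right_distrib mult.commute)
    qed
    then show ?case by (simp only: lessThan_Suc[of r]) (subst sum_Pow_insert, simp_all)
  qed
  from this[of k] have "\<eta> z = (\<Sum>K\<in>Pow {..<k}. ((\<Prod>j\<in>K. b j) * (\<Prod>j\<in>{..<k} - K. a j)) *\<^sub>R \<eta> (W k K))" by simp
  moreover have "\<eta> (W k K) = \<eta> (\<lambda>j. if j \<in> K then y j else x j)" for K
    by (rule local_covecD[OF multilinear_local[OF assms]]) (simp add: W_def)
  ultimately show ?thesis by (simp add: z_def)
qed

definition mixed_eval :: "'n::finite covec \<Rightarrow> nat set \<Rightarrow> 'n covec" where
  "mixed_eval \<eta> K v = \<eta> (\<lambda>j. if j \<in> K then \<i> *s v j else v j)"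

text \<open>Trades the complexified evaluation for real ones. Choosing the imaginary part costs a
  factor i, times -1/2 in a (1,0)-slot and 1/2 in a (0,1)-slot, as in \<open>part10\<close> and
  \<open>part01\<close>.\<close>

lemma bideg_mixed_eval:
  assumes "multilinear (p + q) \<eta>"
  shows "bideg p q \<eta> v = (\<Sum>I | I \<subseteq> {..<p + q} \<and> card I = p. \<Sum>K\<in>Pow {..<p + q}.
    (\<Prod>j<p + q. if j \<in> K then if j \<in> I then - (\<i> / 2) else \<i> / 2 else 1 / 2) * mixed_eval \<eta> K v)"
  unfolding bideg_def complexify_def
proof (intro sum.cong refl)
  fix I K assume "I \<in> {I. I \<subseteq> {..<p + q} \<and> card I = p}" and K: "K \<in> Pow {..<p + q}"
  let ?w = "\<lambda>j. if j \<in> I then part10 (v j) else part01 (v j)"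
  let ?c = "\<lambda>j. if j \<in> K then if j \<in> I then - (1/2) else 1/2 else (1/2 :: real)"
  have "(\<lambda>j. if j \<in> K then snd (?w j) else fst (?w j)) = (\<lambda>j. ?c j *\<^sub>R (if j \<in> K then \<i> *s v j else v j))"
    by (auto simp: part10_def part01_def)
  then have "\<eta> (\<lambda>j. if j \<in> K then snd (?w j) else fst (?w j)) = (\<Prod>j<p + q. ?c j) *\<^sub>R mixed_eval \<eta> K v"
    using multilinear_scale_slots[OF assms] by (simp add: mixed_eval_def)
  moreover have "\<i> ^ card K = (\<Prod>j<p + q. if j \<in> K then \<i> else 1)"
    using K by (simp add: prod.If_cases Int_absorb1)
  moreover have "(\<Prod>j<p + q. if j \<in> K then \<i> else 1) * complex_of_real (\<Prod>j<p + q. ?c j)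
     = (\<Prod>j<p + q. if j \<in> K then if j \<in> I then - (\<i> / 2) else \<i> / 2 else 1 / 2)"
    unfolding of_real_prod prod.distrib[symmetric] by (intro prod.cong) auto
  ultimately show "\<i> ^ card K * \<eta> (\<lambda>j. if j \<in> K then snd (?w j) else fst (?w j))
     = (\<Prod>j<p + q. if j \<in> K then if j \<in> I then - (\<i> / 2) else \<i> / 2 else 1 / 2) * mixed_eval \<eta> K v"
    by (simp add: scaleR_conv_of_real mult.assoc[symmetric])
qed

lemma multilinear_mixed_eval:
  fixes \<eta> :: "'n::finite covec"
  assumes "multilinear k \<eta>"
  shows "multilinear k (mixed_eval \<eta> K)"
  unfolding multilinear_def
proof (intro conjI allI impI)
  show "local_covec k (mixed_eval \<eta> K)"
    unfolding local_covec_def mixed_eval_def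
    by (intro allI impI local_covecD[OF multilinear_local[OF assms]]) auto
  fix v :: "nat \<Rightarrow> complex^'n" and i assume i: "i < k"
  let ?w = "\<lambda>j. if j \<in> K then \<i> *s v j else v j"
  have lin: "linear (\<lambda>x. \<eta> (?w(i := x)))" using assms i by (simp add: multilinear_def)
  have "linear (\<lambda>x::complex^'n. if i \<in> K then \<i> *s x else x)"
    by (auto simp: linear_iff vec_eq_iff algebra_simps)
  from linear_compose[OF this lin]
  have "linear (\<lambda>x. \<eta> (?w(i := if i \<in> K then \<i> *s x else x)))" by (simp add: o_def)
  moreover have "?w(i := if i \<in> K then \<i> *s x else x) = (\<lambda>j. if j \<in> K then \<i> *s (v(i := x)) j else (v(i := x)) j)" for x
    by auto
  ultimately show "linear (\<lambda>x. mixed_eval \<eta> K (v(i := x)))" by (simp add: mixed_eval_def)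
qed

lemma multilinear_bideg:
  assumes "multilinear (p + q) \<eta>"
  shows "multilinear (p + q) (bideg p q \<eta>)"
  unfolding bideg_mixed_eval[OF assms]
  by (intro multilinear_sum multilinear_scale multilinear_mixed_eval assms)

lemma bideg_zero: "bideg p q (\<lambda>v. 0) = (\<lambda>v. 0)"
  by (simp add: bideg_def complexify_def)

text \<open>Multiplication by u acts on (1,0)-parts as u and on (0,1)-parts as cnj u, so the
  component of type (p, k - p) is the piece of weight u^p cnj(u)^(k-p). Together with
  \<open>unit_circle_coeffs_unique\<close> this characterises the components.\<close>

lemma multilinear_rotate:
  assumes "multilinear k \<eta>"
  shows "\<eta> (\<lambda>j. u *s v j) = (\<Sum>p\<le>k. u ^ p * cnj u ^ (k - p) * bideg p (k - p) \<eta> v)"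
proof -
  let ?c = "\<lambda>I K. \<Prod>j<k. if j \<in> K then if j \<in> I then - (\<i> / 2) else \<i> / 2 else 1 / 2"
  define f where "f K = (\<lambda>j::nat. u * (if j \<in> K then - (\<i> / 2) else 1 / 2))" for K
  define g where "g K = (\<lambda>j::nat. cnj u * (if j \<in> K then \<i> / 2 else 1 / 2))" for K
  have "(\<Sum>p\<le>k. u ^ p * cnj u ^ (k - p) * bideg p (k - p) \<eta> v)
      = (\<Sum>p\<le>k. \<Sum>I | I \<in> Pow {..<k} \<and> card I = p. u ^ card I * cnj u ^ (k - card I) *
           (\<Sum>K\<in>Pow {..<k}. ?c I K * mixed_eval \<eta> K v))"
    using assms by (intro sum.cong refl) (simp add: bideg_mixed_eval sum_distrib_left)
  also have "\<dots> = (\<Sum>I\<in>Pow {..<k}. u ^ card I * cnj u ^ (k - card I) *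
           (\<Sum>K\<in>Pow {..<k}. ?c I K * mixed_eval \<eta> K v))"
    by (intro sum.group) (auto dest: card_mono[OF finite_lessThan])
  also have "\<dots> = (\<Sum>I\<in>Pow {..<k}. \<Sum>K\<in>Pow {..<k}. prod (f K) I * prod (g K) ({..<k} - I) * mixed_eval \<eta> K v)"
    unfolding sum_distrib_left
  proof (intro sum.cong refl)
    fix I K assume "I \<in> Pow {..<k}" "K \<in> Pow {..<k}"
    then have I: "I \<subseteq> {..<k}" "finite I" by (auto intro: finite_subset)
    have 1: "u ^ card I * cnj u ^ (k - card I) = (\<Prod>j\<in>I. u) * (\<Prod>j\<in>{..<k} - I. cnj u)"
      using I by (simp add: card_Diff_subset)
    have "?c I K = (\<Prod>j\<in>{..<k} - I. if j \<in> K then if j \<in> I then - (\<i> / 2) else \<i> / 2 else 1 / 2)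
        * (\<Prod>j\<in>I. if j \<in> K then if j \<in> I then - (\<i> / 2) else \<i> / 2 else 1 / 2)"
      by (rule prod.subset_diff[OF I(1) finite_lessThan])
    also have "\<dots> = (\<Prod>j\<in>{..<k} - I. if j \<in> K then \<i> / 2 else 1 / 2) * (\<Prod>j\<in>I. if j \<in> K then - (\<i> / 2) else 1 / 2)"
      by (intro arg_cong2[where f = "(*)"] prod.cong refl) auto
    finally have 2: "?c I K = \<dots>" .
    have 3: "(a * b) * (c * d) = (a * d) * (b * c)" for a b c d :: complex by simp
    have "u ^ card I * cnj u ^ (k - card I) * ?c I K = prod (f K) I * prod (g K) ({..<k} - I)"
      unfolding 1 2 f_def g_def prod.distrib by (rule 3)
    then show "u ^ card I * cnj u ^ (k - card I) * (?c I K * mixed_eval \<eta> K v)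
       = prod (f K) I * prod (g K) ({..<k} - I) * mixed_eval \<eta> K v"
      by (simp only: mult.assoc[symmetric])
  qed
  also have "\<dots> = (\<Sum>K\<in>Pow {..<k}. (\<Sum>I\<in>Pow {..<k}. prod (f K) I * prod (g K) ({..<k} - I)) * mixed_eval \<eta> K v)"
    by (subst sum.swap) (simp add: sum_distrib_right)
  also have "\<dots> = (\<Sum>K\<in>Pow {..<k}. ((\<Prod>j\<in>K. Im u) * (\<Prod>j\<in>{..<k} - K. Re u)) *\<^sub>R mixed_eval \<eta> K v)"
  proof (intro sum.cong refl)
    fix K assume "K \<in> Pow {..<k}"
    then have K: "K \<subseteq> {..<k}" by auto
    \<comment> \<open>In each slot the (1,0) and (0,1) contributions add up to a real number: u
      (-i/2) + cnj u (i/2) = Im u on K, and u/2 + cnj u/2 = Re u off K. The sum over I is the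
      expanded product of these.\<close>
    have "f K j + g K j = of_real (if j \<in> K then Im u else Re u)" for j
      by (simp add: f_def g_def complex_eq_iff)
    then have "(\<Sum>I\<in>Pow {..<k}. prod (f K) I * prod (g K) ({..<k} - I)) = of_real (\<Prod>j<k. if j \<in> K then Im u else Re u)"
      by (simp add: prod_add[symmetric])
    also have "(\<Prod>j<k. if j \<in> K then Im u else Re u) = (\<Prod>j\<in>K. Im u) * (\<Prod>j\<in>{..<k} - K. Re u)"
      by (subst prod.subset_diff[OF K finite_lessThan], subst mult.commute)
        (intro arg_cong2[where f = "(*)"] prod.cong refl, auto)
    finally show "(\<Sum>I\<in>Pow {..<k}. prod (f K) I * prod (g K) ({..<k} - I)) * mixed_eval \<eta> K v
       = ((\<Prod>j\<in>K. Im u) * (\<Prod>j\<in>{..<k} - K. Re u)) *\<^sub>R mixed_eval \<eta> K v"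
      by (simp add: scaleR_conv_of_real)
  qed
  also have "\<dots> = \<eta> (\<lambda>j. Re u *\<^sub>R v j + Im u *\<^sub>R (\<i> *s v j))"
    unfolding mixed_eval_def by (rule multilinear_expand[OF assms, symmetric])
  also have "(\<lambda>j. Re u *\<^sub>R v j + Im u *\<^sub>R (\<i> *s v j)) = (\<lambda>j. u *s v j)"
    by (auto simp: fun_eq_iff vec_eq_iff complex_eq_iff)
  finally show ?thesis by simp
qed

text \<open>After multiplication by u^k the two sides differ by a polynomial in w = u^2, because u
  cnj u = 1. It vanishes at every w on the unit circle, which is infinite.\<close>

lemma unit_circle_coeffs_unique:
  fixes c d :: "nat \<Rightarrow> complex"
  assumes "\<And>u. norm u = 1 \<Longrightarrow> (\<Sum>p\<le>k. u ^ p * cnj u ^ (k - p) * c p) = (\<Sum>p\<le>k. u ^ p * cnj u ^ (k - p) * d p)"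
    and "p \<le> k"
  shows "c p = d p"
proof (rule ccontr)
  assume ne: "c p \<noteq> d p"
  have "(\<Sum>p\<le>k. (c p - d p) * w ^ p) = 0" if "norm w = 1" for w
  proof -
    define u where "u = csqrt w"
    have u: "u\<^sup>2 = w" "norm u = 1" using that by (simp_all add: u_def)
    have uc: "u * cnj u = 1" using u(2) by (simp add: complex_norm_square[symmetric])
    have "0 = u ^ k * (\<Sum>p\<le>k. u ^ p * cnj u ^ (k - p) * (c p - d p))"
      using assms(1)[OF u(2)] by (simp add: right_diff_distrib sum_subtractf)
    also have "\<dots> = (\<Sum>p\<le>k. (c p - d p) * w ^ p)"
      unfolding sum_distrib_left
    proof (intro sum.cong refl)
      fix p assume "p \<in> {..k}"
      then have "u ^ k = u ^ p * u ^ (k - p)" by (simp add: power_add[symmetric])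
      then have "u ^ k * (u ^ p * cnj u ^ (k - p) * (c p - d p)) = (u ^ p * u ^ p) * (u * cnj u) ^ (k - p) * (c p - d p)"
        by (simp add: power_mult_distrib)
      also have "u ^ p * u ^ p = w ^ p" by (simp add: u(1)[symmetric] power2_eq_square power_mult_distrib)
      finally show "u ^ k * (u ^ p * cnj u ^ (k - p) * (c p - d p)) = (c p - d p) * w ^ p" by (simp add: uc)
    qed
    finally show ?thesis by simp
  qed
  then have "sphere 0 1 \<subseteq> {w. (\<Sum>p\<le>k. (c p - d p) * w ^ p) = 0}" by auto
  moreover have "finite {w. (\<Sum>p\<le>k. (c p - d p) * w ^ p) = 0}"
    using polyfun_finite_roots[of "\<lambda>p. c p - d p" k] ne assms(2) by auto
  \<comment> \<open>A finite connected set has at most one point, but the circle contains 1 and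
    -1.\<close>
  ultimately have "finite (sphere (0::complex) 1)" by (rule finite_subset)
  moreover have "connected (sphere (0::complex) 1)" by (rule connected_sphere) simp
  ultimately have "sphere (0::complex) 1 = {} \<or> (\<exists>x. sphere (0::complex) 1 = {x})"
    using connected_finite_iff_sing by blast
  moreover have "(1::complex) \<in> sphere 0 1" "(-1::complex) \<in> sphere 0 1" by simp_all
  ultimately show False by (metis empty_iff one_neq_neg_one singletonD)
qed

lemma bideg_eqI:
  assumes "multilinear k \<eta>"
    and "\<And>u. norm u = 1 \<Longrightarrow> \<eta> (\<lambda>j. u *s v j) = (\<Sum>p\<le>k. u ^ p * cnj u ^ (k - p) * c p)"
    and "p + q = k"
  shows "bideg p q \<eta> v = c p"
proof -
  have "(\<Sum>p\<le>k. u ^ p * cnj u ^ (k - p) * bideg p (k - p) \<eta> v) = (\<Sum>p\<le>k. u ^ p * cnj u ^ (k - p) * c p)"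
    if "norm u = 1" for u
    using assms(2)[OF that] multilinear_rotate[OF assms(1), of u v] by simp
  from unit_circle_coeffs_unique[OF this, of p] show ?thesis using assms(3) by auto
qed

text \<open>For a \<open>2q\<close>-covector, invariance under unit scalars means type \<open>(q,q)\<close>.\<close>

definition unitary_invariant :: "'n::finite covec \<Rightarrow> bool" where
  "unitary_invariant \<theta> \<longleftrightarrow> (\<forall>u v. norm u = 1 \<longrightarrow> \<theta> (\<lambda>j. u *s v j) = \<theta> v)"

text \<open>Rotating all arguments by a unit u leaves \<theta> fixed, so the weights of the product
  are those of \<eta>. Inserting (u cnj u)^q = 1 rewrites the weight (p, k - p) as (p + q, k - p +
  q), now of total degree k + 2q; no other weight occurs.\<close>

lemma bideg_wedge:
  assumes \<eta>: "multilinear k \<eta>" and \<theta>: "multilinear (2 * q) \<theta>" "unitary_invariant \<theta>"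
    and pr: "p + r = k + 2 * q"
  shows "bideg p r (wedge k (2 * q) \<eta> \<theta>)
     = (if q \<le> p \<and> q \<le> r then wedge k (2 * q) (bideg (p - q) (r - q) \<eta>) \<theta> else (\<lambda>v. 0))"
proof
  fix v
  let ?n = "k + 2 * q"
  define c where "c p = (if q \<le> p \<and> q \<le> ?n - p then wedge k (2 * q) (bideg (p - q) (k - (p - q)) \<eta>) \<theta> v else 0)" for p
  have "wedge k (2 * q) \<eta> \<theta> (\<lambda>j. u *s v j) = (\<Sum>p\<le>?n. u ^ p * cnj u ^ (?n - p) * c p)" if u: "norm u = 1" for u
  proof -
    have uc: "u * cnj u = 1" using u by (simp add: complex_norm_square[symmetric])
    have "wedge k (2 * q) \<eta> \<theta> (\<lambda>j. u *s v j) = wedge k (2 * q) (\<lambda>v. \<eta> (\<lambda>j. u *s v j)) \<theta> v"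
      using \<theta>(2) u unfolding wedge_pullback unitary_invariant_def by simp
    also have "\<dots> = (\<Sum>p\<le>k. u ^ p * cnj u ^ (k - p) * wedge k (2 * q) (bideg p (k - p) \<eta>) \<theta> v)"
      by (simp only: multilinear_rotate[OF \<eta>] wedge_sum_left wedge_scale_left)
    also have "\<dots> = (\<Sum>p\<in>{q..k + q}. u ^ p * cnj u ^ (?n - p) * c p)"
    proof (intro sum.reindex_bij_witness[of _ "\<lambda>p. p - q" "\<lambda>p. p + q"])
      fix p assume p: "p \<in> {..k}"
      have e: "?n - (p + q) = (k - p) + q" using p by simp
      have "u ^ (p + q) * cnj u ^ (?n - (p + q)) = u ^ p * cnj u ^ (k - p) * (u * cnj u) ^ q"
        unfolding e by (simp add: power_mult_distrib power_add mult_ac)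
      then show "u ^ (p + q) * cnj u ^ (?n - (p + q)) * c (p + q)
         = u ^ p * cnj u ^ (k - p) * wedge k (2 * q) (bideg p (k - p) \<eta>) \<theta> v"
        using p by (simp add: uc c_def)
    qed auto
    also have "\<dots> = (\<Sum>p\<le>?n. u ^ p * cnj u ^ (?n - p) * c p)"
      by (intro sum.mono_neutral_left) (auto simp: c_def)
    finally show ?thesis .
  qed
  then have "bideg p r (wedge k (2 * q) \<eta> \<theta>) v = c p"
    by (intro bideg_eqI[OF multilinear_wedge[OF \<eta> \<theta>(1)]] pr)
  moreover have "?n - p = r" "q \<le> p \<and> q \<le> r \<Longrightarrow> k - (p - q) = r - q" using pr by auto
  ultimately show "bideg p r (wedge k (2 * q) \<eta> \<theta>) v
     = (if q \<le> p \<and> q \<le> r then wedge k (2 * q) (bideg (p - q) (r - q) \<eta>) \<theta> else (\<lambda>v. 0)) v"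
    by (simp add: c_def)
qed

section \<open>Dolbeault operators and multiplication by a closed (q,q)-form\<close>

lemma ext_deriv_cong_open:
  assumes "open S" "z \<in> S" "\<And>y. y \<in> S \<Longrightarrow> \<eta> y = \<eta>' y"
  shows "ext_deriv k \<eta> z = ext_deriv k \<eta>' z"
  unfolding ext_deriv_def
  by (intro ext sum.cong refl arg_cong2[where f = "(*)"] fun_cong[OF frechet_derivative_cong_open[OF assms(1,2)]])
    (simp add: assms(3))

lemma ext_deriv_zero: "ext_deriv k (\<lambda>y v. 0) z = (\<lambda>v. 0)"
  by (simp add: ext_deriv_def frechet_derivative_const)

text \<open>Linearity in the old slots survives differentiation because the linear relations hold on
  the whole neighbourhood S and not just at z; slot 0 is linear as the argument of a
  derivative.\<close>

lemma multilinear_grad: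
  assumes "open S" "z \<in> S" and ml: "\<And>y. y \<in> S \<Longrightarrow> multilinear k (\<eta> y)"
    and df: "\<And>v. (\<lambda>y. \<eta> y v) differentiable (at z)"
  shows "multilinear (Suc k) (grad \<eta> z)"
  unfolding multilinear_def
proof (intro conjI allI impI)
  show "local_covec (Suc k) (grad \<eta> z)"
    unfolding local_covec_def
  proof (intro allI impI)
    fix v w :: "nat \<Rightarrow> complex^'a" assume vw: "\<forall>i<Suc k. v i = w i"
    have "frechet_derivative (\<lambda>y. \<eta> y (\<lambda>j. v (Suc j))) (at z) = frechet_derivative (\<lambda>y. \<eta> y (\<lambda>j. w (Suc j))) (at z)"
      using vw by (intro frechet_derivative_cong_open[OF assms(1,2)] local_covecD[OF multilinear_local[OF ml]]) auto
    then show "grad \<eta> z v = grad \<eta> z w" using vw by (simp add: grad_def)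
  qed
  fix v :: "nat \<Rightarrow> complex^'a" and i assume i: "i < Suc k"
  show "linear (\<lambda>x. grad \<eta> z (v(i := x)))"
  proof (cases i)
    case 0
    then show ?thesis
      using linear_frechet_derivative[OF df, of "\<lambda>j. v (Suc j)"] by (simp add: grad_def)
  next
    case (Suc j)
    let ?w = "\<lambda>j. v (Suc j)"
    have "(\<lambda>j'. (v(i := x)) (Suc j')) = ?w(j := x)" for x using Suc by auto
    then have eq: "grad \<eta> z (v(i := x)) = frechet_derivative (\<lambda>y. \<eta> y (?w(j := x))) (at z) (v 0)" for x
      using Suc by (simp only: grad_def) simp
    have D: "((\<lambda>y. \<eta> y w) has_derivative frechet_derivative (\<lambda>y. \<eta> y w) (at z)) (at z)" for w
      using df by (simp add: frechet_derivative_works[symmetric])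
    have "frechet_derivative (\<lambda>y. \<eta> y (?w(j := a *\<^sub>R x + b *\<^sub>R x'))) (at z) h
      = a *\<^sub>R frechet_derivative (\<lambda>y. \<eta> y (?w(j := x))) (at z) h + b *\<^sub>R frechet_derivative (\<lambda>y. \<eta> y (?w(j := x'))) (at z) h"
      for a b x x' h
    proof -
      have "frechet_derivative (\<lambda>y. \<eta> y (?w(j := a *\<^sub>R x + b *\<^sub>R x'))) (at z)
        = frechet_derivative (\<lambda>y. a *\<^sub>R \<eta> y (?w(j := x)) + b *\<^sub>R \<eta> y (?w(j := x'))) (at z)"
        using i Suc by (intro frechet_derivative_cong_open[OF assms(1,2)] multilinear_update[OF ml]) auto
      also have "\<dots> = (\<lambda>h. a *\<^sub>R frechet_derivative (\<lambda>y. \<eta> y (?w(j := x))) (at z) h + b *\<^sub>R frechet_derivative (\<lambda>y. \<eta> y (?w(j := x'))) (at z) h)"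
        by (rule frechet_derivative_at[symmetric]) (intro has_derivative_add has_derivative_scaleR_right D)
      finally show ?thesis by simp
    qed
    from this[where a = 1 and b = 1] this[where b = 0] show ?thesis
      unfolding eq by (intro linearI) (simp_all only: scaleR_one scaleR_zero_left add_0_right)
  qed
qed

lemma multilinear_ext_deriv:
  assumes "open S" "z \<in> S" "\<And>y. y \<in> S \<Longrightarrow> multilinear k (\<eta> y)"
    and "\<And>v. (\<lambda>y. \<eta> y v) differentiable (at z)"
  shows "multilinear (Suc k) (ext_deriv k \<eta> z)"
proof -
  have "ext_deriv k \<eta> z = (\<lambda>v. \<Sum>i\<in>{..k}. of_int (sign (cycle_perm i)) * grad \<eta> z (v \<circ> cycle_perm i))"
    by (simp add: ext_deriv_grad fun_eq_iff)
  then show ?thesis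
    using multilinear_grad[OF assms]
    by (auto intro!: multilinear_sum multilinear_scale multilinear_permute cycle_perm_permutes)
qed

definition local_del :: "nat \<Rightarrow> 'n::finite lform \<Rightarrow> 'n lform" where
  "local_del k \<eta> z v = (\<Sum>p\<le>k. bideg (Suc p) (k - p) (ext_deriv k (\<lambda>y. bideg p (k - p) (\<eta> y)) z) v)"

definition local_delbar :: "nat \<Rightarrow> 'n::finite lform \<Rightarrow> 'n lform" where
  "local_delbar k \<eta> z v = (\<Sum>p\<le>k. bideg p (Suc (k - p)) (ext_deriv k (\<lambda>y. bideg p (k - p) (\<eta> y)) z) v)"

lemma form_del_local: "form_del k \<omega> c = local_del k (\<omega> c)"
  by (simp add: form_del_def form_component_def form_d_def local_del_def fun_eq_iff)

lemma form_delbar_local: "form_delbar k \<omega> c = local_delbar k (\<omega> c)"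
  by (simp add: form_delbar_def form_component_def form_d_def local_delbar_def fun_eq_iff)

lemma local_del_cong_open:
  assumes "open S" "z \<in> S" "\<And>y. y \<in> S \<Longrightarrow> \<eta> y = \<eta>' y"
  shows "local_del k \<eta> z = local_del k \<eta>' z" "local_delbar k \<eta> z = local_delbar k \<eta>' z"
  unfolding local_del_def[abs_def] local_delbar_def[abs_def]
  by (intro ext sum.cong refl arg_cong2[where f = "bideg _ _"] ext_deriv_cong_open[OF assms(1,2)] | simp add: assms(3))+

lemma differentiable_bideg:
  assumes "\<And>v. (\<lambda>y. \<eta> y v) differentiable (at z)"
  shows "(\<lambda>y. bideg p q (\<eta> y) v) differentiable (at z)"
  unfolding bideg_def complexify_def
  by (intro differentiable_sum ballI differentiable_mult differentiable_const assms)
    (auto intro: finite_subset[of _ "Pow {..<p + q}"])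

text \<open>The shape of a sum over bidegrees after wedging with a (q,q)-covector: only q \<le> p
  \<le> k + q contributes.\<close>

lemma sum_shift_index:
  fixes G :: "nat \<Rightarrow> 'a::comm_monoid_add" and k q :: nat
  shows "(\<Sum>p\<le>k + 2 * q. if q \<le> p \<and> q \<le> k + 2 * q - p then G (p - q) else 0) = (\<Sum>p\<le>k. G p)"
proof -
  have "(\<Sum>p\<le>k. G p) = (\<Sum>p\<in>{q..k + q}. G (p - q))"
    by (intro sum.reindex_bij_witness[of _ "\<lambda>p. p - q" "\<lambda>p. p + q"]) auto
  also have "\<dots> = (\<Sum>p\<le>k + 2 * q. if q \<le> p \<and> q \<le> k + 2 * q - p then G (p - q) else 0)"
    by (intro sum.mono_neutral_cong_left) auto
  finally show ?thesis by simp
qed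

text \<open>The algebraic hypotheses are made on a neighbourhood because \<open>ext_deriv\<close>
  compares nearby points. Closedness of \<theta> enters at z, where it kills the second term of the
  Leibniz rule.\<close>

context
  fixes S :: "(complex^'n::finite) set" and k q :: nat and \<eta> \<theta> :: "'n lform" and z :: "complex^'n"
  assumes S: "open S" "z \<in> S"
    and \<eta>: "\<And>y. y \<in> S \<Longrightarrow> multilinear k (\<eta> y)" "\<And>v. (\<lambda>y. \<eta> y v) differentiable (at z)"
    and \<theta>: "\<And>y. y \<in> S \<Longrightarrow> multilinear (2 * q) (\<theta> y)" "\<And>y. y \<in> S \<Longrightarrow> unitary_invariant (\<theta> y)"
      "\<And>v. (\<lambda>y. \<theta> y v) differentiable (at z)"
    and closed: "ext_deriv (2 * q) \<theta> z = (\<lambda>v. 0)"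
begin

lemma ext_deriv_bideg_wedge:
  assumes "p \<le> k + 2 * q"
  shows "ext_deriv (k + 2 * q) (\<lambda>y. bideg p (k + 2 * q - p) (wedge k (2 * q) (\<eta> y) (\<theta> y))) z
   = (if q \<le> p \<and> q \<le> k + 2 * q - p
      then wedge (Suc k) (2 * q) (ext_deriv k (\<lambda>y. bideg (p - q) (k - (p - q)) (\<eta> y)) z) (\<theta> z) else (\<lambda>v. 0))"
proof (cases "q \<le> p \<and> q \<le> k + 2 * q - p")
  case True
  have pk: "p - q + (k - (p - q)) = k" using True assms by auto
  have loc: "local_covec k (bideg (p - q) (k - (p - q)) (\<eta> z))"
    using multilinear_local[OF multilinear_bideg[of "p - q" "k - (p - q)" "\<eta> z"]] \<eta>(1)[OF S(2)] pk by simp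
  have "k + 2 * q - p - q = k - (p - q)" using True by auto
  then have "ext_deriv (k + 2 * q) (\<lambda>y. bideg p (k + 2 * q - p) (wedge k (2 * q) (\<eta> y) (\<theta> y))) z
    = ext_deriv (k + 2 * q) (\<lambda>y. wedge k (2 * q) (bideg (p - q) (k - (p - q)) (\<eta> y)) (\<theta> y)) z"
    using True assms by (intro ext_deriv_cong_open[OF S]) (simp add: bideg_wedge[OF \<eta>(1) \<theta>(1,2)])
  also have "\<dots> = wedge (Suc k) (2 * q) (ext_deriv k (\<lambda>y. bideg (p - q) (k - (p - q)) (\<eta> y)) z) (\<theta> z)"
    by (simp add: fun_eq_iff ext_deriv_wedge[OF differentiable_bideg[OF \<eta>(2)] \<theta>(3) loc] closed wedge_zero_right)
  finally show ?thesis using True by simp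
next
  case False
  then have "ext_deriv (k + 2 * q) (\<lambda>y. bideg p (k + 2 * q - p) (wedge k (2 * q) (\<eta> y) (\<theta> y))) z
    = ext_deriv (k + 2 * q) (\<lambda>y v. 0) z"
    using assms by (intro ext_deriv_cong_open[OF S]) (auto simp: bideg_wedge[OF \<eta>(1) \<theta>(1,2)])
  then show ?thesis unfolding if_not_P[OF False] by (simp only: ext_deriv_zero)
qed

lemma multilinear_ext_deriv_bideg:
  assumes "p \<le> k"
  shows "multilinear (Suc k) (ext_deriv k (\<lambda>y. bideg p (k - p) (\<eta> y)) z)"
proof -
  have "multilinear k (bideg p (k - p) (\<eta> y))" if "y \<in> S" for y
    using multilinear_bideg[of p "k - p" "\<eta> y"] \<eta>(1)[OF that] assms by simp
  then show ?thesis by (intro multilinear_ext_deriv[OF S] differentiable_bideg \<eta>(2))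
qed

text \<open>The component taken before d and the one taken after d are both shifted by (q,q), so
  each summand is a summand of \<open>local_del k \<eta> z\<close> wedged with
  \<open>\<theta> z\<close>; the shift is then undone in the summation index.\<close>

lemma local_del_wedge:
  "local_del (k + 2 * q) (\<lambda>y. wedge k (2 * q) (\<eta> y) (\<theta> y)) z = wedge (Suc k) (2 * q) (local_del k \<eta> z) (\<theta> z)"
proof
  fix v
  let ?X = "\<lambda>p. ext_deriv k (\<lambda>y. bideg p (k - p) (\<eta> y)) z"
  have "local_del (k + 2 * q) (\<lambda>y. wedge k (2 * q) (\<eta> y) (\<theta> y)) z v
    = (\<Sum>p\<le>k + 2 * q. if q \<le> p \<and> q \<le> k + 2 * q - p
        then wedge (Suc k) (2 * q) (bideg (Suc (p - q)) (k - (p - q)) (?X (p - q))) (\<theta> z) v else 0)"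
    unfolding local_del_def
  proof (intro sum.cong refl)
    fix p assume "p \<in> {..k + 2 * q}"
    then have p: "p \<le> k + 2 * q" by simp
    show "bideg (Suc p) (k + 2 * q - p) (ext_deriv (k + 2 * q) (\<lambda>y. bideg p (k + 2 * q - p) (wedge k (2 * q) (\<eta> y) (\<theta> y))) z) v
      = (if q \<le> p \<and> q \<le> k + 2 * q - p
        then wedge (Suc k) (2 * q) (bideg (Suc (p - q)) (k - (p - q)) (?X (p - q))) (\<theta> z) v else 0)"
    proof (cases "q \<le> p \<and> q \<le> k + 2 * q - p")
      case True
      have "Suc p - q = Suc (p - q)" "k + 2 * q - p - q = k - (p - q)" "p - q \<le> k" using True p by auto
      then show ?thesis
        using True p bideg_wedge[OF multilinear_ext_deriv_bideg \<theta>(1,2)[OF S(2)], of "p - q" "Suc p" "k + 2 * q - p"]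
        by (simp add: ext_deriv_bideg_wedge[OF p])
    next
      case False
      then show ?thesis by (auto simp: ext_deriv_bideg_wedge[OF p] bideg_zero)
    qed
  qed
  also have "\<dots> = (\<Sum>p\<le>k. wedge (Suc k) (2 * q) (bideg (Suc p) (k - p) (?X p)) (\<theta> z) v)"
    by (rule sum_shift_index)
  also have "\<dots> = wedge (Suc k) (2 * q) (local_del k \<eta> z) (\<theta> z) v"
    by (simp add: local_del_def[abs_def] wedge_sum_left)
  finally show "local_del (k + 2 * q) (\<lambda>y. wedge k (2 * q) (\<eta> y) (\<theta> y)) z v = \<dots>" .
qed

lemma local_delbar_wedge:
  "local_delbar (k + 2 * q) (\<lambda>y. wedge k (2 * q) (\<eta> y) (\<theta> y)) z = wedge (Suc k) (2 * q) (local_delbar k \<eta> z) (\<theta> z)"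
proof
  fix v
  let ?X = "\<lambda>p. ext_deriv k (\<lambda>y. bideg p (k - p) (\<eta> y)) z"
  have "local_delbar (k + 2 * q) (\<lambda>y. wedge k (2 * q) (\<eta> y) (\<theta> y)) z v
    = (\<Sum>p\<le>k + 2 * q. if q \<le> p \<and> q \<le> k + 2 * q - p
        then wedge (Suc k) (2 * q) (bideg (p - q) (Suc (k - (p - q))) (?X (p - q))) (\<theta> z) v else 0)"
    unfolding local_delbar_def
  proof (intro sum.cong refl)
    fix p assume "p \<in> {..k + 2 * q}"
    then have p: "p \<le> k + 2 * q" by simp
    show "bideg p (Suc (k + 2 * q - p)) (ext_deriv (k + 2 * q) (\<lambda>y. bideg p (k + 2 * q - p) (wedge k (2 * q) (\<eta> y) (\<theta> y))) z) v
      = (if q \<le> p \<and> q \<le> k + 2 * q - p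
        then wedge (Suc k) (2 * q) (bideg (p - q) (Suc (k - (p - q))) (?X (p - q))) (\<theta> z) v else 0)"
    proof (cases "q \<le> p \<and> q \<le> k + 2 * q - p")
      case True
      have "Suc (k + 2 * q - p) - q = Suc (k - (p - q))" "p - q \<le> k" using True p by auto
      then show ?thesis
        using True p bideg_wedge[OF multilinear_ext_deriv_bideg \<theta>(1,2)[OF S(2)], of "p - q" p "Suc (k + 2 * q - p)"]
        by (simp add: ext_deriv_bideg_wedge[OF p])
    next
      case False
      then show ?thesis by (auto simp: ext_deriv_bideg_wedge[OF p] bideg_zero)
    qed
  qed
  also have "\<dots> = (\<Sum>p\<le>k. wedge (Suc k) (2 * q) (bideg p (Suc (k - p)) (?X p)) (\<theta> z) v)"
    by (rule sum_shift_index)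
  also have "\<dots> = wedge (Suc k) (2 * q) (local_delbar k \<eta> z) (\<theta> z) v"
    by (simp add: local_delbar_def[abs_def] wedge_sum_left)
  finally show "local_delbar (k + 2 * q) (\<lambda>y. wedge k (2 * q) (\<eta> y) (\<theta> y)) z v = \<dots>" .
qed

end

text \<open>Makes it possible to apply \<open>local_del_wedge\<close> once more, to the outer
  operator in del after delbar.\<close>

lemma multilinear_local_delbar:
  assumes "open S" "z \<in> S" "\<And>y. y \<in> S \<Longrightarrow> multilinear k (\<eta> y)"
    and "\<And>v. (\<lambda>y. \<eta> y v) differentiable (at z)"
  shows "multilinear (Suc k) (local_delbar k \<eta> z)"
proof -
  have "multilinear (Suc k) (bideg p (Suc (k - p)) (ext_deriv k (\<lambda>y. bideg p (k - p) (\<eta> y)) z))" if "p \<le> k" for p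
  proof -
    have "multilinear k (bideg p (k - p) (\<eta> y))" if "y \<in> S" for y
      using multilinear_bideg[of p "k - p" "\<eta> y"] assms(3)[OF that] \<open>p \<le> k\<close> by simp
    then have "multilinear (Suc k) (ext_deriv k (\<lambda>y. bideg p (k - p) (\<eta> y)) z)"
      by (intro multilinear_ext_deriv[OF assms(1,2)] differentiable_bideg assms(4))
    then show ?thesis
      using multilinear_bideg[of p "Suc (k - p)" "ext_deriv k (\<lambda>y. bideg p (k - p) (\<eta> y)) z"] that by simp
  qed
  then show ?thesis unfolding local_delbar_def[abs_def] by (intro multilinear_sum) simp
qed

section \<open>Positivity\<close>

definition jseq :: "(nat \<Rightarrow> complex^'n) \<Rightarrow> nat \<Rightarrow> complex^'n::finite" where
  "jseq e = (\<lambda>i. if even i then e (i div 2) else \<i> *s e (i div 2))"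

lemma jseq_simps [simp]: "jseq e (2 * j) = e j" "jseq e (Suc (2 * j)) = \<i> *s e j"
  by (simp_all add: jseq_def)

text \<open>Independence of an indexed family, so that permuting and shearing the vectors are
  computations with coefficients; \<open>positive_volume_on\<close> expresses the same through the
  image set and injectivity.\<close>

definition fam_indep :: "nat \<Rightarrow> (nat \<Rightarrow> complex^'n::finite) \<Rightarrow> bool" where
  "fam_indep p e \<longleftrightarrow> (\<forall>c. (\<Sum>j<p. c j *s e j) = 0 \<longrightarrow> (\<forall>j<p. c j = 0))"

lemma fam_indepI_basis:
  assumes "inj_on e {..<p}" "vec.independent (e ` {..<p})"
  shows "fam_indep p e"
  unfolding fam_indep_def
proof (intro allI impI)
  fix c j assume c: "(\<Sum>j<p. c j *s e j) = 0" and j: "j < p"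
  define u where "u x = c (inv_into {..<p} e x)" for x
  have u: "u (e i) = c i" if "i < p" for i
    using that assms(1) by (simp add: u_def)
  have "(\<Sum>x\<in>e ` {..<p}. u x *s x) = 0"
    using c by (simp add: sum.reindex[OF assms(1)] u)
  then have "u (e j) = 0"
    using assms(2) j vec.dependent_finite[of "e ` {..<p}"] by auto
  then show "c j = 0" using u j by simp
qed

lemma fam_indepD_basis:
  assumes "fam_indep p e"
  shows "inj_on e {..<p}" "vec.independent (e ` {..<p})"
proof -
  show inj: "inj_on e {..<p}"
  proof (rule inj_onI, rule ccontr)
    fix i j assume ij: "i \<in> {..<p}" "j \<in> {..<p}" "e i = e j" "i \<noteq> j"
    define c where "c k = (if k = i then 1 else if k = j then -1 else 0 :: complex)" for k
    have "(\<Sum>k<p. c k *s e k) = (\<Sum>k<p. (if k = i then e i else 0) + (if k = j then - e j else 0))"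
      using ij by (intro sum.cong) (auto simp: c_def)
    also have "\<dots> = 0" using ij by (simp add: sum.distrib)
    finally have "c i = 0" using assms ij unfolding fam_indep_def by blast
    then show False by (simp add: c_def)
  qed
  show "vec.independent (e ` {..<p})"
  proof
    assume "vec.dependent (e ` {..<p})"
    then obtain u x where u: "x \<in> e ` {..<p}" "u x \<noteq> 0" "(\<Sum>x\<in>e ` {..<p}. u x *s x) = 0"
      using vec.dependent_finite[of "e ` {..<p}"] by auto
    have "(\<Sum>j<p. u (e j) *s e j) = 0" using u(3) by (simp add: sum.reindex[OF inj])
    then show False using assms u(1,2) unfolding fam_indep_def by auto
  qed
qed

lemma fam_indep_dim: "fam_indep p e \<Longrightarrow> vec.dim (vec.span (e ` {..<p})) = p"
  using fam_indepD_basis[of p e] by (simp add: vec.dim_eq_card_independent card_image)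

lemma fam_indep_permute:
  assumes "fam_indep p e" "t permutes {..<p}"
  shows "fam_indep p (e \<circ> t)"
  unfolding fam_indep_def
proof (intro allI impI)
  fix c j assume c: "(\<Sum>j<p. c j *s (e \<circ> t) j) = 0" and j: "j < p"
  have "(\<Sum>j<p. c (inv t j) *s e j) = (\<Sum>j<p. c j *s (e \<circ> t) j)"
    by (subst sum.permute[OF assms(2)]) (simp add: o_def permutes_inverses[OF assms(2)])
  with c assms(1) have "c (inv t (t j)) = 0"
    using permutes_in_image[OF assms(2), of j] j unfolding fam_indep_def by auto
  then show "c j = 0" by (simp add: permutes_inverses[OF assms(2)])
qed

lemma fam_indep_shear:
  assumes "fam_indep (Suc p) e"
  shows "fam_indep p (\<lambda>j. if j < p then e j + d j *s e p else e j)"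
  unfolding fam_indep_def
proof (intro allI impI)
  fix c j assume c: "(\<Sum>j<p. c j *s (if j < p then e j + d j *s e p else e j)) = 0" and j: "j < p"
  define c' where "c' j = (if j < p then c j else (\<Sum>j<p. c j * d j))" for j
  have "(\<Sum>j<Suc p. c' j *s e j) = (\<Sum>j<p. c j *s e j) + (\<Sum>j<p. c j * d j) *s e p"
    by (simp add: c'_def)
  also have "\<dots> = (\<Sum>j<p. c j *s (if j < p then e j + d j *s e p else e j))"
    by (simp add: vec.scale_right_distrib sum.distrib vec.scale_sum_left)
  finally have "c' j = 0" using assms c j unfolding fam_indep_def by simp
  then show "c j = 0" using j by (simp add: c'_def)
qed

lemma k_covector_add_combination:
  assumes "k_covector n \<zeta>" "i < n" "a < n" "b < n" "a \<noteq> i" "b \<noteq> i"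
  shows "\<zeta> (v(i := v i + (r *\<^sub>R v a + s *\<^sub>R v b))) = \<zeta> v"
proof -
  have ml: "multilinear n \<zeta>" using assms by (simp add: k_covector_iff)
  have z: "\<zeta> (v(i := v j)) = 0" if "j < n" "j \<noteq> i" for j
    using assms(1,2) that unfolding k_covector_iff alternating_def
    by (metis fun_upd_other fun_upd_same)
  show ?thesis
    using multilinear_update[OF ml assms(2), of v 1 "v i" 1 "r *\<^sub>R v a + s *\<^sub>R v b"]
      multilinear_update[OF ml assms(2), of v r "v a" s "v b"] z assms by simp
qed

text \<open>Adding a complex multiple of \<open>e k\<close> to \<open>e j\<close> alters the real
  slots 2j and 2j + 1 by combinations of the slots 2k and 2k + 1, and an alternating form ignores
  such changes.\<close>

lemma k_covector_jseq_add:
  assumes "k_covector (2 * p) \<zeta>" "j < p" "k < p" "j \<noteq> k"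
  shows "\<zeta> (jseq (e(j := e j + c *s e k))) = \<zeta> (jseq e)"
proof -
  define v where "v = jseq e"
  define v1 where "v1 = v(2 * j := v (2 * j) + (Re c *\<^sub>R v (2 * k) + Im c *\<^sub>R v (Suc (2 * k))))"
  \<comment> \<open>The coefficients come from i c = - Im c + i Re c.\<close>
  define v2 where "v2 = v1(Suc (2 * j) := v1 (Suc (2 * j)) + ((- Im c) *\<^sub>R v1 (2 * k) + Re c *\<^sub>R v1 (Suc (2 * k))))"
  have ne: "2 * k \<noteq> Suc (2 * j)" "Suc (2 * k) \<noteq> 2 * j" "Suc (2 * j) \<noteq> 2 * k" by presburger+
  have "\<zeta> v2 = \<zeta> v1" unfolding v2_def
    using assms ne by (intro k_covector_add_combination[OF assms(1)]) auto
  also have "\<zeta> v1 = \<zeta> v" unfolding v1_def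
    using assms ne by (intro k_covector_add_combination[OF assms(1)]) auto
  finally have "\<zeta> v2 = \<zeta> v" .
  moreover have "v2 = jseq (e(j := e j + c *s e k))"
  proof
    fix i
    obtain l where "i = 2 * l \<or> i = Suc (2 * l)"
      by (metis evenE oddE Suc_eq_plus1)
    then show "v2 i = jseq (e(j := e j + c *s e k)) i"
      using assms(4) ne
      by (auto simp: v2_def v1_def v_def vec_eq_iff complex_eq_iff)
  qed
  ultimately show ?thesis by (simp add: v_def)
qed

lemma k_covector_jseq_shear:
  assumes "k_covector (2 * Suc p) \<zeta>"
  shows "\<zeta> (jseq (\<lambda>j. if j < p then e j + d j *s e p else e j)) = \<zeta> (jseq e)"
proof -
  define er where "er r = (\<lambda>j. if j < r then e j + d j *s e p else e j)" for r :: nat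
  have "\<zeta> (jseq (er r)) = \<zeta> (jseq e)" if "r \<le> p" for r
    using that
  proof (induction r)
    case 0
    then show ?case by (simp add: er_def)
  next
    case (Suc r)
    have eq: "er (Suc r) = (er r)(r := er r r + d r *s er r p)"
      using Suc.prems by (auto simp: er_def fun_eq_iff less_Suc_eq)
    have "\<zeta> (jseq ((er r)(r := er r r + d r *s er r p))) = \<zeta> (jseq (er r))"
      using Suc.prems by (intro k_covector_jseq_add[OF assms]) auto
    then show ?case
      unfolding eq using Suc.IH[OF Suc_leD[OF Suc.prems]] by (rule trans)
  qed
  from this[of p] show ?thesis by (simp add: er_def)
qed

text \<open>One exchange of complex vectors is two exchanges of real ones, an even permutation: the
  canonical orientation does not depend on the order of the complex basis.\<close>

lemma k_covector_jseq_swap: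
  assumes "k_covector (2 * p) \<zeta>" "a < p" "b < p"
  shows "\<zeta> (jseq (e \<circ> Transposition.transpose a b)) = \<zeta> (jseq e)"
proof (cases "a = b")
  case False
  let ?s = "Transposition.transpose (2 * a) (2 * b)" and ?t = "Transposition.transpose (Suc (2 * a)) (Suc (2 * b))"
  have s: "?s permutes {..<2 * p}" and t: "?t permutes {..<2 * p}"
    using assms by (auto intro!: permutes_swap_id)
  have "jseq (e \<circ> Transposition.transpose a b) = jseq e \<circ> ?s \<circ> ?t"
  proof
    fix i
    obtain l where l: "i = 2 * l \<or> i = Suc (2 * l)"
      by (metis evenE oddE Suc_eq_plus1)
    have ne: "2 * x \<noteq> Suc (2 * y)" "Suc (2 * x) \<noteq> 2 * y" for x y :: nat by presburger+
    show "jseq (e \<circ> Transposition.transpose a b) i = (jseq e \<circ> ?s \<circ> ?t) i"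
      using l ne by (cases "l = a"; cases "l = b") (auto simp: Transposition.transpose_def)
  qed
  then show ?thesis
    using False by (simp add: k_covector_permute[OF assms(1) s] k_covector_permute[OF assms(1) t] sign_swap_id)
qed simp

text \<open>For complex linear \<beta> this is (i/2) times the wedge of \<beta> with its conjugate;
  on the pair (x, i x) it takes the value |\<beta>(x)|^2.\<close>

definition rank_one :: "(complex^'n::finite \<Rightarrow> complex) \<Rightarrow> 'n covec" where
  "rank_one \<beta> v = complex_of_real (- Im (\<beta> (v 0) * cnj (\<beta> (v 1))))"

text \<open>A permutation contributes only if both arguments of \<open>rank_one\<close> come from
  the last pair, \<open>e p\<close> and its multiple by i, since \<beta> kills all the others.
  Whether it keeps or exchanges that pair, its contribution is the same, because an exchange flips
  both \<open>rank_one\<close> and the sign. The constant counts these permutations and is positive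
  because the identity is one of them.\<close>

lemma wedge_rank_one_jseq:
  fixes \<eta> :: "'n::finite covec"
  assumes \<eta>: "k_covector (2 * p) \<eta>" and \<beta>: "\<And>j. j < p \<Longrightarrow> \<beta> (e j) = 0"
    and \<beta>i: "\<And>x. \<beta> (\<i> *s x) = \<i> * \<beta> x"
  shows "\<exists>c>0. wedge (2 * p) 2 \<eta> (rank_one \<beta>) (jseq e) = complex_of_real (c * (norm (\<beta> (e p)))\<^sup>2) * \<eta> (jseq e)"
proof -
  define v where "v = jseq e"
  define x where "x = complex_of_real ((norm (\<beta> (e p)))\<^sup>2) * \<eta> v"
  define P where "P = {s. s permutes {..<2 * p + 2}}"
  define G where "G = {s \<in> P. 2 * p \<le> s (2 * p) \<and> 2 * p \<le> s (Suc (2 * p))}"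
  have finP: "finite P" unfolding P_def by (intro finite_permutations) simp
  have v0: "\<beta> (v i) = 0" if "i < 2 * p" for i
  proof -
    obtain l where l: "i = 2 * l \<or> i = Suc (2 * l)"
      by (metis evenE oddE Suc_eq_plus1)
    then have "l < p" using that by auto
    then show ?thesis using l \<beta> by (auto simp: v_def \<beta>i)
  qed
  have nn: "\<beta> (e p) * cnj (\<beta> (e p)) = complex_of_real ((norm (\<beta> (e p)))\<^sup>2)"
    using complex_norm_square by (metis)
  have summand: "of_int (sign s) * \<eta> (\<lambda>i. v (s i)) * rank_one \<beta> (\<lambda>i. v (s (2 * p + i)))
       = (if s \<in> G then x else 0)" if s: "s \<in> P" for s
  proof (cases "s \<in> G")
    case False
    then have "\<beta> (v (s (2 * p))) = 0 \<or> \<beta> (v (s (Suc (2 * p)))) = 0"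
      using s v0 by (auto simp: G_def not_le)
    then show ?thesis using False by (auto simp: rank_one_def)
  next
    case True
    have sp: "s permutes {..<2 * p + 2}" using s by (simp add: P_def)
    have inj: "s i = s j \<longleftrightarrow> i = j" for i j using permutes_inj[OF sp] by (simp add: inj_eq)
    have "s (2 * p) < 2 * p + 2" "s (Suc (2 * p)) < 2 * p + 2"
      using permutes_in_image[OF sp, of "2 * p"] permutes_in_image[OF sp, of "Suc (2 * p)"] by auto
    moreover have "s (2 * p) \<noteq> s (Suc (2 * p))" by (simp add: inj)
    ultimately consider (id) "s (2 * p) = 2 * p" "s (Suc (2 * p)) = Suc (2 * p)"
      | (swap) "s (2 * p) = Suc (2 * p)" "s (Suc (2 * p)) = 2 * p"
      using True unfolding G_def by force
    then show ?thesis
    proof cases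
      case id
      have "s permutes {..<2 * p}"
        by (rule permutes_superset[OF sp]) (use id less_2_cases in \<open>auto simp: less_Suc_eq\<close>)
      from k_covector_permute[OF \<eta> this, of v]
      have "of_int (sign s) * \<eta> (\<lambda>i. v (s i)) = of_int (sign s * sign s) * \<eta> v"
        by (simp only: o_def of_int_mult mult.assoc)
      moreover have "rank_one \<beta> (\<lambda>i. v (s (2 * p + i))) = complex_of_real ((norm (\<beta> (e p)))\<^sup>2)"
        using id nn by (simp add: rank_one_def v_def \<beta>i mult.left_commute)
      ultimately show ?thesis using True by (simp add: x_def)
    next
      case swap
      \<comment> \<open>Undoing the exchange leaves a permutation of the first 2p positions, of
        opposite sign.\<close>
      define t where "t = Transposition.transpose (2 * p) (Suc (2 * p)) \<circ> s"
      have "t permutes {..<2 * p + 2}"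
        unfolding t_def by (intro permutes_compose[OF sp] permutes_swap_id) auto
      then have tp: "t permutes {..<2 * p}"
        by (rule permutes_superset) (use swap in \<open>auto simp: t_def less_Suc_eq\<close>)
      have sgn: "sign t = - sign s" unfolding t_def by (intro sign_transpose_compose[OF _ sp]) simp
      have "t i = s i" if "i < 2 * p" for i
      proof -
        have "s i \<noteq> 2 * p" "s i \<noteq> Suc (2 * p)"
          using that inj[of i "Suc (2 * p)"] inj[of i "2 * p"] unfolding swap by auto
        then show ?thesis by (simp add: t_def)
      qed
      then have "\<eta> (\<lambda>i. v (s i)) = \<eta> (v \<circ> t)"
        using \<eta> by (intro local_covecD[of "2 * p" \<eta>]) (auto simp: k_covector_iff multilinear_local)
      also have "\<dots> = - of_int (sign s) * \<eta> v"
        unfolding k_covector_permute[OF \<eta> tp] sgn by simp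
      finally have "of_int (sign s) * \<eta> (\<lambda>i. v (s i)) = - (of_int (sign s * sign s) * \<eta> v)"
        by (simp only: of_int_mult) (simp add: mult.assoc)
      moreover have "rank_one \<beta> (\<lambda>i. v (s (2 * p + i))) = - complex_of_real ((norm (\<beta> (e p)))\<^sup>2)"
        using swap nn by (simp add: rank_one_def v_def \<beta>i mult.assoc)
      ultimately show ?thesis using True by (simp add: x_def)
    qed
  qed
  have "wedge (2 * p) 2 \<eta> (rank_one \<beta>) v = (\<Sum>s\<in>P. if s \<in> G then x else 0) / (fact (2 * p) * fact 2)"
    unfolding wedge_def P_def[symmetric] by (simp add: summand)
  also have "(\<Sum>s\<in>P. if s \<in> G then x else 0) = of_nat (card G) * x"
    using finP by (subst sum.inter_restrict[symmetric]) (auto simp: G_def Int_def)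
  finally have "wedge (2 * p) 2 \<eta> (rank_one \<beta>) v
     = complex_of_real (real (card G) / (fact (2 * p) * fact 2) * (norm (\<beta> (e p)))\<^sup>2) * \<eta> v"
    by (simp add: x_def)
  moreover have "id \<in> G" by (simp add: G_def P_def permutes_id)
  moreover have "finite G" unfolding G_def using finP by simp
  ultimately have "card G > 0" "wedge (2 * p) 2 \<eta> (rank_one \<beta>) v
     = complex_of_real (real (card G) / (fact (2 * p) * fact 2) * (norm (\<beta> (e p)))\<^sup>2) * \<eta> v"
    by (auto simp: card_gt_0_iff)
  then show ?thesis unfolding v_def by (intro exI[of _ "real (card G) / (fact (2 * p) * fact 2)"]) simp
qed

lemma scaleR_vec_complex: "r *\<^sub>R x = complex_of_real r *s x"
  by (simp only: vec_eq_iff vector_scaleR_component vector_smult_component) (simp add: scaleR_conv_of_real)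

lemma k_covector_rank_one:
  assumes "Vector_Spaces.linear (*s) (*) \<beta>"
  shows "k_covector 2 (rank_one \<beta>)"
proof -
  interpret \<beta>: Vector_Spaces.linear "(*s)" "(*)" \<beta> by (rule assms)
  have lin: "linear \<beta>"
    by (intro linearI) (simp_all add: \<beta>.add scaleR_vec_complex \<beta>.scale scaleR_conv_of_real[where 'a = complex])
  show ?thesis
    unfolding k_covector_def
  proof (intro conjI allI impI)
    fix v :: "nat \<Rightarrow> complex^'a" and i :: nat assume "i < 2"
    then show "linear (\<lambda>x. rank_one \<beta> (v(i := x)))"
      using linear_add[OF lin] linear_scale[OF lin]
      by (intro linearI) (auto simp: rank_one_def less_2_cases_iff algebra_simps scaleR_conv_of_real)
  next
    fix v :: "nat \<Rightarrow> complex^'a" and i j :: nat assume "i < 2" "j < 2" "i \<noteq> j" "v i = v j"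
    then have "v 0 = v 1" by (auto simp: less_2_cases_iff)
    then show "rank_one \<beta> v = 0" by (simp add: rank_one_def)
  qed (simp add: rank_one_def)
qed

lemma k_covector_sum:
  assumes "\<And>l. l \<in> L \<Longrightarrow> k_covector k (\<eta> l)"
  shows "k_covector k (\<lambda>v. \<Sum>l\<in>L. \<eta> l v)"
  using assms multilinear_sum[of L k \<eta>]
  unfolding k_covector_iff alternating_def by (auto intro!: sum.neutral)

text \<open>Gaussian elimination on the basis e: a vector on which \<beta> is nonzero is moved to
  the end, and multiples of it are added to the others until these lie in the kernel. Neither move
  changes the value of a covector of degree 2 (p + 1), so the value is a positive multiple of that
  of \<eta> on a hyperplane section.\<close>

lemma wedge_rank_one_step:
  fixes \<eta> :: "'n::finite covec"
  assumes \<eta>: "k_covector (2 * p) \<eta>" and \<beta>: "Vector_Spaces.linear (*s) (*) \<beta>" and e: "fam_indep (Suc p) e"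
  shows "(\<forall>j<Suc p. \<beta> (e j) = 0) \<and> wedge (2 * p) 2 \<eta> (rank_one \<beta>) (jseq e) = 0
    \<or> (\<exists>c>0. \<exists>e'. fam_indep p e' \<and> vec.span (e' ` {..<p}) \<subseteq> vec.span (e ` {..<Suc p}) \<inter> {x. \<beta> x = 0}
         \<and> wedge (2 * p) 2 \<eta> (rank_one \<beta>) (jseq e) = complex_of_real c * \<eta> (jseq e'))"
proof -
  interpret \<beta>: Vector_Spaces.linear "(*s)" "(*)" \<beta> by (rule \<beta>)
  let ?W = "wedge (2 * p) 2 \<eta> (rank_one \<beta>)"
  have W: "k_covector (2 * Suc p) ?W"
    using k_covector_wedge[OF \<eta> k_covector_rank_one[OF \<beta>]] by simp
  show ?thesis
  proof (cases "\<forall>j<Suc p. \<beta> (e j) = 0")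
    case True
    then have "?W (jseq e) = 0"
      using wedge_rank_one_jseq[OF \<eta>, of \<beta> e] by (auto simp: \<beta>.scale)
    with True show ?thesis by blast
  next
    case False
    then obtain k where k: "k < Suc p" "\<beta> (e k) \<noteq> 0" by blast
    define t where "t = Transposition.transpose k p"
    have t: "t permutes {..<Suc p}" unfolding t_def using k by (intro permutes_swap_id) auto
    define e1 where "e1 = e \<circ> t"
    have e1: "fam_indep (Suc p) e1" unfolding e1_def by (rule fam_indep_permute[OF e t])
    have e1p: "\<beta> (e1 p) \<noteq> 0" using k by (simp add: e1_def t_def)
    define d where "d j = - \<beta> (e1 j) / \<beta> (e1 p)" for j
    define e' where "e' = (\<lambda>j. if j < p then e1 j + d j *s e1 p else e1 j)"
    have z: "\<beta> (e' j) = 0" if "j < p" for j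
      using that e1p by (simp add: e'_def \<beta>.add \<beta>.diff \<beta>.scale d_def)
    have e'p: "\<beta> (e' p) \<noteq> 0" using e1p by (simp add: e'_def)
    obtain c where c: "c > 0" "?W (jseq e') = complex_of_real (c * (norm (\<beta> (e' p)))\<^sup>2) * \<eta> (jseq e')"
      using wedge_rank_one_jseq[OF \<eta>, of \<beta> e'] z by (auto simp: \<beta>.scale)
    have "?W (jseq e') = ?W (jseq e1)"
      unfolding e'_def by (rule k_covector_jseq_shear[OF W])
    also have "\<dots> = ?W (jseq e)"
      unfolding e1_def t_def using k by (intro k_covector_jseq_swap[OF W]) auto
    finally have eq: "?W (jseq e) = complex_of_real (c * (norm (\<beta> (e' p)))\<^sup>2) * \<eta> (jseq e')" using c(2) by simp
    have in_span: "e1 j \<in> vec.span (e ` {..<Suc p})" if "j < Suc p" for j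
      using that permutes_in_image[OF t, of j] by (intro vec.span_base) (auto simp: e1_def)
    have "e' ` {..<p} \<subseteq> vec.span (e ` {..<Suc p}) \<inter> {x. \<beta> x = 0}"
      using z in_span by (auto simp: e'_def intro!: vec.span_add vec.span_scale)
    moreover have "vec.subspace (vec.span (e ` {..<Suc p}) \<inter> {x. \<beta> x = 0})"
      by (intro vec.subspace_inter vec.subspace_span \<beta>.subspace_kernel)
    ultimately have "vec.span (e' ` {..<p}) \<subseteq> vec.span (e ` {..<Suc p}) \<inter> {x. \<beta> x = 0}"
      by (rule vec.span_minimal)
    moreover have "fam_indep p e'" unfolding e'_def by (rule fam_indep_shear[OF e1])
    moreover have "c * (norm (\<beta> (e' p)))\<^sup>2 > 0" using c(1) e'p by simp
    ultimately show ?thesis using eq by blast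
  qed
qed

text \<open>Nonnegativity on all complex subspaces, strict on those meeting \<open>K\<close> in dimension at most \<open>a\<close>:
  this is what survives a wedge product with a semipositive \<open>(1,1)\<close>-covector with kernel \<open>K\<close>.\<close>

definition positive_mod :: "nat \<Rightarrow> (complex^'n::finite) set \<Rightarrow> nat \<Rightarrow> 'n covec \<Rightarrow> bool" where
  "positive_mod a K p \<eta> \<longleftrightarrow> (\<forall>e. fam_indep p e \<longrightarrow> 0 \<le> Re (\<eta> (jseq e)) \<and>
     (vec.dim (vec.span (e ` {..<p}) \<inter> K) \<le> a \<longrightarrow> 0 < Re (\<eta> (jseq e))))"

text \<open>Every summand is nonnegative by \<open>wedge_rank_one_step\<close>. If the span meets K
  in dimension at most a, it is not inside K, having dimension p + 1 > a, so some
  \<open>\<beta> l\<close> is nonzero on it. The hyperplane section this produces lies inside the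
  span, so it again meets K in dimension at most a, and \<eta> is strictly positive there.\<close>

lemma positive_mod_wedge:
  fixes \<eta> :: "'n::finite covec"
  assumes \<eta>: "k_covector (2 * p) \<eta>" "positive_mod a K p \<eta>" and "a \<le> p"
    and L: "finite L" "\<And>l. l \<in> L \<Longrightarrow> Vector_Spaces.linear (*s) (*) (\<beta> l)"
    and K: "K = {x. \<forall>l\<in>L. \<beta> l x = 0}"
  shows "positive_mod a K (Suc p) (wedge (2 * p) 2 \<eta> (\<lambda>v. \<Sum>l\<in>L. rank_one (\<beta> l) v))"
  unfolding positive_mod_def
proof (intro allI impI)
  fix e :: "nat \<Rightarrow> complex^'n" assume e: "fam_indep (Suc p) e"
  let ?W = "\<lambda>l. wedge (2 * p) 2 \<eta> (rank_one (\<beta> l)) (jseq e)"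
  have Re: "Re (wedge (2 * p) 2 \<eta> (\<lambda>v. \<Sum>l\<in>L. rank_one (\<beta> l) v) (jseq e)) = (\<Sum>l\<in>L. Re (?W l))"
    by (simp add: wedge_sum_right)
  have nonneg: "0 \<le> Re (?W l)" if "l \<in> L" for l
    using wedge_rank_one_step[OF \<eta>(1) L(2)[OF that] e] \<eta>(2) unfolding positive_mod_def by auto
  have "0 < (\<Sum>l\<in>L. Re (?W l))" if d: "vec.dim (vec.span (e ` {..<Suc p}) \<inter> K) \<le> a"
  proof -
    have "\<not> vec.span (e ` {..<Suc p}) \<subseteq> K"
      using d fam_indep_dim[OF e] \<open>a \<le> p\<close> by (auto simp: Int_absorb2)
    moreover have "vec.subspace K"
    proof -
      have "K = (\<Inter>l\<in>L. {x. \<beta> l x = 0})" using K by auto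
      moreover have "vec.subspace {x. \<beta> l x = 0}" if "l \<in> L" for l
      proof -
        interpret \<beta>: Vector_Spaces.linear "(*s)" "(*)" "\<beta> l" by (rule L(2)[OF that])
        show ?thesis by (rule \<beta>.subspace_kernel)
      qed
      ultimately show ?thesis by (auto intro: vec.subspace_Inter)
    qed
    ultimately have "\<not> e ` {..<Suc p} \<subseteq> K" using vec.span_minimal by blast
    then obtain l j where l: "l \<in> L" "j < Suc p" "\<beta> l (e j) \<noteq> 0" using K by auto
    then obtain c e' where c: "c > 0" "fam_indep p e'" "vec.span (e' ` {..<p}) \<subseteq> vec.span (e ` {..<Suc p})"
        "?W l = complex_of_real c * \<eta> (jseq e')"
      using wedge_rank_one_step[OF \<eta>(1) L(2)[OF l(1)] e] by blast
    have "vec.dim (vec.span (e' ` {..<p}) \<inter> K) \<le> vec.dim (vec.span (e ` {..<Suc p}) \<inter> K)"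
      using c(3) by (intro vec.dim_subset) auto
    then have "0 < Re (\<eta> (jseq e'))" using \<eta>(2) c(2) d unfolding positive_mod_def by auto
    then have "0 < Re (?W l)" using c(1,4) by simp
    then show ?thesis using nonneg l(1) L(1) by (intro sum_pos2[of L l]) auto
  qed
  then show "0 \<le> Re (wedge (2 * p) 2 \<eta> (\<lambda>v. \<Sum>l\<in>L. rank_one (\<beta> l) v) (jseq e)) \<and>
     (vec.dim (vec.span (e ` {..<Suc p}) \<inter> K) \<le> a \<longrightarrow>
      0 < Re (wedge (2 * p) 2 \<eta> (\<lambda>v. \<Sum>l\<in>L. rank_one (\<beta> l) v) (jseq e)))"
    using nonneg by (simp add: Re sum_nonneg)
qed

text \<open>Associativity moves one factor \<psi> from the power over to \<eta>, so the induction
  lets p and \<eta> vary.\<close>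

lemma positive_mod_wedge_power:
  fixes \<eta> :: "'n::finite covec"
  assumes L: "finite L" "\<And>l. l \<in> L \<Longrightarrow> Vector_Spaces.linear (*s) (*) (\<beta> l)"
    and K: "K = {x. \<forall>l\<in>L. \<beta> l x = 0}"
    and \<psi>: "\<psi> = (\<lambda>v. \<Sum>l\<in>L. rank_one (\<beta> l) v)"
    and "k_covector (2 * p) \<eta>" "positive_mod a K p \<eta>" "a \<le> p"
  shows "positive_mod a K (p + q) (wedge (2 * p) (2 * q) \<eta> (wedge_power \<psi> q))"
  using assms(5-)
proof (induction q arbitrary: p \<eta>)
  case 0
  then show ?case by (simp add: wedge_one)
next
  case (Suc q)
  have \<psi>2: "k_covector 2 \<psi>"
    unfolding \<psi> by (intro k_covector_sum k_covector_rank_one L(2))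
  let ?\<eta> = "wedge (2 * p) 2 \<eta> \<psi>"
  have 1: "k_covector (2 * Suc p) ?\<eta>" using k_covector_wedge[OF Suc.prems(1) \<psi>2] by simp
  have 2: "positive_mod a K (Suc p) ?\<eta>" unfolding \<psi> by (rule positive_mod_wedge[OF Suc.prems L K])
  have "wedge (2 * p) (2 * Suc q) \<eta> (wedge_power \<psi> (Suc q)) = wedge (2 * p + 2) (2 * q) ?\<eta> (wedge_power \<psi> q)"
    using Suc.prems(1) wedge_assoc[of "2 * p" \<eta> 2 "2 * q" \<psi> "wedge_power \<psi> q"]
    by (simp add: k_covector_iff multilinear_local)
  also have "2 * p + 2 = 2 * Suc p" by simp
  finally show ?case using Suc.IH[OF 1 2] Suc.prems(3) by simp
qed

section \<open>Semidefinite hermitian forms as sums of squares\<close>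

definition hermitian_form :: "(complex^'n::finite \<Rightarrow> complex^'n \<Rightarrow> complex) \<Rightarrow> bool" where
  "hermitian_form g \<longleftrightarrow> (\<forall>w. Vector_Spaces.linear (*s) (*) (\<lambda>u. g u w)) \<and> (\<forall>u w. g w u = cnj (g u w)) \<and>
     (\<forall>u. 0 \<le> Re (g u u))"

lemma hermitian_form_simps:
  assumes "hermitian_form g"
  shows "g (u + u') w = g u w + g u' w" "g (c *s u) w = c * g u w"
    "g u (w + w') = g u w + g u w'" "g u (c *s w) = cnj c * g u w"
    "Im (g u u) = 0" "0 \<le> Re (g u u)"
proof -
  have "Vector_Spaces.linear (*s) (*) (\<lambda>u. g u w)" for w
    using assms unfolding hermitian_form_def by blast
  note lin = this[unfolded linear_iff_module_hom]
  have sym: "g w u = cnj (g u w)" for u w using assms unfolding hermitian_form_def by blast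
  show 1: "g (u + u') w = g u w + g u' w" for u u' w by (rule module_hom.add[OF lin])
  show 2: "g (c *s u) w = c * g u w" for c u w by (rule module_hom.scale[OF lin])
  have "g u (w + w') = cnj (g w u) + cnj (g w' u)"
    unfolding sym[of u "w + w'"] 1 by simp
  then show "g u (w + w') = g u w + g u w'" by (simp only: sym[of u w] sym[of u w'])
  have "g u (c *s w) = cnj c * cnj (g w u)"
    unfolding sym[of u "c *s w"] 2 by simp
  then show "g u (c *s w) = cnj c * g u w" by (simp only: sym[of u w])
  show "Im (g u u) = 0" using arg_cong[where f = Im, OF sym[of u u]] by simp
  show "0 \<le> Re (g u u)" using assms unfolding hermitian_form_def by blast
qed

lemma hermitian_form_sym: "hermitian_form g \<Longrightarrow> g w u = cnj (g u w)"
  unfolding hermitian_form_def by blast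

lemma hermitian_form_linear: "hermitian_form g \<Longrightarrow> Vector_Spaces.linear (*s) (*) (\<lambda>u. g u w)"
  unfolding hermitian_form_def by blast

text \<open>Stated for semidefinite forms because the remainders in
  \<open>hermitian_form_decompose_aux\<close> degenerate; \<open>g x x = 0\<close> is therefore a
  genuine case.\<close>

lemma hermitian_form_cauchy_schwarz:
  assumes g: "hermitian_form g"
  shows "(norm (g u x))\<^sup>2 \<le> Re (g u u) * Re (g x x)"
proof -
  note s = hermitian_form_simps[OF g]
  have expand: "0 \<le> Re (g u u) - 2 * t * (norm (g u x))\<^sup>2 + t\<^sup>2 * (norm (g u x))\<^sup>2 * Re (g x x)" for t :: real
  proof -
    \<comment> \<open>This multiple of \<open>g u x\<close> gives both cross terms the real part -t
      |g u x|^2.\<close>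
    define c where "c = - complex_of_real t * g u x"
    have ux: "Re (cnj c * g u x) = - t * (norm (g u x))\<^sup>2" "Re (c * g x u) = - t * (norm (g u x))\<^sup>2"
      unfolding hermitian_form_sym[OF g, of x u]
      by (simp_all add: c_def cmod_power2) (simp_all add: power2_eq_square algebra_simps)
    have xx: "Re (c * (cnj c * g x x)) = t\<^sup>2 * (norm (g u x))\<^sup>2 * Re (g x x)"
    proof -
      have "c * (cnj c * g x x) = complex_of_real ((norm c)\<^sup>2) * g x x"
        by (metis complex_norm_square mult.assoc)
      then show ?thesis by (simp only: times_complex.simps Re_complex_of_real Im_complex_of_real) (simp add: c_def norm_mult power_mult_distrib)
    qed
    have "g (u + c *s x) (u + c *s x) = g u u + cnj c * g u x + (c * g x u + c * (cnj c * g x x))"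
      by (simp add: s(1-4) algebra_simps)
    then show ?thesis using s(6)[of "u + c *s x"] ux xx by simp
  qed
  show ?thesis
  proof (cases "Re (g x x) = 0")
    case True
    have "(norm (g u x))\<^sup>2 = 0"
    proof (rule ccontr)
      assume n: "(norm (g u x))\<^sup>2 \<noteq> 0"
      \<comment> \<open>When \<open>g x x = 0\<close> the lower bound is affine in t, and this t
        makes it equal to -1.\<close>
      define t where "t = (Re (g u u) + 1) / (2 * (norm (g u x))\<^sup>2)"
      have "2 * t * (norm (g u x))\<^sup>2 = Re (g u u) + 1" using n by (simp add: t_def)
      with expand[of t] True show False by simp
    qed
    then show ?thesis using True by simp
  next
    case False
    then have r: "Re (g x x) > 0" using s(6)[of x] by linarith
    have "0 \<le> (Re (g u u) - 2 * (1 / Re (g x x)) * (norm (g u x))\<^sup>2 + (1 / Re (g x x))\<^sup>2 * (norm (g u x))\<^sup>2 * Re (g x x)) * Re (g x x)"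
      using expand[of "1 / Re (g x x)"] r by (intro mult_nonneg_nonneg) auto
    also have "\<dots> = Re (g u u) * Re (g x x) - (norm (g u x))\<^sup>2"
      using r by (simp add: field_simps power2_eq_square)
    finally show ?thesis by simp
  qed
qed

text \<open>Cholesky decomposition, where I holds the axes not yet known to lie in the radical.
  Subtracting the square of l(u) = g(u,x) / sqrt(g(x,x)) puts the axis x into the radical, keeps
  there the axes already in it, and preserves semidefiniteness by Cauchy-Schwarz.\<close>

lemma hermitian_form_decompose_aux:
  fixes g :: "complex^'n::finite \<Rightarrow> complex^'n \<Rightarrow> complex"
  assumes "finite I" "hermitian_form g" "\<And>i w. i \<notin> I \<Longrightarrow> g (axis i 1) w = 0"
  shows "\<exists>\<beta>. (\<forall>i\<in>I. Vector_Spaces.linear (*s) (*) (\<beta> i)) \<and> (\<forall>u w. g u w = (\<Sum>i\<in>I. \<beta> i u * cnj (\<beta> i w)))"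
  using assms
proof (induction I arbitrary: g)
  case empty
  have "g u w = 0" for u w
  proof -
    have "Vector_Spaces.linear (*s) (*) (\<lambda>u. g u w)" using empty(1) by (rule hermitian_form_linear)
    then interpret L: Vector_Spaces.linear "(*s)" "(*)" "\<lambda>u. g u w" .
    have "g (\<Sum>i\<in>UNIV. (u $ i) *s axis i 1) w = (\<Sum>i\<in>UNIV. (u $ i) * g (axis i 1) w)"
      by (simp only: L.sum L.scale)
    then show ?thesis using empty(2) by (simp add: basis_expansion)
  qed
  then show ?case by simp
next
  case (insert i I)
  note g = insert.prems(1)
  note s = hermitian_form_simps[OF g]
  define x where "x = (axis i 1 :: complex^'n)"
  define r where "r = Re (g x x)"
  \<comment> \<open>If r = 0, division by zero gives l = 0. This is the right value, since by
    Cauchy-Schwarz x is then already in the radical.\<close>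
  define l where "l u = g u x / complex_of_real (sqrt r)" for u
  define g' where "g' u w = g u w - l u * cnj (l w)" for u w
  have r0: "r \<ge> 0" using s(6) by (simp add: r_def)
  have gxx: "g x x = complex_of_real r" using s(5)[of x] by (simp add: r_def complex_eq_iff)
  have l: "Vector_Spaces.linear (*s) (*) l"
  proof -
    have "Vector_Spaces.linear (*s) (*) (\<lambda>u. g u x)" using g by (rule hermitian_form_linear)
    then show ?thesis
      unfolding linear_iff_module_hom l_def[abs_def] module_hom_iff by (auto simp: add_divide_distrib)
  qed
  have ll: "Re (l u * cnj (l u)) \<le> Re (g u u)" for u
  proof -
    have "Re (l u * cnj (l u)) = (norm (l u))\<^sup>2" unfolding complex_norm_square[symmetric] by simp
    also have "\<dots> = (norm (g u x))\<^sup>2 / r"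
      using r0 by (simp add: l_def norm_divide power_divide)
    also have "\<dots> \<le> Re (g u u)"
    proof (cases "r = 0")
      case False
      then show ?thesis
        using hermitian_form_cauchy_schwarz[OF g, of u x] r0 by (simp add: r_def divide_le_eq)
    qed (use s(6) in simp)
    finally show ?thesis .
  qed
  have "hermitian_form g'"
    unfolding hermitian_form_def
  proof (intro conjI allI)
    fix w
    have "Vector_Spaces.linear (*s) (*) (\<lambda>u. g u w)" using g by (rule hermitian_form_linear)
    then show "Vector_Spaces.linear (*s) (*) (\<lambda>u. g' u w)"
      using l unfolding linear_iff_module_hom g'_def module_hom_iff by (auto simp: algebra_simps)
  next
    fix u w show "g' w u = cnj (g' u w)"
      unfolding g'_def hermitian_form_sym[OF g, of w u] by simp
  next
    fix u show "0 \<le> Re (g' u u)" using ll[of u] by (simp add: g'_def)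
  qed
  moreover have "g' (axis j 1) w = 0" if j: "j \<notin> I" for j w
  proof (cases "j = i")
    case False
    then have "g (axis j 1) v = 0" for v using insert.prems(2) j by blast
    then show ?thesis by (simp add: g'_def l_def)
  next
    case True
    have gxw: "g x w = cnj (g w x)" by (rule hermitian_form_sym[OF g])
    show ?thesis
    proof (cases "r = 0")
      case True
      then have "g w x = 0"
        using hermitian_form_cauchy_schwarz[OF g, of w x] by (simp add: r_def)
      then show ?thesis using \<open>j = i\<close> True gxw by (simp add: g'_def l_def x_def)
    next
      case False
      have "complex_of_real (sqrt r) * complex_of_real (sqrt r) = complex_of_real r"
        using r0 by (simp flip: of_real_mult)
      then have "l x * cnj (l w) = g x w"
        using False r0 by (simp add: l_def gxx gxw divide_simps)
      then show ?thesis using \<open>j = i\<close> by (simp add: g'_def x_def)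
    qed
  qed
  ultimately obtain \<beta> where \<beta>: "\<forall>i\<in>I. Vector_Spaces.linear (*s) (*) (\<beta> i)"
    "\<forall>u w. g' u w = (\<Sum>i\<in>I. \<beta> i u * cnj (\<beta> i w))"
    using insert.IH by blast
  have "g u w = (\<Sum>j\<in>insert i I. (\<beta>(i := l)) j u * cnj ((\<beta>(i := l)) j w))" for u w
  proof -
    have "(\<Sum>j\<in>I. (\<beta>(i := l)) j u * cnj ((\<beta>(i := l)) j w)) = g' u w"
      using insert.hyps(2) \<beta>(2) by (auto intro!: sum.cong)
    then show ?thesis using insert.hyps by (simp add: g'_def)
  qed
  moreover have "\<forall>j\<in>insert i I. Vector_Spaces.linear (*s) (*) ((\<beta>(i := l)) j)"
    using l \<beta>(1) by auto
  ultimately show ?case by blast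
qed

lemma hermitian_form_decompose:
  fixes g :: "complex^'n::finite \<Rightarrow> complex^'n \<Rightarrow> complex"
  assumes "hermitian_form g"
  obtains \<beta> :: "'n \<Rightarrow> complex^'n \<Rightarrow> complex" where "\<And>i. Vector_Spaces.linear (*s) (*) (\<beta> i)"
    "\<And>u w. g u w = (\<Sum>i\<in>UNIV. \<beta> i u * cnj (\<beta> i w))"
  using hermitian_form_decompose_aux[of UNIV g] assms by auto

text \<open>The half of rank-nullity that bounds the kernel from above: a basis of the kernel
  together with preimages of the unit vectors is independent.\<close>

lemma dim_kernel_surj:
  fixes L :: "complex^'n::finite \<Rightarrow> complex^'m::finite"
  assumes L: "Vector_Spaces.linear (*s) (*s) L" and "surj L"
  shows "vec.dim {x. L x = 0} + CARD('m) \<le> CARD('n)"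
proof -
  interpret L: Vector_Spaces.linear "(*s)" "(*s)" L by (rule L)
  obtain B where B: "B \<subseteq> {x. L x = 0}" "vec.independent B" "card B = vec.dim {x. L x = 0}"
    using vec.basis_exists[of "{x. L x = 0}"] by metis
  have finB: "finite B" using B(2) by (rule vec.finiteI_independent)
  define y where "y i = inv L (axis i 1)" for i :: 'm
  have y: "L (y i) = axis i 1" for i using assms(2) by (simp add: y_def surj_f_inv_f)
  have inj: "inj y" by (metis injI y axis_eq_axis zero_neq_one)
  have disj: "B \<inter> range y = {}"
    using B(1) y by (force simp: axis_eq_0_iff)
  have "vec.independent (B \<union> range y)"
  proof
    assume "vec.dependent (B \<union> range y)"
    then obtain u where u: "\<exists>v\<in>B \<union> range y. u v \<noteq> 0" "(\<Sum>v\<in>B \<union> range y. u v *s v) = 0"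
      using vec.dependent_finite[of "B \<union> range y"] finB by auto
    have split: "(\<Sum>v\<in>B. u v *s v) + (\<Sum>i\<in>UNIV. u (y i) *s y i) = 0"
      using u(2) finB disj by (simp add: sum.union_disjoint sum.reindex[OF inj])
    have LB: "L (\<Sum>v\<in>B. u v *s v) = 0"
      using B(1) by (simp add: L.sum L.scale) (intro sum.neutral, auto)
    have "L ((\<Sum>v\<in>B. u v *s v) + (\<Sum>i\<in>UNIV. u (y i) *s y i)) = (\<Sum>i\<in>UNIV. u (y i) *s axis i 1)"
      unfolding L.add LB by (simp add: L.sum L.scale y)
    then have z: "(\<Sum>i\<in>UNIV. u (y i) *s axis i (1::complex)) = 0" unfolding split by (simp add: L.zero)
    have uy: "u (y j) = 0" for j
    proof -
      have "(\<Sum>i\<in>UNIV. u (y i) *s axis i (1::complex)) $ j = (\<Sum>i\<in>UNIV. if i = j then u (y i) else 0)"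
        unfolding sum_component by (intro sum.cong) (auto simp: axis_def)
      then show ?thesis using z by simp
    qed
    then have "(\<Sum>v\<in>B. u v *s v) = 0" using split by simp
    then have "\<forall>v\<in>B. u v = 0" using B(2) vec.dependent_finite[OF finB] by auto
    with uy u(1) show False by auto
  qed
  then have "card (B \<union> range y) \<le> vec.dim (UNIV :: (complex^'n) set)"
    by (intro vec.independent_card_le_dim) auto
  also have "card (B \<union> range y) = card B + CARD('m)"
    using finB disj by (simp add: card_Un_disjoint card_image[OF inj])
  finally show ?thesis using B(3) unfolding vec_dim_card by simp
qed

section \<open>Pullback of a two-form and its powers\<close>

definition pullback :: "(complex^'n::finite \<Rightarrow> complex^'m::finite) \<Rightarrow> 'm lform \<Rightarrow> 'n lform" where
  "pullback F \<omega> z v = \<omega> (F z) (\<lambda>i. frechet_derivative F (at z) (v i))"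

definition pair_seq :: "'v \<Rightarrow> 'v \<Rightarrow> nat \<Rightarrow> 'v" where
  "pair_seq x y = (\<lambda>i. if i = 0 then x else y)"

lemma pair_seq_simps [simp]: "pair_seq x y 0 = x" "pair_seq x y (Suc i) = y" "pair_seq x y 1 = y"
  by (simp_all add: pair_seq_def)

lemma covec2_pair: "multilinear 2 \<eta> \<Longrightarrow> \<eta> v = \<eta> (pair_seq (v 0) (v 1))"
  by (rule local_covecD[OF multilinear_local]) (auto simp: pair_seq_def less_2_cases_iff)

lemma covec2_linear:
  assumes "multilinear 2 \<eta>"
  shows "linear (\<lambda>x. \<eta> (pair_seq x y))" "linear (\<lambda>y. \<eta> (pair_seq x y))"
proof -
  have "linear (\<lambda>x. \<eta> ((pair_seq undefined y)(0 := x)))"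
    using assms unfolding multilinear_def by simp
  moreover have "(pair_seq undefined y)(0 := x) = pair_seq x y" for x by (auto simp: pair_seq_def)
  ultimately show "linear (\<lambda>x. \<eta> (pair_seq x y))" by simp
  have "linear (\<lambda>y. \<eta> ((pair_seq x undefined)(1 := y)))"
    using assms unfolding multilinear_def by simp
  moreover have "\<eta> ((pair_seq x undefined)(1 := y)) = \<eta> (pair_seq x y)" for y
    using covec2_pair[OF assms, of "(pair_seq x undefined)(1 := y)"] by simp
  ultimately show "linear (\<lambda>y. \<eta> (pair_seq x y))" by simp
qed

text \<open>Serves to differentiate a field of 2-covectors whose arguments also move: the scalars
  carry the arguments, and the fixed pairs of basis vectors carry the field.\<close>

lemma covec2_basis_expand:
  assumes "multilinear 2 \<eta>"
  shows "\<eta> (pair_seq x y) = (\<Sum>a\<in>Basis. \<Sum>b\<in>Basis. ((x \<bullet> a) * (y \<bullet> b)) *\<^sub>R \<eta> (pair_seq a b))"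
  by (subst linear_euclidean_expand[OF covec2_linear(1)[OF assms]],
      subst linear_euclidean_expand[OF covec2_linear(2)[OF assms]])
    (simp add: scaleR_sum_right)

lemma k_covector2_antisym:
  assumes "k_covector 2 \<eta>"
  shows "\<eta> (pair_seq x y) = - \<eta> (pair_seq y x)"
proof -
  have "pair_seq y x \<circ> Transposition.transpose 0 1 = (\<lambda>i. if i = 0 then x else if i = 1 then y else x)"
    by (auto simp: pair_seq_def Transposition.transpose_def)
  moreover have "\<eta> (\<lambda>i. if i = 0 then x else if i = 1 then y else x) = \<eta> (pair_seq x y)"
    using assms by (intro local_covecD[of 2 \<eta>]) (auto simp: k_covector_iff multilinear_local pair_seq_def less_2_cases_iff)
  ultimately show ?thesis
    using k_covector_permute[OF assms, of "Transposition.transpose 0 1" "pair_seq y x"]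
    by (simp add: sign_swap_id permutes_swap_id)
qed

lemma smooth_on_scaleR: 
  "open S \<Longrightarrow> smooth_on S f \<Longrightarrow> smooth_on S g \<Longrightarrow> smooth_on S (\<lambda>x. f x *\<^sub>R g x)"
  by (rule smooth_on_bilinear[OF bounded_bilinear_scaleR])

lemma smooth_on_inner_const: "open S \<Longrightarrow> smooth_on S f \<Longrightarrow> smooth_on S (\<lambda>x. f x \<bullet> c)"
  by (rule smooth_on_linear[OF bounded_linear_inner_left])

lemma smooth_on_wedge:
  assumes "open S" "\<And>v. smooth_on S (\<lambda>z. \<eta> z v)" "\<And>v. smooth_on S (\<lambda>z. \<theta> z v)"
  shows "smooth_on S (\<lambda>z. wedge k l (\<eta> z) (\<theta> z) v)"
  unfolding wedge_def
  by (intro smooth_on_linear[OF bounded_linear_divide] smooth_on_sum smooth_on_mult smooth_on_const assms)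

lemma smooth_on_wedge_power:
  assumes "open S" "\<And>v. smooth_on S (\<lambda>z. \<psi> z v)"
  shows "smooth_on S (\<lambda>z. wedge_power (\<psi> z) q v)"
proof (induction q arbitrary: v)
  case 0
  then show ?case by (simp add: smooth_on_const)
next
  case (Suc q)
  then show ?case using assms by (simp add: smooth_on_wedge)
qed

lemma smooth_on_bideg:
  assumes "open S" "\<And>v. smooth_on S (\<lambda>z. \<eta> z v)"
  shows "smooth_on S (\<lambda>z. bideg p q (\<eta> z) v)"
  unfolding bideg_def complexify_def
  by (intro smooth_on_sum smooth_on_mult smooth_on_const assms)

lemma smooth_on_ext_deriv:
  assumes "open S" "\<And>v. smooth_on S (\<lambda>z. \<eta> z v)"
  shows "smooth_on S (\<lambda>z. ext_deriv k \<eta> z v)"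
  unfolding ext_deriv_def
  by (intro smooth_on_sum smooth_on_mult smooth_on_const smooth_on_frechet_derivative assms)

lemma smooth_on_local_delbar:
  assumes "open S" "\<And>v. smooth_on S (\<lambda>z. \<eta> z v)"
  shows "smooth_on S (\<lambda>z. local_delbar k \<eta> z v)"
  unfolding local_delbar_def
  by (intro smooth_on_sum smooth_on_bideg smooth_on_ext_deriv assms)

lemma covec2_compose_linear:
  fixes L :: "complex^'n::finite \<Rightarrow> complex^'m::finite"
  assumes "multilinear 2 \<eta>" "linear L"
  shows "multilinear 2 (\<lambda>v. \<eta> (\<lambda>i. L (v i)))"
  unfolding multilinear_def
proof (intro conjI allI impI)
  show "local_covec 2 (\<lambda>v. \<eta> (\<lambda>i. L (v i)))"
    using multilinear_local[OF assms(1)] unfolding local_covec_def by simp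
  fix v :: "nat \<Rightarrow> complex^'n" and i :: nat assume i: "i < 2"
  have "(\<lambda>j. L ((v(i := x)) j)) = (\<lambda>j. L (v j))(i := L x)" for x by auto
  moreover have "linear (\<lambda>y. \<eta> ((\<lambda>j. L (v j))(i := y)))"
    using assms(1) i by (simp add: multilinear_def)
  from linear_compose[OF assms(2) this] have "linear (\<lambda>x. \<eta> ((\<lambda>j. L (v j))(i := L x)))"
    by (simp add: o_def)
  ultimately show "linear (\<lambda>x. \<eta> (\<lambda>j. L ((v(i := x)) j)))" by simp
qed

lemma ext_deriv2_pair:
  assumes "open U" "w \<in> U" "\<And>y. y \<in> U \<Longrightarrow> multilinear 2 (\<eta> y)"
  shows "ext_deriv 2 \<eta> w v =
      frechet_derivative (\<lambda>y. \<eta> y (pair_seq (v 1) (v 2))) (at w) (v 0)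
    - frechet_derivative (\<lambda>y. \<eta> y (pair_seq (v 0) (v 2))) (at w) (v 1)
    + frechet_derivative (\<lambda>y. \<eta> y (pair_seq (v 0) (v 1))) (at w) (v 2)"
proof -
  have "frechet_derivative (\<lambda>y. \<eta> y u) (at w) = frechet_derivative (\<lambda>y. \<eta> y (pair_seq (u 0) (u 1))) (at w)" for u
    by (intro frechet_derivative_cong_open[OF assms(1,2)] covec2_pair assms(3))
  note P = this
  show ?thesis
    unfolding ext_deriv_def
    by (simp add: numeral_2_eq_2 P[of "\<lambda>j. v (Suc j)"] P[of "\<lambda>j. if j = 0 then v j else v (Suc j)"]
        P[of "\<lambda>j. if j < Suc (Suc 0) then v j else v (Suc j)"])
qed

context
  fixes F :: "complex^'n::finite \<Rightarrow> complex^'m::finite" and S T and \<omega> :: "'m lform"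
  assumes S: "open S" and T: "open T" and FS: "\<And>z. z \<in> S \<Longrightarrow> F z \<in> T" and F: "smooth_on S F"
    and \<omega>: "\<And>w. w \<in> T \<Longrightarrow> k_covector 2 (\<omega> w)" "\<And>v. smooth_on T (\<lambda>w. \<omega> w v)"
begin

lemma linear_deriv_F: "z \<in> S \<Longrightarrow> linear (frechet_derivative F (at z))"
  by (intro linear_frechet_derivative smooth_on_differentiable[OF F])

lemma k_covector_pullback:
  assumes "z \<in> S"
  shows "k_covector 2 (pullback F \<omega> z)"
  unfolding k_covector_iff
proof
  have k: "k_covector 2 (\<omega> (F z))" using \<omega>(1) FS assms by blast
  then have "multilinear 2 (\<omega> (F z))" by (simp add: k_covector_iff)
  from covec2_compose_linear[OF this linear_deriv_F[OF assms]]
  show "multilinear 2 (pullback F \<omega> z)" by (simp add: pullback_def[abs_def])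
  show "alternating 2 (pullback F \<omega> z)"
    using k unfolding pullback_def k_covector_iff alternating_def by simp
qed

lemma pullback_pair: "pullback F \<omega> z (pair_seq a b) =
    \<omega> (F z) (pair_seq (frechet_derivative F (at z) a) (frechet_derivative F (at z) b))"
proof -
  have "(\<lambda>i. frechet_derivative F (at z) (pair_seq a b i)) =
     pair_seq (frechet_derivative F (at z) a) (frechet_derivative F (at z) b)"
    by (auto simp: pair_seq_def)
  then show ?thesis by (simp add: pullback_def)
qed

lemma multilinear_\<omega>: "w \<in> T \<Longrightarrow> multilinear 2 (\<omega> w)"
  using \<omega>(1) by (simp add: k_covector_iff)

lemma pullback_expand:
  assumes "z \<in> S"
  shows "pullback F \<omega> z (pair_seq x y) = (\<Sum>a\<in>Basis. \<Sum>b\<in>Basis.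
    ((frechet_derivative F (at z) x \<bullet> a) * (frechet_derivative F (at z) y \<bullet> b)) *\<^sub>R \<omega> (F z) (pair_seq a b))"
  unfolding pullback_pair by (rule covec2_basis_expand[OF multilinear_\<omega>[OF FS[OF assms]]])

lemma smooth_on_pullback: "smooth_on S (\<lambda>z. pullback F \<omega> z v)"
proof -
  have "pullback F \<omega> z v = (\<Sum>a\<in>Basis. \<Sum>b\<in>Basis.
    ((frechet_derivative F (at z) (v 0) \<bullet> a) * (frechet_derivative F (at z) (v 1) \<bullet> b)) *\<^sub>R \<omega> (F z) (pair_seq a b))"
    if "z \<in> S" for z
    using k_covector_pullback[OF that] pullback_expand[OF that, of "v 0" "v 1"]
    by (subst covec2_pair) (auto simp: k_covector_iff)
  note eq = this
  have \<omega>F: "smooth_on S (\<lambda>z. \<omega> (F z) u)" for u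
    by (rule smooth_on_compose[OF S T FS F \<omega>(2)])
  have "smooth_on S (\<lambda>z. \<Sum>a\<in>Basis. \<Sum>b\<in>Basis.
    ((frechet_derivative F (at z) (v 0) \<bullet> a) * (frechet_derivative F (at z) (v 1) \<bullet> b)) *\<^sub>R \<omega> (F z) (pair_seq a b))"
    by (intro smooth_on_sum smooth_on_scaleR smooth_on_mult smooth_on_inner_const
        smooth_on_frechet_derivative S F \<omega>F)
  then show ?thesis by (subst smooth_on_cong[OF S eq])
qed

text \<open>Product rule in three parts: the base point F z moves, and each of the two arguments
  moves by a second derivative of F.\<close>

lemma frechet_derivative_pullback:
  assumes z: "z \<in> S"
  shows "frechet_derivative (\<lambda>y. pullback F \<omega> y (pair_seq p q)) (at z) h =
    frechet_derivative (\<lambda>w. \<omega> w (pair_seq (frechet_derivative F (at z) p) (frechet_derivative F (at z) q))) (at (F z))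
        (frechet_derivative F (at z) h)
    + \<omega> (F z) (pair_seq (frechet_derivative (\<lambda>y. frechet_derivative F (at y) p) (at z) h) (frechet_derivative F (at z) q))
    + \<omega> (F z) (pair_seq (frechet_derivative F (at z) p) (frechet_derivative (\<lambda>y. frechet_derivative F (at y) q) (at z) h))"
proof -
  define D where "D y = frechet_derivative F (at y)" for y
  define E where "E p h = frechet_derivative (\<lambda>y. D y p) (at z) h" for p h
  define G where "G a b k = frechet_derivative (\<lambda>w. \<omega> w (pair_seq a b)) (at (F z)) k" for a b k
  have Fz: "F z \<in> T" using FS z .
  have dF: "(F has_derivative D z) (at z)"
    unfolding D_def using smooth_on_differentiable[OF F z] by (simp add: frechet_derivative_works[symmetric])
  have dE: "((\<lambda>y. D y p) has_derivative E p) (at z)" for p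
    unfolding E_def D_def
    using smooth_on_differentiable[OF smooth_on_frechet_derivative[OF F] z] by (simp add: frechet_derivative_works[symmetric])
  have dG: "((\<lambda>w. \<omega> w (pair_seq a b)) has_derivative G a b) (at (F z))" for a b
    unfolding G_def
    using smooth_on_differentiable[OF \<omega>(2) Fz] by (simp add: frechet_derivative_works[symmetric])
  have dGF: "((\<lambda>y. \<omega> (F y) (pair_seq a b)) has_derivative (\<lambda>h. G a b (D z h))) (at z)" for a b
    by (rule has_derivative_compose[OF dF dG])
  have D: "((\<lambda>y. \<Sum>a\<in>Basis. \<Sum>b\<in>Basis. ((D y p \<bullet> a) * (D y q \<bullet> b)) *\<^sub>R \<omega> (F y) (pair_seq a b)) has_derivative
     (\<lambda>h. \<Sum>a\<in>Basis. \<Sum>b\<in>Basis. ((D z p \<bullet> a) * (D z q \<bullet> b)) *\<^sub>R G a b (D z h)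
        + ((D z p \<bullet> a) * (E q h \<bullet> b) + (E p h \<bullet> a) * (D z q \<bullet> b)) *\<^sub>R \<omega> (F z) (pair_seq a b))) (at z)"
    by (intro has_derivative_sum has_derivative_scaleR has_derivative_mult has_derivative_inner_left dE dGF)
  have "frechet_derivative (\<lambda>y. pullback F \<omega> y (pair_seq p q)) (at z)
     = frechet_derivative (\<lambda>y. \<Sum>a\<in>Basis. \<Sum>b\<in>Basis. ((D y p \<bullet> a) * (D y q \<bullet> b)) *\<^sub>R \<omega> (F y) (pair_seq a b)) (at z)"
    unfolding D_def by (intro frechet_derivative_cong_open[OF S z] pullback_expand)
  note eq = this
  have "frechet_derivative (\<lambda>y. pullback F \<omega> y (pair_seq p q)) (at z) h =
     (\<Sum>a\<in>Basis. \<Sum>b\<in>Basis. ((D z p \<bullet> a) * (D z q \<bullet> b)) *\<^sub>R G a b (D z h)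
        + ((D z p \<bullet> a) * (E q h \<bullet> b) + (E p h \<bullet> a) * (D z q \<bullet> b)) *\<^sub>R \<omega> (F z) (pair_seq a b))"
    unfolding eq by (rule fun_cong[OF frechet_derivative_at[OF D, symmetric]])
  also have "\<dots> = (\<Sum>a\<in>Basis. \<Sum>b\<in>Basis. ((D z p \<bullet> a) * (D z q \<bullet> b)) *\<^sub>R G a b (D z h))
      + (\<Sum>a\<in>Basis. \<Sum>b\<in>Basis. ((E p h \<bullet> a) * (D z q \<bullet> b)) *\<^sub>R \<omega> (F z) (pair_seq a b))
      + (\<Sum>a\<in>Basis. \<Sum>b\<in>Basis. ((D z p \<bullet> a) * (E q h \<bullet> b)) *\<^sub>R \<omega> (F z) (pair_seq a b))"
    by (simp only: sum.distrib scaleR_left_distrib add_ac)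
  also have "(\<Sum>a\<in>Basis. \<Sum>b\<in>Basis. ((E p h \<bullet> a) * (D z q \<bullet> b)) *\<^sub>R \<omega> (F z) (pair_seq a b)) = \<omega> (F z) (pair_seq (E p h) (D z q))"
    by (rule covec2_basis_expand[OF multilinear_\<omega>[OF Fz], symmetric])
  also have "(\<Sum>a\<in>Basis. \<Sum>b\<in>Basis. ((D z p \<bullet> a) * (E q h \<bullet> b)) *\<^sub>R \<omega> (F z) (pair_seq a b)) = \<omega> (F z) (pair_seq (D z p) (E q h))"
    by (rule covec2_basis_expand[OF multilinear_\<omega>[OF Fz], symmetric])
  also have "(\<Sum>a\<in>Basis. \<Sum>b\<in>Basis. ((D z p \<bullet> a) * (D z q \<bullet> b)) *\<^sub>R G a b (D z h)) = G (D z p) (D z q) (D z h)"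
  proof -
    have D': "((\<lambda>w. \<Sum>a\<in>Basis. \<Sum>b\<in>Basis. ((D z p \<bullet> a) * (D z q \<bullet> b)) *\<^sub>R \<omega> w (pair_seq a b)) has_derivative
      (\<lambda>k. \<Sum>a\<in>Basis. \<Sum>b\<in>Basis. ((D z p \<bullet> a) * (D z q \<bullet> b)) *\<^sub>R G a b k)) (at (F z))"
      by (intro has_derivative_sum has_derivative_scaleR_right dG)
    have eq': "frechet_derivative (\<lambda>w. \<omega> w (pair_seq (D z p) (D z q))) (at (F z))
      = frechet_derivative (\<lambda>w. \<Sum>a\<in>Basis. \<Sum>b\<in>Basis. ((D z p \<bullet> a) * (D z q \<bullet> b)) *\<^sub>R \<omega> w (pair_seq a b)) (at (F z))"
      by (intro frechet_derivative_cong_open[OF T Fz] covec2_basis_expand multilinear_\<omega>)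
    have "G (D z p) (D z q) = (\<lambda>k. \<Sum>a\<in>Basis. \<Sum>b\<in>Basis. ((D z p \<bullet> a) * (D z q \<bullet> b)) *\<^sub>R G a b k)"
      unfolding G_def[of "D z p" "D z q", abs_def] eq' by (rule frechet_derivative_at[OF D', symmetric])
    then show ?thesis by simp
  qed
  finally show ?thesis by (simp only: D_def E_def G_def)
qed

text \<open>In the alternating sum the terms with second derivatives of F cancel in pairs, since the
  second derivative is symmetric and \<omega> is antisymmetric.\<close>

lemma ext_deriv_pullback:
  assumes z: "z \<in> S"
  shows "ext_deriv 2 (pullback F \<omega>) z v = ext_deriv 2 \<omega> (F z) (\<lambda>i. frechet_derivative F (at z) (v i))"
proof -
  have k: "k_covector 2 (\<omega> (F z))" using \<omega>(1) FS z by blast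
  note sym = second_derivative_symmetric[OF S F z]
  have ml: "multilinear 2 (pullback F \<omega> y)" if "y \<in> S" for y
    using k_covector_pullback[OF that] by (simp add: k_covector_iff)
  define Dv where "Dv i = frechet_derivative F (at z) (v i)" for i
  have 1: "ext_deriv 2 (pullback F \<omega>) z v =
      frechet_derivative (\<lambda>y. pullback F \<omega> y (pair_seq (v 1) (v 2))) (at z) (v 0)
    - frechet_derivative (\<lambda>y. pullback F \<omega> y (pair_seq (v 0) (v 2))) (at z) (v 1)
    + frechet_derivative (\<lambda>y. pullback F \<omega> y (pair_seq (v 0) (v 1))) (at z) (v 2)"
    by (rule ext_deriv2_pair[OF S z ml])
  have 2: "ext_deriv 2 \<omega> (F z) Dv =
      frechet_derivative (\<lambda>y. \<omega> y (pair_seq (Dv 1) (Dv 2))) (at (F z)) (Dv 0)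
    - frechet_derivative (\<lambda>y. \<omega> y (pair_seq (Dv 0) (Dv 2))) (at (F z)) (Dv 1)
    + frechet_derivative (\<lambda>y. \<omega> y (pair_seq (Dv 0) (Dv 1))) (at (F z)) (Dv 2)"
    by (rule ext_deriv2_pair[OF T FS[OF z] multilinear_\<omega>])
  have "ext_deriv 2 (pullback F \<omega>) z v = ext_deriv 2 \<omega> (F z) Dv"
    unfolding 1 2 frechet_derivative_pullback[OF z] Dv_def[symmetric]
    using sym[of "v 0" "v 1"] sym[of "v 0" "v 2"] sym[of "v 1" "v 2"]
      k_covector2_antisym[OF k, of "Dv 0"] k_covector2_antisym[OF k, of "Dv 1"] k_covector2_antisym[OF k, of "Dv 2"]
    by simp
  then show ?thesis by (simp add: Dv_def[abs_def])
qed

text \<open>The closed form on the base is a power of \<omega> while \<omega> itself need not be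
  closed, so naturality is wanted in degree 2q. Applying the Leibniz rule on both sides reduces it
  to degree 2.\<close>

lemma ext_deriv_wedge_power_pullback:
  assumes z: "z \<in> S"
  shows "ext_deriv (2 * q) (\<lambda>y. wedge_power (pullback F \<omega> y) q) z v =
    ext_deriv (2 * q) (\<lambda>w. wedge_power (\<omega> w) q) (F z) (\<lambda>i. frechet_derivative F (at z) (v i))"
proof (induction q arbitrary: v)
  case 0
  then show ?case by (simp add: ext_deriv_def frechet_derivative_const)
next
  case (Suc q)
  have k: "k_covector 2 (\<omega> (F z))" using \<omega>(1) FS z by blast
  note diff1 = smooth_on_differentiable[OF smooth_on_pullback z]
    smooth_on_differentiable[OF smooth_on_wedge_power[OF S smooth_on_pullback] z]
    multilinear_local[OF k_covector_iff[THEN iffD1, THEN conjunct1, OF k_covector_pullback[OF z]]]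
  note diff2 = smooth_on_differentiable[OF \<omega>(2) FS[OF z]]
    smooth_on_differentiable[OF smooth_on_wedge_power[OF T \<omega>(2)] FS[OF z]]
    multilinear_local[OF multilinear_\<omega>[OF FS[OF z]]]
  have e: "2 * Suc q = 2 + 2 * q" by simp
  have pb: "pullback F \<omega> z = (\<lambda>v. \<omega> (F z) (\<lambda>i. frechet_derivative F (at z) (v i)))"
    by (simp add: pullback_def fun_eq_iff)
  have pw: "wedge_power (pullback F \<omega> z) q = (\<lambda>v. wedge_power (\<omega> (F z)) q (\<lambda>i. frechet_derivative F (at z) (v i)))"
    unfolding pb wedge_power_pullback by simp
  have d1: "ext_deriv 2 (pullback F \<omega>) z = (\<lambda>v. ext_deriv 2 \<omega> (F z) (\<lambda>i. frechet_derivative F (at z) (v i)))"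
    using ext_deriv_pullback[OF z] by (simp add: fun_eq_iff)
  have d2: "ext_deriv (2 * q) (\<lambda>y. wedge_power (pullback F \<omega> y) q) z =
     (\<lambda>v. ext_deriv (2 * q) (\<lambda>w. wedge_power (\<omega> w) q) (F z) (\<lambda>i. frechet_derivative F (at z) (v i)))"
    using Suc.IH by (simp add: fun_eq_iff)
  show ?case
    unfolding e wedge_power.simps ext_deriv_wedge[OF diff1] ext_deriv_wedge[OF diff2] wedge_pullback
    unfolding d1 d2 pw
    unfolding pb by (rule refl)
qed

end

section \<open>The product form on the total space\<close>

lemma frechet_derivative_compose_open:
  assumes "open W" "z \<in> W" "\<And>y. y \<in> W \<Longrightarrow> F y = G (H y)"
    and "H differentiable (at z)" "G differentiable (at (H z))"
  shows "frechet_derivative F (at z) v = frechet_derivative G (at (H z)) (frechet_derivative H (at z) v)"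
proof -
  have H: "(H has_derivative frechet_derivative H (at z)) (at z)"
    and G: "(G has_derivative frechet_derivative G (at (H z))) (at (H z))"
    using assms(4,5) by (simp_all add: frechet_derivative_works[symmetric])
  have "frechet_derivative F (at z) = frechet_derivative (\<lambda>y. G (H y)) (at z)"
    by (rule frechet_derivative_cong_open[OF assms(1-3)])
  also have "\<dots> = (\<lambda>v. frechet_derivative G (at (H z)) (frechet_derivative H (at z) v))"
    by (rule frechet_derivative_at[OF has_derivative_compose[OF H G], symmetric])
  finally show ?thesis by simp
qed

definition chart_inv :: "('a, 'n) chart \<Rightarrow> complex^'n \<Rightarrow> 'a" where
  "chart_inv c = inv_into (cdom c) (snd c)"

lemma in_charts_eq: "in_charts c c' f z = snd c' (f (chart_inv c z))"
  by (simp add: in_charts_def chart_inv_def)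

context compact_complex_manifold
begin

lemma topspace_chart: "c \<in> A \<Longrightarrow> topspace (subtopology T (cdom c)) = cdom c"
  using chart_openin openin_subset by (metis topspace_subtopology_subset)

lemma chart_inj: "c \<in> A \<Longrightarrow> inj_on (snd c) (cdom c)"
  using homeomorphic_imp_injective_map[OF chart_homeo] topspace_chart by metis

lemma chart_inv_left: "c \<in> A \<Longrightarrow> x \<in> cdom c \<Longrightarrow> chart_inv c (snd c x) = x"
  using chart_inj by (simp add: chart_inv_def)

lemma chart_inv_right:
  assumes "z \<in> cran c"
  shows "chart_inv c z \<in> cdom c" "snd c (chart_inv c z) = z"
  using assms by (auto simp: chart_inv_def inv_into_into f_inv_into_f)

lemma in_chart_image_iff:
  assumes "c \<in> A" "U \<subseteq> cdom c"
  shows "z \<in> snd c ` U \<longleftrightarrow> z \<in> cran c \<and> chart_inv c z \<in> U"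
proof
  assume "z \<in> snd c ` U"
  then obtain x where x: "x \<in> U" "z = snd c x" by blast
  then show "z \<in> cran c \<and> chart_inv c z \<in> U"
    using assms chart_inv_left[of c x] by auto
next
  assume z: "z \<in> cran c \<and> chart_inv c z \<in> U"
  have "snd c (chart_inv c z) = z" using z by (intro chart_inv_right) blast
  then show "z \<in> snd c ` U" using z by (metis imageI)
qed

lemma open_chart_image:
  assumes "c \<in> A" "openin T U" "U \<subseteq> cdom c"
  shows "open (snd c ` U)"
proof -
  have "openin (subtopology T (cdom c)) U"
    using assms by (auto simp: openin_subtopology Int_absorb2)
  then have "openin (top_of_set (cran c)) (snd c ` U)"
    using homeomorphic_imp_open_map[OF chart_homeo[OF assms(1)]] unfolding open_map_def by blast
  then show ?thesis using chart_open[OF assms(1)] by (simp add: openin_open_eq)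
qed

definition overlap :: "('a, 'n) chart \<Rightarrow> ('a, 'n) chart \<Rightarrow> (complex^'n) set" where
  "overlap c c' = snd c ` (cdom c \<inter> cdom c')"

lemma open_overlap: "c \<in> A \<Longrightarrow> c' \<in> A \<Longrightarrow> open (overlap c c')"
  unfolding overlap_def by (intro open_chart_image openin_Int chart_openin) auto

lemma overlap_iff: "c \<in> A \<Longrightarrow> z \<in> overlap c c' \<longleftrightarrow> z \<in> cran c \<and> chart_inv c z \<in> cdom c'"
  unfolding overlap_def using in_chart_image_iff[of c "cdom c \<inter> cdom c'" z] chart_inv_right(1)[of z c] by blast

lemma smooth_transition: "c \<in> A \<Longrightarrow> c' \<in> A \<Longrightarrow> smooth_on (overlap c c') (in_charts c c' id)"
  using transition unfolding overlap_def holo_map_on_def by blast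

lemma transition_point:
  assumes "c \<in> A" "c' \<in> A" "z \<in> overlap c c'"
  shows "in_charts c c' id z \<in> cran c'" "chart_inv c' (in_charts c c' id z) = chart_inv c z"
  using assms overlap_iff[OF assms(1)] chart_inv_left[OF assms(2)] by (auto simp: in_charts_eq)

end

text \<open>Chart expressions are compared on the chart ranges only, so the compatibility condition
  transfers because the transition map lands in the range of the second chart.\<close>

lemma smooth_form_cong:
  assumes mf: "compact_complex_manifold T A" and eq: "form_eq A \<omega> \<omega>'" and sm: "smooth_form A k \<omega>"
  shows "smooth_form A k \<omega>'"
proof -
  interpret compact_complex_manifold T A by (rule mf)
  have e: "\<omega> c z = \<omega>' c z" if "c \<in> A" "z \<in> cran c" for c z
    using eq that unfolding form_eq_def by blast
  have "smooth_on (cran c) (\<lambda>z. \<omega>' c z v)" if "c \<in> A" for c v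
  proof (subst smooth_on_cong[OF chart_open[OF that], where g = "\<lambda>z. \<omega> c z v"])
    show "smooth_on (cran c) (\<lambda>z. \<omega> c z v)" using sm that unfolding smooth_form_def by blast
  qed (use e that in simp)
  moreover have "\<omega>' c z v = \<omega>' c' (in_charts c c' id z) (\<lambda>i. frechet_derivative (in_charts c c' id) (at z) (v i))"
    if "c \<in> A" "c' \<in> A" "z \<in> snd c ` (cdom c \<inter> cdom c')" for c c' z v
  proof -
    have "\<omega> c z v = \<omega> c' (in_charts c c' id z) (\<lambda>i. frechet_derivative (in_charts c c' id) (at z) (v i))"
      using sm that unfolding smooth_form_def by blast
    moreover have "in_charts c c' id z \<in> cran c'"
      using transition_point(1)[OF that(1,2)] that(3) by (simp add: overlap_def)
    moreover have "z \<in> cran c" using that(3) by auto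
    ultimately show ?thesis using e that(1,2) by simp
  qed
  moreover have "k_covector k (\<omega>' c z)" if "c \<in> A" "z \<in> cran c" for c z
    using sm e[OF that] that unfolding smooth_form_def by metis
  ultimately show ?thesis unfolding smooth_form_def by blast
qed

lemma transverse_form_cong:
  assumes mf: "compact_complex_manifold T A" and eq: "form_eq A \<omega> \<omega>'" and tr: "transverse_form A p \<omega>"
  shows "transverse_form A p \<omega>'"
proof -
  have e: "\<omega> c z = \<omega>' c z" if "c \<in> A" "z \<in> cran c" for c z
    using eq that unfolding form_eq_def by blast
  have "smooth_form A (2 * p) \<omega>'"
    using smooth_form_cong[OF mf eq] tr unfolding transverse_form_def by blast
  then show ?thesis
    using tr e unfolding transverse_form_def real_form_def form_eq_def form_component_def by simp
qed

section \<open>The pulled-back fundamental form and its closed power\<close>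

locale hermitian_submersion =
  N: compact_complex_manifold N AN + M: compact_complex_manifold M AM
  for N :: "'a topology" and AN :: "('a, 'n::finite) chart set"
    and M :: "'b topology" and AM :: "('b, 'm::finite) chart set" +
  fixes f :: "'a \<Rightarrow> 'b" and h :: "('b, 'm) chart \<Rightarrow> complex^'m \<Rightarrow> complex^'m \<Rightarrow> complex^'m \<Rightarrow> complex"
    and q :: nat
  assumes submersion: "holomorphic_submersion N AN M AM f"
    and metric: "hermitian_metric AM h"
    and closed_power: "form_eq AM (form_d (2 * q) (\<lambda>c z. wedge_power (fundamental_form h c z) q)) zero_form"
begin

definition fdom :: "('a, 'n) chart \<Rightarrow> ('b, 'm) chart \<Rightarrow> (complex^'n) set" where
  "fdom c c' = snd c ` {x \<in> cdom c. f x \<in> cdom c'}"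

lemma fdom_iff: "c \<in> AN \<Longrightarrow> z \<in> fdom c c' \<longleftrightarrow> z \<in> cran c \<and> f (chart_inv c z) \<in> cdom c'"
  unfolding fdom_def using N.in_chart_image_iff[of c "{x \<in> cdom c. f x \<in> cdom c'}" z] N.chart_inv_right(1)[of z c] by blast

lemma open_fdom:
  assumes "c \<in> AN" "c' \<in> AM"
  shows "open (fdom c c')"
proof -
  have "openin N {x \<in> topspace N. f x \<in> cdom c'}"
    using submersion M.chart_openin[OF assms(2)] unfolding holomorphic_submersion_def
    by (auto intro: openin_continuous_map_preimage)
  then have "openin N (cdom c \<inter> {x \<in> topspace N. f x \<in> cdom c'})"
    using N.chart_openin[OF assms(1)] by (rule openin_Int[rotated])
  moreover have "cdom c \<inter> {x \<in> topspace N. f x \<in> cdom c'} = {x \<in> cdom c. f x \<in> cdom c'}"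
    using openin_subset[OF N.chart_openin[OF assms(1)]] by auto
  ultimately show ?thesis unfolding fdom_def using assms by (intro N.open_chart_image) auto
qed

lemma f_charts:
  assumes "c \<in> AN" "c' \<in> AM"
  shows "smooth_on (fdom c c') (in_charts c c' f)"
    and "z \<in> fdom c c' \<Longrightarrow> Vector_Spaces.linear (*s) (*s) (frechet_derivative (in_charts c c' f) (at z))"
    and "z \<in> fdom c c' \<Longrightarrow> surj (frechet_derivative (in_charts c c' f) (at z))"
proof -
  have "holo_map_on (fdom c c') (in_charts c c' f) \<and>
      (\<forall>z\<in>fdom c c'. surj (frechet_derivative (in_charts c c' f) (at z)))"
    using submersion assms unfolding holomorphic_submersion_def Let_def fdom_def by simp
  then show "smooth_on (fdom c c') (in_charts c c' f)"
    "z \<in> fdom c c' \<Longrightarrow> Vector_Spaces.linear (*s) (*s) (frechet_derivative (in_charts c c' f) (at z))"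
    "z \<in> fdom c c' \<Longrightarrow> surj (frechet_derivative (in_charts c c' f) (at z))"
    unfolding holo_map_on_def by simp_all
qed

lemma f_charts_in_cran: "c \<in> AN \<Longrightarrow> z \<in> fdom c c' \<Longrightarrow> in_charts c c' f z \<in> cran c'"
  by (auto simp: fdom_iff in_charts_eq)

lemma metric_at:
  assumes "c' \<in> AM" "w \<in> cran c'"
  shows "hermitian_form (h c' w)" "u \<noteq> 0 \<Longrightarrow> Re (h c' w u u) > 0"
proof -
  have *: "(\<forall>v. Vector_Spaces.linear (*s) (*) (\<lambda>u. h c' w u v)) \<and>
        (\<forall>u v. h c' w v u = cnj (h c' w u v)) \<and> (\<forall>u. u \<noteq> 0 \<longrightarrow> Re (h c' w u u) > 0)"
    using metric assms unfolding hermitian_metric_def by blast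
  then have lin: "Vector_Spaces.linear (*s) (*) (\<lambda>u. h c' w u v)" and sym: "h c' w v u = cnj (h c' w u v)"
    and pos: "u \<noteq> 0 \<Longrightarrow> Re (h c' w u u) > 0" for u v by blast+
  interpret L: Vector_Spaces.linear "(*s)" "(*)" "\<lambda>u. h c' w u 0" by (rule lin)
  have "h c' w 0 0 = 0" by (rule L.zero)
  then have "0 \<le> Re (h c' w u u)" for u
    using pos[of u] by (cases "u = 0") simp_all
  then show "hermitian_form (h c' w)"
    unfolding hermitian_form_def by (intro conjI allI lin sym)
  show "u \<noteq> 0 \<Longrightarrow> Re (h c' w u u) > 0" by (rule pos)
qed

abbreviation \<omega>\<^sub>M :: "('b, 'm) form" where "\<omega>\<^sub>M \<equiv> fundamental_form h"

text \<open>The \<open>\<gamma> i\<close> come from writing the metric as a sum of squares;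
  definiteness of the metric is what makes their common kernel trivial.\<close>

lemma fundamental_form_rank_one:
  assumes "c' \<in> AM" "w \<in> cran c'"
  obtains \<gamma> :: "'m \<Rightarrow> complex^'m \<Rightarrow> complex" where "\<And>i. Vector_Spaces.linear (*s) (*) (\<gamma> i)"
    "\<omega>\<^sub>M c' w = (\<lambda>v. \<Sum>i\<in>UNIV. rank_one (\<gamma> i) v)" "\<And>u. (\<forall>i. \<gamma> i u = 0) \<Longrightarrow> u = 0"
proof -
  obtain \<gamma> :: "'m \<Rightarrow> complex^'m \<Rightarrow> complex" where \<gamma>: "\<And>i. Vector_Spaces.linear (*s) (*) (\<gamma> i)"
    "\<And>u v. h c' w u v = (\<Sum>i\<in>UNIV. \<gamma> i u * cnj (\<gamma> i v))"
    using hermitian_form_decompose[OF metric_at(1)[OF assms]] by blast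
  have "u = 0" if "\<forall>i. \<gamma> i u = 0" for u
    using metric_at(2)[OF assms, of u] \<gamma>(2)[of u u] that by auto
  moreover have "\<omega>\<^sub>M c' w = (\<lambda>v. \<Sum>i\<in>UNIV. rank_one (\<gamma> i) v)"
    by (simp only: fundamental_form_def \<gamma>(2) rank_one_def Im_sum sum_negf of_real_sum of_real_minus)
  ultimately show ?thesis using that \<gamma>(1) by blast
qed

lemma k_covector_\<omega>\<^sub>M: "c' \<in> AM \<Longrightarrow> w \<in> cran c' \<Longrightarrow> k_covector 2 (\<omega>\<^sub>M c' w)"
proof -
  assume "c' \<in> AM" "w \<in> cran c'"
  then obtain \<gamma> :: "'m \<Rightarrow> complex^'m \<Rightarrow> complex" where \<gamma>: "\<And>i. Vector_Spaces.linear (*s) (*) (\<gamma> i)"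
    "\<omega>\<^sub>M c' w = (\<lambda>v. \<Sum>i\<in>UNIV. rank_one (\<gamma> i) v)"
    using fundamental_form_rank_one by blast
  show ?thesis unfolding \<gamma>(2) by (intro k_covector_sum k_covector_rank_one \<gamma>(1))
qed

lemma smooth_on_\<omega>\<^sub>M: "c' \<in> AM \<Longrightarrow> smooth_on (cran c') (\<lambda>w. \<omega>\<^sub>M c' w v)"
proof -
  assume c': "c' \<in> AM"
  have "bounded_linear (\<lambda>x. - complex_of_real (Im x))"
    by (intro bounded_linear_minus bounded_linear_compose[OF bounded_linear_of_real bounded_linear_Im])
  moreover have "smooth_on (cran c') (\<lambda>w. h c' w (v 0) (v 1))"
    using metric c' unfolding hermitian_metric_def by blast
  ultimately show ?thesis
    unfolding fundamental_form_def by (rule smooth_on_linear[OF _ M.chart_open[OF c']])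
qed

lemma \<omega>\<^sub>M_transition:
  assumes "c' \<in> AM" "c'' \<in> AM" "w \<in> M.overlap c' c''"
  shows "\<omega>\<^sub>M c' w v = \<omega>\<^sub>M c'' (in_charts c' c'' id w) (\<lambda>i. frechet_derivative (in_charts c' c'' id) (at w) (v i))"
proof -
  have "h c' w x y = h c'' (in_charts c' c'' id w)
      (frechet_derivative (in_charts c' c'' id) (at w) x) (frechet_derivative (in_charts c' c'' id) (at w) y)" for x y
    using metric assms unfolding hermitian_metric_def M.overlap_def Let_def by blast
  then show ?thesis by (simp add: fundamental_form_def)
qed

text \<open>The pullback of the fundamental form by \<open>f\<close>; by \<open>\<psi>_eq\<close> below, the chart of \<open>M\<close> chosen at each
  point does not matter.\<close>

definition base_chart :: "'b \<Rightarrow> ('b, 'm) chart" where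
  "base_chart y = (SOME c'. c' \<in> AM \<and> y \<in> cdom c')"

definition \<psi> :: "('a, 'n) form" where
  "\<psi> c z = (let c' = base_chart (f (chart_inv c z)) in pullback (in_charts c c' f) (\<omega>\<^sub>M c') z)"

lemma base_chart:
  assumes "c \<in> AN" "z \<in> cran c"
  shows "base_chart (f (chart_inv c z)) \<in> AM" "z \<in> fdom c (base_chart (f (chart_inv c z)))"
proof -
  have "chart_inv c z \<in> topspace N"
    using assms N.chart_inv_right(1)[OF assms(2)] openin_subset[OF N.chart_openin[OF assms(1)]] by auto
  then have "f (chart_inv c z) \<in> topspace M"
    using submersion unfolding holomorphic_submersion_def continuous_map_def by auto
  then have "\<exists>c'. c' \<in> AM \<and> f (chart_inv c z) \<in> cdom c'" using M.cover by blast
  from someI_ex[OF this] show "base_chart (f (chart_inv c z)) \<in> AM" "z \<in> fdom c (base_chart (f (chart_inv c z)))"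
    using assms unfolding base_chart_def[symmetric] by (auto simp: fdom_iff)
qed

text \<open>Near z the two expressions of f differ by a transition map of M, so the chain rule and
  the invariance of the metric give the claim.\<close>

lemma pullback_chart_independent:
  assumes c: "c \<in> AN" and c': "c' \<in> AM" "c'' \<in> AM" and z: "z \<in> fdom c c'" "z \<in> fdom c c''"
  shows "pullback (in_charts c c' f) (\<omega>\<^sub>M c') z = pullback (in_charts c c'' f) (\<omega>\<^sub>M c'') z"
proof
  fix v
  let ?W = "fdom c c' \<inter> fdom c c''" and ?\<tau> = "in_charts c' c'' id"
  have ov: "in_charts c c' f y \<in> M.overlap c' c''" and comp: "in_charts c c'' f y = ?\<tau> (in_charts c c' f y)"
    if "y \<in> ?W" for y
  proof -
    have y: "f (chart_inv c y) \<in> cdom c'" "f (chart_inv c y) \<in> cdom c''" using that c by (auto simp: fdom_iff)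
    then show "in_charts c c' f y \<in> M.overlap c' c''" by (auto simp: M.overlap_def in_charts_eq)
    show "in_charts c c'' f y = ?\<tau> (in_charts c c' f y)"
      using y by (simp add: in_charts_eq M.chart_inv_left[OF c'(1)])
  qed
  have W: "open ?W" "z \<in> ?W" using open_fdom[OF c c'(1)] open_fdom[OF c c'(2)] z by auto
  have D: "frechet_derivative (in_charts c c'' f) (at z) x =
     frechet_derivative ?\<tau> (at (in_charts c c' f z)) (frechet_derivative (in_charts c c' f) (at z) x)" for x
    by (rule frechet_derivative_compose_open[where G = ?\<tau> and H = "in_charts c c' f", OF W comp])
      (auto intro: smooth_on_differentiable[OF f_charts(1)[OF c c'(1)] z(1)]
        smooth_on_differentiable[OF M.smooth_transition[OF c'] ov[OF W(2)]])
  show "pullback (in_charts c c' f) (\<omega>\<^sub>M c') z v = pullback (in_charts c c'' f) (\<omega>\<^sub>M c'') z v"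
    unfolding pullback_def D comp[OF W(2)] by (rule \<omega>\<^sub>M_transition[OF c' ov[OF W(2)]])
qed

lemma \<psi>_eq:
  assumes "c \<in> AN" "c' \<in> AM" "z \<in> fdom c c'"
  shows "\<psi> c z = pullback (in_charts c c' f) (\<omega>\<^sub>M c') z"
proof -
  have "z \<in> cran c" using assms by (simp add: fdom_iff)
  then show ?thesis
    unfolding \<psi>_def Let_def using assms base_chart by (intro pullback_chart_independent)
qed

lemmas pullback_facts = open_fdom M.chart_open f_charts_in_cran f_charts(1) k_covector_\<omega>\<^sub>M smooth_on_\<omega>\<^sub>M

lemma k_covector_\<psi>:
  assumes "c \<in> AN" "z \<in> cran c"
  shows "k_covector 2 (\<psi> c z)"
proof -
  obtain c' where c': "c' \<in> AM" "z \<in> fdom c c'" using base_chart[OF assms] by blast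
  show ?thesis
    unfolding \<psi>_eq[OF assms(1) c']
    by (rule k_covector_pullback[where S = "fdom c c'" and T = "cran c'"])
      (use assms(1) c' in \<open>auto intro: pullback_facts simp del: image_iff\<close>)
qed

lemma smooth_on_\<psi>:
  assumes c: "c \<in> AN"
  shows "smooth_on (cran c) (\<lambda>z. \<psi> c z v)"
proof (rule smooth_on_local)
  fix z assume "z \<in> cran c"
  then obtain c' where c': "c' \<in> AM" "z \<in> fdom c c'" using base_chart[OF c] by blast
  have "smooth_on (fdom c c') (\<lambda>z. pullback (in_charts c c' f) (\<omega>\<^sub>M c') z v)"
    by (rule smooth_on_pullback[where T = "cran c'"]) (use c c' in \<open>blast intro: pullback_facts\<close>)+
  then have "smooth_on (fdom c c') (\<lambda>z. \<psi> c z v)"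
    using \<psi>_eq[OF c c'(1)] smooth_on_cong[OF open_fdom[OF c c'(1)], of "\<lambda>z. \<psi> c z v"] by simp
  then show "\<exists>U. open U \<and> z \<in> U \<and> smooth_on U (\<lambda>z. \<psi> c z v)"
    using open_fdom[OF c c'(1)] c'(2) by blast
qed

text \<open>One chart of M serves both sides, so only the chart of N changes and the chain rule
  suffices.\<close>

lemma \<psi>_transition:
  assumes c: "c1 \<in> AN" "c2 \<in> AN" and z: "z \<in> N.overlap c1 c2"
  shows "\<psi> c1 z v = \<psi> c2 (in_charts c1 c2 id z) (\<lambda>i. frechet_derivative (in_charts c1 c2 id) (at z) (v i))"
proof -
  let ?\<tau> = "in_charts c1 c2 id"
  have z1: "z \<in> cran c1" using z c by (simp add: N.overlap_iff)
  obtain c' where c': "c' \<in> AM" "z \<in> fdom c1 c'" using base_chart[OF c(1) z1] by blast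
  let ?W = "N.overlap c1 c2 \<inter> fdom c1 c'"
  have fd: "?\<tau> y \<in> fdom c2 c'" and comp: "in_charts c1 c' f y = in_charts c2 c' f (?\<tau> y)" if "y \<in> ?W" for y
    using that c c' N.transition_point[OF c, of y] by (auto simp: fdom_iff in_charts_eq[of _ c' f])
  have W: "open ?W" "z \<in> ?W" using open_fdom[OF c(1) c'(1)] N.open_overlap[OF c] c' z by auto
  have D: "frechet_derivative (in_charts c1 c' f) (at z) x =
     frechet_derivative (in_charts c2 c' f) (at (?\<tau> z)) (frechet_derivative ?\<tau> (at z) x)" for x
    by (rule frechet_derivative_compose_open[where G = "in_charts c2 c' f" and H = ?\<tau>, OF W comp])
      (auto intro: smooth_on_differentiable[OF f_charts(1)[OF c(2) c'(1)] fd[OF W(2)]]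
        smooth_on_differentiable[OF N.smooth_transition[OF c] z])
  show ?thesis
    unfolding \<psi>_eq[OF c(1) c'] \<psi>_eq[OF c(2) c'(1) fd[OF W(2)]] pullback_def D comp[OF W(2)] ..
qed

lemma \<psi>_real: "\<psi> c z v \<in> \<real>"
  by (simp add: \<psi>_def Let_def pullback_def fundamental_form_def)

definition \<theta> :: "('a, 'n) form" where
  "\<theta> c z = wedge_power (\<psi> c z) q"

lemma k_covector_\<theta>: "c \<in> AN \<Longrightarrow> z \<in> cran c \<Longrightarrow> k_covector (2 * q) (\<theta> c z)"
  unfolding \<theta>_def by (intro k_covector_wedge_power k_covector_\<psi>)

lemma smooth_on_\<theta>: "c \<in> AN \<Longrightarrow> smooth_on (cran c) (\<lambda>z. \<theta> c z v)"
  unfolding \<theta>_def by (intro smooth_on_wedge_power N.chart_open smooth_on_\<psi>)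

lemma \<theta>_real: "\<theta> c z v \<in> \<real>"
  unfolding \<theta>_def by (intro wedge_power_real \<psi>_real)

lemma \<theta>_transition:
  assumes "c1 \<in> AN" "c2 \<in> AN" "z \<in> N.overlap c1 c2"
  shows "\<theta> c1 z v = \<theta> c2 (in_charts c1 c2 id z) (\<lambda>i. frechet_derivative (in_charts c1 c2 id) (at z) (v i))"
  unfolding \<theta>_def wedge_power_pullback \<psi>_transition[OF assms, symmetric] by simp

text \<open>This is where \<theta> gets type (q,q): the differential of f commutes with the scalar u
  because f is holomorphic, and in the sesquilinear h the factors u and cnj u cancel.\<close>

lemma unitary_invariant_\<theta>:
  assumes "c \<in> AN" "z \<in> cran c"
  shows "unitary_invariant (\<theta> c z)"
  unfolding unitary_invariant_def
proof (intro allI impI)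
  fix u :: complex and v :: "nat \<Rightarrow> complex^'n" assume u: "norm u = 1"
  obtain c' where c': "c' \<in> AM" "z \<in> fdom c c'" using base_chart[OF assms] by blast
  interpret D: Vector_Spaces.linear "(*s)" "(*s)" "frechet_derivative (in_charts c c' f) (at z)"
    by (rule f_charts(2)[OF assms(1) c'])
  note h = hermitian_form_simps[OF metric_at(1)[OF c'(1) f_charts_in_cran[OF assms(1) c'(2)]]]
  have "u * cnj u = 1" using u by (simp add: complex_norm_square[symmetric])
  then have uc: "u * (cnj u * x) = x" "cnj u * (u * x) = x" for x
    by (simp_all add: mult.assoc[symmetric] mult.commute[of "cnj u"])
  have "\<psi> c z (\<lambda>j. u *s v j) = \<psi> c z v" for v
    unfolding \<psi>_eq[OF assms(1) c'] pullback_def fundamental_form_def D.scale h uc ..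
  then show "\<theta> c z (\<lambda>j. u *s v j) = \<theta> c z v"
    unfolding \<theta>_def wedge_power_pullback by simp
qed

lemma ext_deriv_\<theta>:
  assumes c: "c \<in> AN" and z: "z \<in> cran c"
  shows "ext_deriv (2 * q) (\<theta> c) z = (\<lambda>v. 0)"
proof
  fix v
  obtain c' where c': "c' \<in> AM" "z \<in> fdom c c'" using base_chart[OF c z] by blast
  let ?F = "in_charts c c' f"
  have "ext_deriv (2 * q) (\<theta> c) z = ext_deriv (2 * q) (\<lambda>y. wedge_power (pullback ?F (\<omega>\<^sub>M c') y) q) z"
    by (rule ext_deriv_cong_open[OF open_fdom[OF c c'(1)] c'(2)]) (simp add: \<theta>_def \<psi>_eq[OF c c'(1)])
  moreover have "ext_deriv (2 * q) (\<lambda>y. wedge_power (pullback ?F (\<omega>\<^sub>M c') y) q) z v =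
    ext_deriv (2 * q) (\<lambda>w. wedge_power (\<omega>\<^sub>M c' w) q) (?F z) (\<lambda>i. frechet_derivative ?F (at z) (v i))"
    by (rule ext_deriv_wedge_power_pullback[where S = "fdom c c'" and T = "cran c'"])
      (use c c' in \<open>blast intro: pullback_facts\<close>)+
  moreover have "ext_deriv (2 * q) (\<lambda>w. wedge_power (\<omega>\<^sub>M c' w) q) (?F z) = (\<lambda>v. 0)"
    using closed_power c'(1) f_charts_in_cran[OF c c'(2)] unfolding form_eq_def form_d_def by blast
  ultimately show "ext_deriv (2 * q) (\<theta> c) z v = 0" by simp
qed

section \<open>Multiplication of forms by \<theta>\<close>

definition times_\<theta> :: "nat \<Rightarrow> ('a, 'n) form \<Rightarrow> ('a, 'n) form" where
  "times_\<theta> k \<Omega> c z = wedge k (2 * q) (\<Omega> c z) (\<theta> c z)"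

lemma smooth_form_times_\<theta>:
  assumes \<Omega>: "smooth_form AN k \<Omega>"
  shows "smooth_form AN (k + 2 * q) (times_\<theta> k \<Omega>)"
  unfolding smooth_form_def times_\<theta>_def
proof (intro conjI ballI allI)
  fix c z assume "c \<in> AN" "z \<in> cran c"
  then show "k_covector (k + 2 * q) (wedge k (2 * q) (\<Omega> c z) (\<theta> c z))"
    using \<Omega> unfolding smooth_form_def by (intro k_covector_wedge k_covector_\<theta>) auto
next
  fix c v assume "c \<in> AN"
  then show "smooth_on (cran c) (\<lambda>z. wedge k (2 * q) (\<Omega> c z) (\<theta> c z) v)"
    using \<Omega> unfolding smooth_form_def by (intro smooth_on_wedge N.chart_open smooth_on_\<theta>) auto
next
  fix c c' z and v :: "nat \<Rightarrow> complex^'n"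
  assume c: "c \<in> AN" "c' \<in> AN" "z \<in> snd c ` (cdom c \<inter> cdom c')"
  have "\<Omega> c z = (\<lambda>v. \<Omega> c' (in_charts c c' id z) (\<lambda>i. frechet_derivative (in_charts c c' id) (at z) (v i)))"
    using \<Omega> c unfolding smooth_form_def by blast
  moreover have "\<theta> c z = (\<lambda>v. \<theta> c' (in_charts c c' id z) (\<lambda>i. frechet_derivative (in_charts c c' id) (at z) (v i)))"
    using \<theta>_transition[OF c(1,2)] c(3) unfolding N.overlap_def by blast
  ultimately show "wedge k (2 * q) (\<Omega> c z) (\<theta> c z) v =
     wedge k (2 * q) (\<Omega> c' (in_charts c c' id z)) (\<theta> c' (in_charts c c' id z))
       (\<lambda>i. frechet_derivative (in_charts c c' id) (at z) (v i))"
    unfolding wedge_pullback by simp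
qed

lemma bideg_times_\<theta>:
  assumes "smooth_form AN (2 * a) \<Omega>" "c \<in> AN" "z \<in> cran c"
  shows "bideg (a + q) (a + q) (times_\<theta> (2 * a) \<Omega> c z) = wedge (2 * a) (2 * q) (bideg a a (\<Omega> c z)) (\<theta> c z)"
proof -
  have "multilinear (2 * a) (\<Omega> c z)" "multilinear (2 * q) (\<theta> c z)"
    using assms k_covector_\<theta>[OF assms(2,3)] unfolding smooth_form_def k_covector_iff by blast+
  from bideg_wedge[OF this unitary_invariant_\<theta>[OF assms(2,3)], of "a + q" "a + q"] show ?thesis
    by (simp add: times_\<theta>_def)
qed

text \<open>K is the kernel of the differential of f, because the \<open>\<gamma> i\<close> have
  trivial common kernel, and surjectivity bounds its dimension by a. Hence every subspace meets K in
  dimension at most a, and \<open>positive_mod\<close> amounts to strict positivity on all of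
  them.\<close>

lemma strictly_weakly_positive_times_\<theta>:
  assumes \<eta>: "k_covector (2 * a) \<eta>" "strictly_weakly_positive a \<eta>" and a: "a + CARD('m) = CARD('n)"
    and c: "c \<in> AN" "z \<in> cran c"
  shows "strictly_weakly_positive (a + q) (wedge (2 * a) (2 * q) \<eta> (\<theta> c z))"
proof -
  obtain c' where c': "c' \<in> AM" "z \<in> fdom c c'" using base_chart[OF c] by blast
  define D where "D = frechet_derivative (in_charts c c' f) (at z)"
  have D: "Vector_Spaces.linear (*s) (*s) D" "surj D"
    unfolding D_def using f_charts(2,3)[OF c(1) c'] by auto
  obtain \<gamma> :: "'m \<Rightarrow> complex^'m \<Rightarrow> complex" where \<gamma>: "\<And>i. Vector_Spaces.linear (*s) (*) (\<gamma> i)"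
    "\<omega>\<^sub>M c' (in_charts c c' f z) = (\<lambda>v. \<Sum>i\<in>UNIV. rank_one (\<gamma> i) v)" "\<And>u. (\<forall>i. \<gamma> i u = 0) \<Longrightarrow> u = 0"
    using fundamental_form_rank_one[OF c'(1) f_charts_in_cran[OF c(1) c'(2)]] by blast
  define \<beta> where "\<beta> i = \<gamma> i \<circ> D" for i
  have \<beta>: "Vector_Spaces.linear (*s) (*) (\<beta> i)" for i
    unfolding \<beta>_def by (rule Vector_Spaces.linear_compose[OF D(1) \<gamma>(1)])
  have \<psi>: "\<psi> c z = (\<lambda>v. \<Sum>i\<in>UNIV. rank_one (\<beta> i) v)"
    unfolding \<psi>_eq[OF c(1) c'] pullback_def[abs_def] \<gamma>(2) D_def[symmetric]
    by (simp add: rank_one_def \<beta>_def)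
  define K where "K = {x. \<forall>i\<in>UNIV. \<beta> i x = 0}"
  interpret D: Vector_Spaces.linear "(*s)" "(*s)" D by (rule D(1))
  have \<gamma>0: "\<gamma> i 0 = 0" for i
  proof -
    interpret G: Vector_Spaces.linear "(*s)" "(*)" "\<gamma> i" by (rule \<gamma>(1))
    show ?thesis by (rule G.zero)
  qed
  have "K = {x. D x = 0}"
    unfolding K_def \<beta>_def using \<gamma>(3) \<gamma>0 by auto
  then have dimK: "vec.dim K \<le> a" using dim_kernel_surj[OF D] a by simp
  \<comment> \<open>The induction on the power starts in degree a, where transversality is already
    strict on every subspace.\<close>
  have "positive_mod a K a \<eta>"
    unfolding positive_mod_def
  proof (intro allI impI)
    fix e :: "nat \<Rightarrow> complex^'n" assume e: "fam_indep a e"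
    have "positive_volume_on a \<eta> (vec.span (e ` {..<a}))"
      using \<eta>(2) fam_indep_dim[OF e] unfolding strictly_weakly_positive_def by (auto simp del: vec.dim_span)
    then have "Re (\<eta> (jseq e)) > 0"
      using fam_indepD_basis[OF e] unfolding positive_volume_on_def jseq_def by blast
    then show "0 \<le> Re (\<eta> (jseq e)) \<and> (vec.dim (vec.span (e ` {..<a}) \<inter> K) \<le> a \<longrightarrow> 0 < Re (\<eta> (jseq e)))"
      by simp
  qed
  then have pos: "positive_mod a K (a + q) (wedge (2 * a) (2 * q) \<eta> (\<theta> c z))"
    unfolding \<theta>_def
    by (intro positive_mod_wedge_power[where L = UNIV and \<beta> = \<beta>]) (auto simp: \<beta> K_def \<psi> \<eta>(1))
  show ?thesis
    unfolding strictly_weakly_positive_def positive_volume_on_def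
  proof (intro allI impI)
    fix V :: "(complex^'n) set" and e
    assume e: "inj_on e {..<a + q} \<and> vec.independent (e ` {..<a + q}) \<and> vec.span (e ` {..<a + q}) = V"
    have "vec.dim (vec.span (e ` {..<a + q}) \<inter> K) \<le> vec.dim K" by (rule vec.dim_subset) auto
    with dimK have "vec.dim (vec.span (e ` {..<a + q}) \<inter> K) \<le> a" by linarith
    then show "0 < Re (wedge (2 * a) (2 * q) \<eta> (\<theta> c z) (\<lambda>i. if even i then e (i div 2) else \<i> *s e (i div 2)))"
      using pos fam_indepI_basis[of e "a + q"] e unfolding positive_mod_def jseq_def by blast
  qed
qed

lemma transverse_times_\<theta>:
  assumes \<Omega>: "transverse_form AN a \<Omega>" and a: "a + CARD('m) = CARD('n)"
  shows "transverse_form AN (a + q) (times_\<theta> (2 * a) \<Omega>)"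
  unfolding transverse_form_def
proof (intro conjI ballI)
  have sm: "smooth_form AN (2 * a) \<Omega>" using \<Omega> by (simp add: transverse_form_def)
  show "smooth_form AN (2 * (a + q)) (times_\<theta> (2 * a) \<Omega>)"
    using smooth_form_times_\<theta>[OF sm] by (simp add: distrib_left)
  show "real_form AN (times_\<theta> (2 * a) \<Omega>)"
    using \<Omega> unfolding real_form_def transverse_form_def times_\<theta>_def by (auto intro!: wedge_real \<theta>_real)
  show "form_eq AN (form_component (a + q) (a + q) (times_\<theta> (2 * a) \<Omega>)) (times_\<theta> (2 * a) \<Omega>)"
    using \<Omega> unfolding form_eq_def form_component_def transverse_form_def
    by (simp add: bideg_times_\<theta>[OF sm]) (simp add: times_\<theta>_def)
  fix c z assume "c \<in> AN" "z \<in> cran c"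
  then show "strictly_weakly_positive (a + q) (times_\<theta> (2 * a) \<Omega> c z)"
    unfolding times_\<theta>_def using \<Omega> a
    by (intro strictly_weakly_positive_times_\<theta>) (auto simp: transverse_form_def smooth_form_def)
qed

text \<open>A form that need not be alternating: the Dolbeault derivatives of smooth forms are of this kind
  without further work.\<close>

definition multilinear_form :: "nat \<Rightarrow> ('a, 'n) form \<Rightarrow> bool" where
  "multilinear_form k \<omega> \<longleftrightarrow>
     (\<forall>c\<in>AN. (\<forall>z\<in>cran c. multilinear k (\<omega> c z)) \<and> (\<forall>v. smooth_on (cran c) (\<lambda>z. \<omega> c z v)))"

lemma smooth_form_multilinear: "smooth_form AN k \<omega> \<Longrightarrow> multilinear_form k \<omega>"
  unfolding smooth_form_def multilinear_form_def k_covector_iff by blast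

lemma multilinear_form_delbar:
  assumes "multilinear_form k \<omega>"
  shows "multilinear_form (Suc k) (form_delbar k \<omega>)"
  unfolding multilinear_form_def form_delbar_local
proof (intro ballI conjI allI)
  fix c assume c: "c \<in> AN"
  have \<omega>: "\<And>z. z \<in> cran c \<Longrightarrow> multilinear k (\<omega> c z)" "\<And>v. smooth_on (cran c) (\<lambda>z. \<omega> c z v)"
    using assms c unfolding multilinear_form_def by auto
  show "multilinear (Suc k) (local_delbar k (\<omega> c) z)" if "z \<in> cran c" for z
    by (rule multilinear_local_delbar[OF N.chart_open[OF c] that \<omega>(1) smooth_on_differentiable[OF \<omega>(2) that]])
  show "smooth_on (cran c) (\<lambda>z. local_delbar k (\<omega> c) z v)" for v
    by (intro smooth_on_local_delbar N.chart_open c \<omega>(2))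
qed

lemma
  assumes "multilinear_form k \<omega>" and c: "c \<in> AN" and z: "z \<in> cran c"
  shows form_del_times_\<theta>: "form_del (k + 2 * q) (times_\<theta> k \<omega>) c z = times_\<theta> (Suc k) (form_del k \<omega>) c z"
    and form_delbar_times_\<theta>: "form_delbar (k + 2 * q) (times_\<theta> k \<omega>) c z = times_\<theta> (Suc k) (form_delbar k \<omega>) c z"
    and form_d_times_\<theta>: "form_d (k + 2 * q) (times_\<theta> k \<omega>) c z = times_\<theta> (Suc k) (form_d k \<omega>) c z"
proof -
  have \<omega>: "\<And>z. z \<in> cran c \<Longrightarrow> multilinear k (\<omega> c z)" "\<And>v. smooth_on (cran c) (\<lambda>z. \<omega> c z v)"
    using assms c unfolding multilinear_form_def by auto
  have \<theta>ml: "\<And>z. z \<in> cran c \<Longrightarrow> multilinear (2 * q) (\<theta> c z)"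
    using k_covector_\<theta>[OF c] by (simp add: k_covector_iff)
  note facts = N.chart_open[OF c] z \<omega>(1) smooth_on_differentiable[OF \<omega>(2) z] \<theta>ml unitary_invariant_\<theta>[OF c]
    smooth_on_differentiable[OF smooth_on_\<theta>[OF c] z] ext_deriv_\<theta>[OF c z]
  show "form_del (k + 2 * q) (times_\<theta> k \<omega>) c z = times_\<theta> (Suc k) (form_del k \<omega>) c z"
    unfolding form_del_local times_\<theta>_def by (rule local_del_wedge[OF facts])
  show "form_delbar (k + 2 * q) (times_\<theta> k \<omega>) c z = times_\<theta> (Suc k) (form_delbar k \<omega>) c z"
    unfolding form_delbar_local times_\<theta>_def by (rule local_delbar_wedge[OF facts])
  show "form_d (k + 2 * q) (times_\<theta> k \<omega>) c z = times_\<theta> (Suc k) (form_d k \<omega>) c z"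
    unfolding form_d_def times_\<theta>_def
    using ext_deriv_wedge[OF smooth_on_differentiable[OF \<omega>(2) z] smooth_on_differentiable[OF smooth_on_\<theta>[OF c] z]
        multilinear_local[OF \<omega>(1)[OF z]], of "2 * q"]
    by (simp add: fun_eq_iff ext_deriv_\<theta>[OF c z] wedge_zero_right)
qed

lemma form_del_cong:
  assumes "\<And>c z. c \<in> AN \<Longrightarrow> z \<in> cran c \<Longrightarrow> \<omega> c z = \<omega>' c z" "c \<in> AN" "z \<in> cran c"
  shows "form_del k \<omega> c z = form_del k \<omega>' c z"
  unfolding form_del_local using assms
  by (intro local_del_cong_open[OF N.chart_open[OF assms(2)]]) auto

text \<open>The outer operator differentiates, so the rule for delbar is used on the whole chart
  range before the rule for del is applied at z.\<close>

lemma form_del_delbar_times_\<theta>: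
  assumes "smooth_form AN k \<omega>" and c: "c \<in> AN" and z: "z \<in> cran c"
  shows "form_del (Suc (k + 2 * q)) (form_delbar (k + 2 * q) (times_\<theta> k \<omega>)) c z
    = times_\<theta> (Suc (Suc k)) (form_del (Suc k) (form_delbar k \<omega>)) c z"
proof -
  note ml = smooth_form_multilinear[OF assms(1)]
  have "form_del (Suc (k + 2 * q)) (form_delbar (k + 2 * q) (times_\<theta> k \<omega>)) c z
     = form_del (Suc k + 2 * q) (times_\<theta> (Suc k) (form_delbar k \<omega>)) c z"
    using form_del_cong[OF form_delbar_times_\<theta>[OF ml] c z, where k = "Suc k + 2 * q"] by simp
  also have "\<dots> = times_\<theta> (Suc (Suc k)) (form_del (Suc k) (form_delbar k \<omega>)) c z"
    by (rule form_del_times_\<theta>[OF multilinear_form_delbar[OF ml] c z])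
  finally show ?thesis .
qed

lemma times_\<theta>_zero: "\<Omega> c z = (\<lambda>v. 0) \<Longrightarrow> times_\<theta> k \<Omega> c z = (\<lambda>v. 0)"
  by (simp add: times_\<theta>_def wedge_zero_left)

section \<open>Transfer of the four types from degree a to degree a + q\<close>

lemma p_kaehler_times:
  assumes "p_kaehler AN a" and a: "a + CARD('m) = CARD('n)"
  shows "p_kaehler AN (a + q)"
proof -
  obtain \<Omega> where \<Omega>: "transverse_form AN a \<Omega>" "form_eq AN (form_del (2 * a) \<Omega>) zero_form"
    using assms(1) unfolding p_kaehler_def by blast
  have ml: "multilinear_form (2 * a) \<Omega>"
    using \<Omega>(1) smooth_form_multilinear unfolding transverse_form_def by blast
  have "form_del (2 * (a + q)) (times_\<theta> (2 * a) \<Omega>) c z = (\<lambda>v. 0)" if "c \<in> AN" "z \<in> cran c" for c z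
  proof -
    have "form_del (2 * a) \<Omega> c z = (\<lambda>v. 0)" using \<Omega>(2) that unfolding form_eq_def by blast
    from times_\<theta>_zero[of "form_del (2 * a) \<Omega>" c z "Suc (2 * a)", OF this]
    show ?thesis by (simp add: distrib_left form_del_times_\<theta>[OF ml that])
  qed
  then show ?thesis
    unfolding p_kaehler_def form_eq_def using transverse_times_\<theta>[OF \<Omega>(1) a] by blast
qed

lemma weakly_p_kaehler_times:
  assumes "weakly_p_kaehler AN a" and a: "a + CARD('m) = CARD('n)" "0 < a"
  shows "weakly_p_kaehler AN (a + q)"
proof -
  obtain \<Omega> \<alpha> where \<Omega>: "transverse_form AN a \<Omega>" "smooth_form AN (2 * a - 1) \<alpha>"
    "form_eq AN (form_del (2 * a) \<Omega>) (form_del (2 * a) (form_delbar (2 * a - 1) \<alpha>))"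
    using assms(1) unfolding weakly_p_kaehler_def by blast
  have ml: "multilinear_form (2 * a) \<Omega>"
    using \<Omega>(1) smooth_form_multilinear unfolding transverse_form_def by blast
  \<comment> \<open>Positivity of a makes the truncated degree 2a - 1 exact, so that delbar of the
    potential, before and after wedging with \<theta>, has the degree of the form it is compared
    with.\<close>
  have deg: "2 * (a + q) = 2 * a + 2 * q" "2 * a + 2 * q - 1 = 2 * a - 1 + 2 * q"
    "2 * a + 2 * q = Suc (2 * a - 1 + 2 * q)" "Suc (2 * a - 1) = 2 * a" using a by auto
  have "form_del (2 * (a + q)) (times_\<theta> (2 * a) \<Omega>) c z
      = form_del (2 * (a + q)) (form_delbar (2 * (a + q) - 1) (times_\<theta> (2 * a - 1) \<alpha>)) c z"
    if "c \<in> AN" "z \<in> cran c" for c z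
  proof -
    have eq: "form_del (2 * a) \<Omega> c z = form_del (2 * a) (form_delbar (2 * a - 1) \<alpha>) c z"
      using \<Omega>(3) that unfolding form_eq_def by blast
    have "form_del (2 * a + 2 * q) (times_\<theta> (2 * a) \<Omega>) c z = times_\<theta> (Suc (2 * a)) (form_del (2 * a) \<Omega>) c z"
      by (rule form_del_times_\<theta>[OF ml that])
    also have "\<dots> = times_\<theta> (Suc (2 * a)) (form_del (2 * a) (form_delbar (2 * a - 1) \<alpha>)) c z"
      by (simp only: times_\<theta>_def eq)
    also have "\<dots> = form_del (Suc (2 * a - 1 + 2 * q)) (form_delbar (2 * a - 1 + 2 * q) (times_\<theta> (2 * a - 1) \<alpha>)) c z"
      using form_del_delbar_times_\<theta>[OF \<Omega>(2) that] unfolding deg(4) by simp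
    finally show ?thesis by (simp only: deg(1,2) deg(3)[symmetric])
  qed
  moreover have "smooth_form AN (2 * (a + q) - 1) (times_\<theta> (2 * a - 1) \<alpha>)"
    unfolding deg(1,2) by (rule smooth_form_times_\<theta>[OF \<Omega>(2)])
  ultimately show ?thesis
    unfolding weakly_p_kaehler_def form_eq_def using transverse_times_\<theta>[OF \<Omega>(1) a(1)] by blast
qed

lemma p_symplectic_times:
  assumes "p_symplectic AN a" and a: "a + CARD('m) = CARD('n)"
  shows "p_symplectic AN (a + q)"
proof -
  obtain \<Psi> where \<Psi>: "smooth_form AN (2 * a) \<Psi>" "real_form AN \<Psi>" "form_eq AN (form_d (2 * a) \<Psi>) zero_form"
    "transverse_form AN a (form_component a a \<Psi>)"
    using assms(1) unfolding p_symplectic_def by blast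
  let ?\<Psi> = "times_\<theta> (2 * a) \<Psi>"
  have "form_d (2 * (a + q)) ?\<Psi> c z = (\<lambda>v. 0)" if "c \<in> AN" "z \<in> cran c" for c z
  proof -
    have "form_d (2 * a) \<Psi> c z = (\<lambda>v. 0)" using \<Psi>(3) that unfolding form_eq_def by blast
    from times_\<theta>_zero[of "form_d (2 * a) \<Psi>" c z "Suc (2 * a)", OF this]
    show ?thesis by (simp add: distrib_left form_d_times_\<theta>[OF smooth_form_multilinear[OF \<Psi>(1)] that])
  qed
  moreover have "transverse_form AN (a + q) (form_component (a + q) (a + q) ?\<Psi>)"
  \<comment> \<open>Wedging with \<theta> and taking the middle component commute at points of the
    chart ranges, so transversality is carried over by equality of forms in the sense of
    \<open>form_eq\<close>.\<close>
  proof (rule transverse_form_cong[OF N.compact_complex_manifold_axioms _ transverse_times_\<theta>[OF \<Psi>(4) a]])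
    show "form_eq AN (times_\<theta> (2 * a) (form_component a a \<Psi>)) (form_component (a + q) (a + q) ?\<Psi>)"
      unfolding form_eq_def form_component_def
      by (simp add: bideg_times_\<theta>[OF \<Psi>(1)]) (simp add: times_\<theta>_def)
  qed
  moreover have "real_form AN ?\<Psi>"
    using \<Psi>(2) unfolding real_form_def times_\<theta>_def by (auto intro!: wedge_real \<theta>_real)
  moreover have "smooth_form AN (2 * (a + q)) ?\<Psi>"
    using smooth_form_times_\<theta>[OF \<Psi>(1)] by (simp add: distrib_left)
  ultimately show ?thesis unfolding p_symplectic_def form_eq_def by blast
qed

lemma p_pluriclosed_times:
  assumes "p_pluriclosed AN a" and a: "a + CARD('m) = CARD('n)"
  shows "p_pluriclosed AN (a + q)"
proof -
  obtain \<Omega> where \<Omega>: "transverse_form AN a \<Omega>"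
    "form_eq AN (form_del (2 * a + 1) (form_delbar (2 * a) \<Omega>)) zero_form"
    using assms(1) unfolding p_pluriclosed_def by blast
  have sm: "smooth_form AN (2 * a) \<Omega>" using \<Omega>(1) unfolding transverse_form_def by blast
  have "form_del (2 * (a + q) + 1) (form_delbar (2 * (a + q)) (times_\<theta> (2 * a) \<Omega>)) c z = (\<lambda>v. 0)"
    if "c \<in> AN" "z \<in> cran c" for c z
  proof -
    have "form_del (2 * a + 1) (form_delbar (2 * a) \<Omega>) c z = (\<lambda>v. 0)"
      using \<Omega>(2) that unfolding form_eq_def by blast
    then have "form_del (Suc (2 * a)) (form_delbar (2 * a) \<Omega>) c z = (\<lambda>v. 0)" by simp
    from times_\<theta>_zero[of "form_del (Suc (2 * a)) (form_delbar (2 * a) \<Omega>)" c z "Suc (Suc (2 * a))", OF this]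
    show ?thesis using form_del_delbar_times_\<theta>[OF sm that] by (simp add: distrib_left)
  qed
  then show ?thesis
    unfolding p_pluriclosed_def form_eq_def using transverse_times_\<theta>[OF \<Omega>(1) a] by blast
qed

end

theorem theorem3p8:
  fixes N :: "'a topology" and A\<^sub>N :: "('a, 'n::finite) chart set"
    and M :: "'b topology" and A\<^sub>M :: "('b, 'm::finite) chart set"
    and f :: "'a \<Rightarrow> 'b" and n m a :: nat and X :: p_type
  assumes "n = CARD('n)" and "m = CARD('m)" and "a = n - m"
    and "n > m" and "m \<ge> 3"
    and "compact_complex_manifold N A\<^sub>N" and "connected_space N"
    and "compact_complex_manifold M A\<^sub>M" and "connected_space M"
    and "holomorphic_submersion N A\<^sub>N M A\<^sub>M f"
    and "balanced A\<^sub>M"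
    and "has_p_type X a A\<^sub>N"
  shows "has_p_type X (n - 1) A\<^sub>N"
proof -
  obtain h where h: "hermitian_metric A\<^sub>M h"
    "form_eq A\<^sub>M (form_d (2 * (m - 1)) (\<lambda>c z. wedge_power (fundamental_form h c z) (m - 1))) zero_form"
    using assms(2,11) unfolding balanced_def by blast
  interpret hermitian_submersion N A\<^sub>N M A\<^sub>M f h "m - 1"
    using assms(6,8,10) h by (intro hermitian_submersion.intro hermitian_submersion_axioms.intro)
  \<comment> \<open>Since 1 \<le> m < n, all the truncated subtractions are exact.\<close>
  have a: "a + CARD('m) = CARD('n)" "0 < a" "a + (m - 1) = n - 1" using assms(1-5) by auto
  have "has_p_type X (a + (m - 1)) A\<^sub>N"
    using assms(12) p_kaehler_times[OF _ a(1)] weakly_p_kaehler_times[OF _ a(1,2)]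
      p_symplectic_times[OF _ a(1)] p_pluriclosed_times[OF _ a(1)]
    by (cases X) simp_all
  then show ?thesis by (simp only: a(3))
qed

end
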